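(* Let $X: f=0$ be a reduced surface of degree $d\ge 3$ in $\mathbb{P}^3$ over $\mathbb{C}$, and let $\mathbf d=(d_1,\dots,d_p)$, $\mathbf c=(c_1,\dots,c_q)$, $\mathbf b=(b_1,\dots,b_r)$ be the graded Betti numbers of the Jacobian algebra $M(f)$, i.e. the degrees appearing in the minimal resolution $$0 \to \bigoplus_{k=1}^{r} S(1-d-b_k)\to \bigoplus_{j=1}^{q} S(1-d-c_j)\to \bigoplus_{i=1}^{p} S(1-d-d_i)\to S^4(1-d)\to S$$ of $M(f)$. Then the following hold. (1) One has $$p+r=q+3\quad\text{and}\quad \sum_{i=1}^p d_i-\sum_{j=1}^q c_j+\sum_{k=1}^r b_k=d-1.$$ (2) The surface $X$ has at most isolated singularities if and only if $$(d-1)^2+\sum_{i=1}^p d_i^2-\sum_{j=1}^q c_j^2+\sum_{k=1}^r b_k^2=0.$$ If this is the case, then the total Tjurina number $\tau(X)$ of $X$ is given by $$6\tau(X)=(d-1)^3-\sum_{i=1}^p d_i^3+\sum_{j=1}^q c_j^3-\sum_{k=1}^r b_k^3.$$ (3) The surface $X$ is smooth if and only if $p=6$, $q=4$, $r=1$, and $d_i=d-1$ for all $i=1,\dots,6$, $c_j=2(d-1)$ for all $j=1,\dots,4$, and $b_1=3(d-1)$. (4) If the singular subscheme $\Sigma$ of $X$ is $1$-dimensional, then the Hilbert polynomial $P(M(f))$ of $M(f)$ is given by $$P(M(f))(u)=\frac{A}{2}u-B,$$ where $$A=(d-1)^2+\sum_{i=1}^p d_i^2-\sum_{j=1}^q c_j^2+\sum_{k=1}^r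 b_k^2$$ and $$B=\frac{d(d-3)^2-4}{3}+\frac{d-3}{2}\left(\sum_{i=1}^p d_i^2-\sum_{j=1}^q c_j^2+\sum_{k=1}^r b_k^2\right)+\frac16\left(\sum_{i=1}^p d_i^3-\sum_{j=1}^q c_j^3+\sum_{k=1}^r b_k^3\right).$$
   Context: $S=\mathbb{C}[x,y,z,t]$ with its standard grading; $f\in S$ is a homogeneous polynomial of degree $d$ and $X:f=0$ is reduced, i.e. $f$ is squarefree. $J_f\subset S$ is the Jacobian ideal generated by the partial derivatives $f_x,f_y,f_z,f_t$, and $M(f)=S/J_f$ is the (graded) Jacobian algebra. In the resolution, the map $S^4(1-d)\to S$ is given by $(f_x,f_y,f_z,f_t)$, and the remaining part is the minimal graded free resolution of its kernel, the (shifted) module of Jacobian syzygies $AR(f)=\{(a^x,a^y,a^z,a^t)\in S^4: a^xf_x+a^yf_y+a^zf_z+a^tf_t=0\}$. Here $p\ge 3$, $q\ge 0$, $r\ge 0$, sums over empty index sets are $0$, and the sequences are ordered increasingly: $d_1\le\dots\le d_p$, $c_1\le\dots\le c_q$, $b_1\le\dots\le b_r$. The Hilbert polynomial $P(M(f))\in\mathbb{Q}[u]$ is the unique polynomial with $\dim_{\mathbb C} M(f)_k=P(M(f))(k)$ for all sufficiently large integers $k$. $\Sigma\subset\mathbb{P}^3$ is the singular subscheme of $X$, defined by $J_f$. $X$ has at most isolated singularities if $\Sigma$ is finite or empty; in that case $\tau(X)=\sum_{s\in\Sigma}\tau(X,s)$, where $\tau(X,s)$ is the Tjurina number of the isolated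 singularity $(X,s)$ (so $\tau(X)=0$ when $X$ is smooth). *)

theory Defs
  imports
    Complex_Main
    "HOL-Library.Poly_Mapping"
    "HOL-Library.Numeral_Type"
    "HOL-Computational_Algebra.Polynomial"
    "HOL-Computational_Algebra.Squarefree"
    "HOL-Computational_Algebra.Fraction_Field"
    "Jordan_Normal_Form.Matrix"
begin

section \<open>The polynomial ring in four variables\<close>

text \<open>The type \<open>4\<close> from Numeral_Type serves only as a four-element index set for the variables;
  its modular arithmetic is never used. Ring operations on polynomials are the convolution product
  and pointwise sum of Poly_Mapping.\<close>

type_synonym monom4 = "4 \<Rightarrow>\<^sub>0 nat"
type_synonym poly4 = "monom4 \<Rightarrow>\<^sub>0 complex"

definition Const :: "complex \<Rightarrow> poly4" where
  "Const c = Poly_Mapping.single 0 c"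

definition Var :: "4 \<Rightarrow> poly4" where
  "Var i = Poly_Mapping.single (Poly_Mapping.single i 1) 1"

definition mdeg :: "monom4 \<Rightarrow> nat" where
  "mdeg m = (\<Sum>i\<in>UNIV. Poly_Mapping.lookup m i)"

text \<open>The degree is an integer: for negative \<open>k\<close> only the zero polynomial qualifies, as for the
  graded piece \<open>S\<^sub>k\<close> of \<open>S\<close>.\<close>

definition homogeneous :: "int \<Rightarrow> poly4 \<Rightarrow> bool" where
  "homogeneous k p \<longleftrightarrow> (\<forall>m\<in>Poly_Mapping.keys p. int (mdeg m) = k)"

definition pd :: "4 \<Rightarrow> poly4 \<Rightarrow> poly4" where
  "pd i p = (\<Sum>m\<in>Poly_Mapping.keys p.
     Poly_Mapping.single (m - Poly_Mapping.single i 1)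
       (of_nat (Poly_Mapping.lookup m i) * Poly_Mapping.lookup p m))"

definition peval :: "(4 \<Rightarrow> complex) \<Rightarrow> poly4 \<Rightarrow> complex" where
  "peval v p = (\<Sum>m\<in>Poly_Mapping.keys p.
     Poly_Mapping.lookup p m * (\<Prod>i\<in>UNIV. v i ^ Poly_Mapping.lookup m i))"

definition psubst :: "(4 \<Rightarrow> poly4) \<Rightarrow> poly4 \<Rightarrow> poly4" where
  "psubst v p = (\<Sum>m\<in>Poly_Mapping.keys p.
     Const (Poly_Mapping.lookup p m) * (\<Prod>i\<in>UNIV. v i ^ Poly_Mapping.lookup m i))"

section \<open>Dimension of a quotient of complex vector spaces\<close>

text \<open>The classes of the elements of \<open>B\<close> form a basis of \<open>V/W\<close>, where \<open>W \<subseteq> V\<close> are subspaces.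
  The dimension \<open>quot_dim\<close> is meaningful only when \<open>V/W\<close> is finite-dimensional.\<close>

definition quot_basis ::
  "(complex \<Rightarrow> 'a \<Rightarrow> 'a) \<Rightarrow> 'a::ab_group_add set \<Rightarrow> 'a set \<Rightarrow> 'a set \<Rightarrow> bool" where
  "quot_basis scale V W B \<longleftrightarrow> finite B \<and> B \<subseteq> V \<and>
     (\<forall>c. (\<Sum>b\<in>B. scale (c b) b) \<in> W \<longrightarrow> (\<forall>b\<in>B. c b = 0)) \<and>
     (\<forall>v\<in>V. \<exists>c. v - (\<Sum>b\<in>B. scale (c b) b) \<in> W)"

definition quot_dim ::
  "(complex \<Rightarrow> 'a \<Rightarrow> 'a) \<Rightarrow> 'a::ab_group_add set \<Rightarrow> 'a set \<Rightarrow> nat" where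
  "quot_dim scale V W = (THE n. \<exists>B. quot_basis scale V W B \<and> card B = n)"

section \<open>Jacobian algebra and Hilbert polynomial\<close>

definition jacobian_ideal :: "poly4 \<Rightarrow> poly4 set" where
  "jacobian_ideal f = {\<Sum>i\<in>UNIV. a i * pd i f | a. True}"

text \<open>The dimension of \<open>M(f)\<^sub>k = S\<^sub>k / (J\<^sub>f \<inter> S\<^sub>k)\<close>.\<close>

definition hilbert_fun :: "poly4 \<Rightarrow> nat \<Rightarrow> nat" where
  "hilbert_fun f k = quot_dim (\<lambda>c p. Const c * p)
     {p. homogeneous (int k) p} (jacobian_ideal f \<inter> {p. homogeneous (int k) p})"

definition hilbert_poly :: "poly4 \<Rightarrow> rat poly" where
  "hilbert_poly f = (THE P. \<exists>k0. \<forall>k\<ge>k0. of_nat (hilbert_fun f k) = poly P (of_nat k))"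

section \<open>Jacobian syzygies and their minimal free resolution\<close>

text \<open>The components of a vector are numbered by \<open>nat\<close>; \<open>of_nat\<close> maps \<open>{0..<4}\<close> bijectively onto
  the index type \<open>4\<close>.\<close>

definition AR :: "poly4 \<Rightarrow> poly4 vec set" where
  "AR f = {v \<in> carrier_vec 4. (\<Sum>i<4. v $ i * pd (of_nat i) f) = 0}"

definition graded_mat :: "int list \<Rightarrow> int list \<Rightarrow> poly4 mat \<Rightarrow> bool" where
  "graded_mat es ds A \<longleftrightarrow> A \<in> carrier_mat (length es) (length ds) \<and>
     (\<forall>i<length es. \<forall>j<length ds. homogeneous (ds ! j - es ! i) (A $$ (i, j)))"

definition minimal_mat :: "poly4 mat \<Rightarrow> bool" where
  "minimal_mat A \<longleftrightarrow>
     (\<forall>i<dim_row A. \<forall>j<dim_col A. Poly_Mapping.lookup (A $$ (i, j)) 0 = 0)"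

text \<open>The lists \<open>ds\<close>, \<open>cs\<close>, \<open>bs\<close> are the degrees in a minimal graded free resolution
  \<open>0 \<rightarrow> \<Oplus> S(-b\<^sub>k) \<rightarrow> \<Oplus> S(-c\<^sub>j) \<rightarrow> \<Oplus> S(-d\<^sub>i) \<rightarrow> AR(f) \<rightarrow> 0\<close>, with \<open>AR(f) \<subseteq> S\<^sup>4\<close>; twisting by \<open>1-d\<close> and
  splicing with the gradient \<open>S\<^sup>4(1-d) \<rightarrow> S\<close> gives the resolution of \<open>M(f)\<close>. Minimality is
  required of \<open>B\<close> and \<open>C\<close> only, since the resolution is the minimal one of \<open>AR(f)\<close>: entries of \<open>A\<close>
  may be nonzero constants, which happens when the partial derivatives are linearly dependent.\<close>

definition graded_betti :: "poly4 \<Rightarrow> int list \<Rightarrow> int list \<Rightarrow> int list \<Rightarrow> bool" where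
  "graded_betti f ds cs bs \<longleftrightarrow> sorted ds \<and> sorted cs \<and> sorted bs \<and>
     (\<exists>A B C. graded_mat [0, 0, 0, 0] ds A \<and> graded_mat ds cs B \<and> graded_mat cs bs C \<and>
        minimal_mat B \<and> minimal_mat C \<and>
        (\<lambda>v. A *\<^sub>v v) ` carrier_vec (length ds) = AR f \<and>
        (\<lambda>v. B *\<^sub>v v) ` carrier_vec (length cs)
          = {v \<in> carrier_vec (length ds). A *\<^sub>v v = 0\<^sub>v 4} \<and>
        (\<lambda>v. C *\<^sub>v v) ` carrier_vec (length bs)
          = {v \<in> carrier_vec (length cs). B *\<^sub>v v = 0\<^sub>v (length ds)} \<and>
        (\<forall>v \<in> carrier_vec (length bs). C *\<^sub>v v = 0\<^sub>v (length cs) \<longrightarrow> v = 0\<^sub>v (length bs)))"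

section \<open>Projective space and the singular locus\<close>

type_synonym ppoint = "(4 \<Rightarrow> complex) set"

definition proj_rel :: "((4 \<Rightarrow> complex) \<times> (4 \<Rightarrow> complex)) set" where
  "proj_rel = {(v, w). v \<noteq> (\<lambda>_. 0) \<and> (\<exists>c. c \<noteq> 0 \<and> w = (\<lambda>i. c * v i))}"

definition P3 :: "ppoint set" where
  "P3 = {v. v \<noteq> (\<lambda>_. 0)} // proj_rel"

definition sing_locus :: "poly4 \<Rightarrow> ppoint set" where
  "sing_locus f = {s \<in> P3. \<forall>v\<in>s. \<forall>i. peval v (pd i f) = 0}"

definition smooth_surface :: "poly4 \<Rightarrow> bool" where
  "smooth_surface f \<longleftrightarrow> sing_locus f = {}"

definition isolated_singularities :: "poly4 \<Rightarrow> bool" where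
  "isolated_singularities f \<longleftrightarrow> finite (sing_locus f)"

definition proj_closed :: "ppoint set \<Rightarrow> bool" where
  "proj_closed Z \<longleftrightarrow> (\<exists>G. (\<forall>g\<in>G. \<exists>k. homogeneous k g) \<and>
     Z = {s \<in> P3. \<forall>g\<in>G. \<forall>v\<in>s. peval v g = 0})"

definition proj_irreducible :: "ppoint set \<Rightarrow> bool" where
  "proj_irreducible Z \<longleftrightarrow> proj_closed Z \<and> Z \<noteq> {} \<and>
     (\<forall>Z1 Z2. proj_closed Z1 \<and> proj_closed Z2 \<and> Z = Z1 \<union> Z2 \<longrightarrow> Z1 = Z \<or> Z2 = Z)"

definition irreducible_chain :: "ppoint set \<Rightarrow> nat \<Rightarrow> bool" where
  "irreducible_chain Z n \<longleftrightarrow> (\<exists>C. (\<forall>i\<le>n. proj_irreducible (C i) \<and> C i \<subseteq> Z) \<and>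
     (\<forall>i<n. C i \<subset> C (Suc i)))"

text \<open>Krull dimension of a closed set \<open>Z\<close> in the Zariski topology.\<close>

definition has_dimension :: "ppoint set \<Rightarrow> nat \<Rightarrow> bool" where
  "has_dimension Z n \<longleftrightarrow> irreducible_chain Z n \<and> \<not> irreducible_chain Z (Suc n)"

section \<open>Tjurina numbers\<close>

text \<open>For \<open>s\<close> with \<open>s\<^sub>j \<noteq> 0\<close> use the affine chart \<open>x\<^sub>j = s\<^sub>j\<close> of projective space, with coordinates
  \<open>x\<^sub>i\<close>, \<open>i \<noteq> j\<close>, centred at \<open>s\<close>. The coordinate ring of the chart is the ring of polynomials in
  which \<open>x\<^sub>j\<close> does not occur, and its localisation at the origin is \<open>local_ring j\<close>.\<close>

definition local_equation :: "poly4 \<Rightarrow> 4 \<Rightarrow> (4 \<Rightarrow> complex) \<Rightarrow> poly4" where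
  "local_equation f j s = psubst (\<lambda>i. if i = j then Const (s j) else Var i + Const (s i)) f"

definition chart_ring :: "4 \<Rightarrow> poly4 set" where
  "chart_ring j = {p. \<forall>m\<in>Poly_Mapping.keys p. Poly_Mapping.lookup m j = 0}"

definition local_ring :: "4 \<Rightarrow> poly4 fract set" where
  "local_ring j = {Fract a b | a b.
     a \<in> chart_ring j \<and> b \<in> chart_ring j \<and> peval (\<lambda>_. 0) b \<noteq> 0}"

text \<open>The ideal of \<open>local_ring j\<close> generated by \<open>g\<close> and its partial derivatives in the three chart
  coordinates.\<close>

definition tjurina_ideal :: "4 \<Rightarrow> poly4 \<Rightarrow> poly4 fract set" where
  "tjurina_ideal j g =
     {h * Fract g 1 + (\<Sum>i\<in>UNIV - {j}. a i * Fract (pd i g) 1) | h a.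
        h \<in> local_ring j \<and> (\<forall>i. a i \<in> local_ring j)}"

text \<open>Neither choice below affects the value: changing the representative or the chart amounts to a
  change of local coordinates and multiplication of the local equation by a unit.\<close>

definition tjurina :: "poly4 \<Rightarrow> ppoint \<Rightarrow> nat" where
  "tjurina f x = (let s = (SOME v. v \<in> x); j = (SOME j. s j \<noteq> 0)
     in quot_dim (\<lambda>c q. Fract (Const c) 1 * q) (local_ring j)
          (tjurina_ideal j (local_equation f j s)))"

definition total_tjurina :: "poly4 \<Rightarrow> nat" where
  "total_tjurina f = (\<Sum>x\<in>sing_locus f. tjurina f x)"

end

theory Submission
  imports
    Defs
    "Subresultants.Subresultant_Gcd"
    "HOL-Analysis.Continuum_Not_Denumerable"
    "HOL-Library.Function_Algebras"
    "HOL-Computational_Algebra.Fundamental_Theorem_Algebra"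
    "HOL-Computational_Algebra.Field_as_Ring"
begin

text \<open>
  Counting dimensions along the resolution expresses the Hilbert function of \<open>M(f)\<close> in large degrees
  as a cubic polynomial in the degree, whose coefficients are alternating power sums of the Betti
  degrees. Since \<open>f\<close> is squarefree, its restriction to a suitable line has only simple roots (a
  discriminant over \<open>\<complex>[x,y,z]\<close> does not vanish identically), so this line misses the singular locus;
  by the Nullstellensatz \<open>M(f)\<close> is then finite over the coordinate ring of the line and the Hilbert
  function grows at most linearly. The vanishing of the two leading coefficients is (1), and the two
  remaining coefficients give (4).

  If the singular locus is finite, some linear form \<open>l\<close> vanishes at none of its points, and
  multiplication by \<open>l\<close> is eventually bijective on the graded pieces of \<open>M(f)\<close>, which therefore have
  constant dimension; sending a form to its germs at the singular points identifies a graded piece of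
  high degree with the direct sum of the local Tjurina algebras. Conversely, \<open>n\<close> singular points force
  the Hilbert function to be at least \<open>n\<close>. This is (2).

  For (3), if the partial derivatives have no common zero, they generate an ideal containing powers of
  all variables; hence their Koszul complex is exact, and comparing it with the given minimal
  resolution by Nakayama's lemma determines the degrees \<open>d\<^sub>i\<close> and \<open>c\<^sub>j\<close>, after which (1) determines \<open>b\<^sub>1\<close>.
\<close>

text \<open>The line can be found from squarefreeness alone because its direction \<open>v\<close>
  is chosen with f(v) nonzero. Then f(x + T v) has a nonzero constant as leading coefficient in T;
  this excludes common factors free of T and makes the resultant with the T-derivative commute with
  specialisation.

  Global forms meet local algebras through Euler's formula: in a chart, \<open>f\<close> and its
  three affine derivatives generate the same ideal as the germs of all four partial derivatives. A
  form with all germs in these ideals is multiplied into \<open>J_f\<close> by a power of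
  \<open>l\<close>, and eventual injectivity of \<open>l\<close> cancels that power; this takes the
  place of saturation and local cohomology. A basis of a Tjurina algebra is likewise obtained by
  transport from a space of forms, so that its dimension is well defined.

  In the smooth case the given first syzygies agree with the Koszul syzygies only up to an
  invertible constant matrix, which must be constructed before the second syzygies can be
  compared.\<close>

hide_const (open) Poly_Mapping.degree

abbreviation "keys \<equiv> Poly_Mapping.keys"
abbreviation "lookup \<equiv> Poly_Mapping.lookup"
abbreviation "single \<equiv> Poly_Mapping.single"

section \<open>The index type of the variables and the generators of the polynomial ring\<close>

lemma UNIV_4: "(UNIV :: 4 set) = {0, 1, 2, 3}"
proof -
  have "card {0, 1, 2, 3 :: 4} = card (UNIV :: 4 set)" by simp
  then show ?thesis by (metis card_subset_eq finite subset_UNIV)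
qed

lemma of_nat_4_image: "of_nat ` {..<4} = (UNIV :: 4 set)"
  by (auto simp: UNIV_4 lessThan_Suc numeral_eq_Suc)

lemma inj_on_of_nat_4: "inj_on (of_nat :: nat \<Rightarrow> 4) {..<4}"
  by (rule eq_card_imp_inj_on) (simp_all add: of_nat_4_image)

lemma sum_4: "(\<Sum>i\<in>UNIV. g (i :: 4)) = (\<Sum>i<4. g (of_nat i))"
  unfolding of_nat_4_image[symmetric] by (simp add: sum.reindex[OF inj_on_of_nat_4])

lemma sum_singles: "(\<Sum>m\<in>keys p. single m (lookup p m)) = p"
  by (rule poly_mapping_eqI) (auto simp: lookup_sum lookup_single when_def in_keys_iff sum.delta)

lemma monom4_eq_sum: "(\<Sum>i\<in>UNIV. single i (lookup m i)) = (m :: monom4)"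
  by (rule poly_mapping_eqI) (auto simp: lookup_sum lookup_single when_def sum.delta)

lemma Const_hom: "comm_ring_hom Const"
  by unfold_locales (simp_all add: Const_def single_add mult_single)

interpretation Const: comm_ring_hom Const by (rule Const_hom)

lemma Const_1 [simp]: "Const 1 = 1" and Const_0 [simp]: "Const 0 = 0" by (rule Const.hom_one, rule Const.hom_zero)

lemma Const_inject [simp]: "Const a = Const b \<longleftrightarrow> a = b"
  unfolding Const_def by (metis lookup_single_eq)

lemma Const_eq_0_iff [simp]: "Const a = 0 \<longleftrightarrow> a = 0"
  using Const_inject[of a 0] by (simp del: Const_inject)

lemma lookup_Const_mult: "lookup (Const c * p) m = c * lookup p m"
proof -
  have "Const c * p = Poly_Mapping.map ((*) c) p"
    by (simp add: Const_def mult_map_scale_conv_mult)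
  then show ?thesis by (simp add: Poly_Mapping.map.rep_eq when_def)
qed

lemma Var_power: "Var i ^ n = single (single i n) 1"
  by (induction n) (simp_all add: Var_def mult_single single_add[symmetric] add.commute)

lemma prod_single_1: "finite A \<Longrightarrow> (\<Prod>i\<in>A. single (g i) (1 :: complex)) = single (\<Sum>i\<in>A. g i) 1"
  by (induction A rule: finite_induct) (simp_all add: mult_single)

lemma single_eq_Const_mult_Var: "single m c = Const c * (\<Prod>i\<in>UNIV. Var i ^ lookup m i)"
  by (simp add: Var_power prod_single_1 monom4_eq_sum Const_def mult_single)

text \<open>Each monomial is a product of a constant and powers of variables. With this rule,
  identities between evaluations, substitutions and derivations are checked on generators.\<close>

lemma poly4_induct [case_names Const Var add mult]:
  assumes C: "\<And>c. P (Const c)" and V: "\<And>i. P (Var i)"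
    and A: "\<And>p q. P p \<Longrightarrow> P q \<Longrightarrow> P (p + q)" and M: "\<And>p q. P p \<Longrightarrow> P q \<Longrightarrow> P (p * q)"
  shows "P p"
proof -
  have pow: "P (Var i ^ n)" for i n
    by (induction n) (use C[of 1] V M in \<open>auto\<close>)
  have "P (\<Prod>i\<in>A. Var i ^ lookup m i)" if "finite A" for A m
    using that by (induction A rule: finite_induct) (use C[of 1] pow M in \<open>auto\<close>)
  then have s: "P (single m c)" for m c
    unfolding single_eq_Const_mult_Var by (intro M C) auto
  have "P (\<Sum>m\<in>A. single m (lookup p m))" if "finite A" for A
    using that by (induction A rule: finite_induct) (use C[of 0] s A in \<open>auto\<close>)
  from this[of "keys p"] show ?thesis by (simp add: sum_singles)
qed

section \<open>Substitution homomorphisms\<close>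

text \<open>The universal property of the polynomial ring: coefficients go through \<open>c\<close>,
  variables to \<open>v\<close>. Evaluation \<open>peval\<close>, substitution \<open>psubst\<close>
  and the passage \<open>Phi\<close> to iterated univariate polynomials are instances.\<close>

definition subst_hom :: "(complex \<Rightarrow> 'b::comm_ring_1) \<Rightarrow> (4 \<Rightarrow> 'b) \<Rightarrow> poly4 \<Rightarrow> 'b" where
  "subst_hom c v p = (\<Sum>m\<in>keys p. c (lookup p m) * (\<Prod>i\<in>UNIV. v i ^ lookup m i))"

lemma subst_hom_superset:
  assumes "finite A" "keys p \<subseteq> A" "c 0 = 0"
  shows "subst_hom c v p = (\<Sum>m\<in>A. c (lookup p m) * (\<Prod>i\<in>UNIV. v i ^ lookup m i))"
  unfolding subst_hom_def by (rule sum.mono_neutral_left) (use assms in \<open>auto simp: in_keys_iff\<close>)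

lemma subst_hom_single: "c 0 = 0 \<Longrightarrow> subst_hom c v (single m a) = c a * (\<Prod>i\<in>UNIV. v i ^ lookup m i)"
  by (subst subst_hom_superset[of "{m}"]) auto

lemma subst_hom_add:
  assumes "comm_ring_hom c"
  shows "subst_hom c v (p + q) = subst_hom c v p + subst_hom c v q"
proof -
  interpret comm_ring_hom c by fact
  let ?A = "keys p \<union> keys q"
  have "keys (p + q) \<subseteq> ?A" by (rule keys_add)
  then show ?thesis
    by (simp add: subst_hom_superset[of ?A] lookup_add hom_add distrib_right sum.distrib)
qed

lemma comm_ring_hom_zero: "comm_ring_hom c \<Longrightarrow> c 0 = 0"
proof -
  assume "comm_ring_hom c" then interpret comm_ring_hom c .
  show ?thesis by (rule hom_zero)
qed

lemma subst_hom_Const: "comm_ring_hom c \<Longrightarrow> subst_hom c v (Const a) = c a"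
  unfolding Const_def by (subst subst_hom_single) (simp_all add: comm_ring_hom_zero)

lemma comm_ring_hom_one: "comm_ring_hom c \<Longrightarrow> c 1 = 1"
proof -
  assume "comm_ring_hom c" then interpret comm_ring_hom c .
  show ?thesis by (rule hom_one)
qed

lemma subst_hom_sum:
  assumes "comm_ring_hom c" "finite A"
  shows "subst_hom c v (\<Sum>x\<in>A. g x) = (\<Sum>x\<in>A. subst_hom c v (g x))"
  using assms(2) by (induction A rule: finite_induct)
    (simp_all add: subst_hom_add[OF assms(1)] subst_hom_def[of _ _ 0])

lemma subst_hom_mult:
  assumes "comm_ring_hom c"
  shows "subst_hom c v (p * q) = subst_hom c v p * subst_hom c v q"
proof -
  interpret comm_ring_hom c by fact
  have "p * q = (\<Sum>m\<in>keys p. \<Sum>n\<in>keys q. single (m + n) (lookup p m * lookup q n))"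
    by (subst (1) sum_singles[of p, symmetric], subst (1) sum_singles[of q, symmetric])
       (simp add: sum_product mult_single)
  then have "subst_hom c v (p * q) = (\<Sum>m\<in>keys p. \<Sum>n\<in>keys q.
      c (lookup p m * lookup q n) * (\<Prod>i\<in>UNIV. v i ^ lookup (m + n) i))"
    by (simp add: subst_hom_sum[OF assms] subst_hom_single[where c = c] hom_zero)
  also have "\<dots> = subst_hom c v p * subst_hom c v q"
    unfolding subst_hom_def sum_product
    by (intro sum.cong refl) (simp add: hom_mult lookup_add power_add prod.distrib mult_ac)
  finally show ?thesis .
qed

lemma subst_hom_hom: "comm_ring_hom c \<Longrightarrow> comm_ring_hom (subst_hom c v)"
  by unfold_locales
    (auto simp: subst_hom_add subst_hom_mult comm_ring_hom_one comm_ring_hom_zero subst_hom_Const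
      simp del: Const_1 Const_0 simp flip: Const_1 Const_0)

lemma subst_hom_Var: "comm_ring_hom c \<Longrightarrow> subst_hom c v (Var i) = v i"
proof -
  assume "comm_ring_hom c" then interpret comm_ring_hom c .
  have "(\<Prod>j\<in>UNIV. v j ^ lookup (single i 1) j) = (\<Prod>j\<in>UNIV. if j = i then v i else 1)"
    by (intro prod.cong) (auto simp: lookup_single)
  then show ?thesis unfolding Var_def by (subst subst_hom_single) auto
qed

lemma hom_unique:
  assumes "comm_ring_hom g" "comm_ring_hom h" "\<And>c. g (Const c) = h (Const c)" "\<And>i. g (Var i) = h (Var i)"
  shows "g p = h p"
proof -
  interpret g: comm_ring_hom g by fact
  interpret h: comm_ring_hom h by fact
  show ?thesis
    by (induction p rule: poly4_induct) (simp_all add: assms g.hom_add h.hom_add g.hom_mult h.hom_mult)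
qed

lemma comm_ring_hom_id: "comm_ring_hom (\<lambda>x. x)"
  by unfold_locales auto

lemma comm_ring_hom_compose: "comm_ring_hom g \<Longrightarrow> comm_ring_hom h \<Longrightarrow> comm_ring_hom (\<lambda>x. g (h x))"
proof -
  assume "comm_ring_hom g" "comm_ring_hom h"
  then interpret g: comm_ring_hom g + h: comm_ring_hom h .
  show ?thesis by unfold_locales (auto simp: h.hom_add g.hom_add h.hom_mult g.hom_mult)
qed

lemma peval_eq_subst_hom: "peval v = subst_hom (\<lambda>x. x) v"
  by (simp add: fun_eq_iff peval_def subst_hom_def)

lemma psubst_eq_subst_hom: "psubst v = subst_hom Const v"
  by (simp add: fun_eq_iff psubst_def subst_hom_def)

interpretation peval: comm_ring_hom "peval v"
  unfolding peval_eq_subst_hom by (intro subst_hom_hom comm_ring_hom_id)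

interpretation psubst: comm_ring_hom "psubst v"
  unfolding psubst_eq_subst_hom by (intro subst_hom_hom Const_hom)

lemma peval_Const [simp]: "peval v (Const c) = c"
  by (simp add: peval_eq_subst_hom subst_hom_Const comm_ring_hom_id)

lemma peval_Var [simp]: "peval v (Var i) = v i"
  by (simp add: peval_eq_subst_hom subst_hom_Var comm_ring_hom_id)

lemma psubst_Const [simp]: "psubst v (Const c) = Const c"
  by (simp add: psubst_eq_subst_hom subst_hom_Const Const_hom)

lemma psubst_Var [simp]: "psubst v (Var i) = v i"
  by (simp add: psubst_eq_subst_hom subst_hom_Var Const_hom)

lemma peval_psubst: "peval w (psubst v p) = peval (\<lambda>i. peval w (v i)) p"
  by (induction p rule: poly4_induct)
    (simp_all add: peval.hom_add psubst.hom_add peval.hom_mult psubst.hom_mult)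

section \<open>Partial derivatives\<close>

lemma pd_superset:
  assumes "finite A" "keys p \<subseteq> A"
  shows "pd i p = (\<Sum>m\<in>A. single (m - single i 1) (of_nat (lookup m i) * lookup p m))"
  unfolding pd_def by (rule sum.mono_neutral_left) (use assms in \<open>auto simp: in_keys_iff\<close>)

lemma pd_single: "pd i (single m a) = single (m - single i 1) (of_nat (lookup m i) * a)"
  by (subst pd_superset[of "{m}"]) auto

lemma pd_add: "pd i (p + q) = pd i p + pd i q"
proof -
  let ?A = "keys p \<union> keys q"
  have "keys (p + q) \<subseteq> ?A" by (rule keys_add)
  then show ?thesis
    by (simp add: pd_superset[of ?A] lookup_add distrib_left sum.distrib single_add)
qed

lemma pd_0 [simp]: "pd i 0 = 0"
  by (simp add: pd_def)

lemma pd_sum: "finite A \<Longrightarrow> pd i (\<Sum>x\<in>A. g x) = (\<Sum>x\<in>A. pd i (g x))"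
  by (induction A rule: finite_induct) (simp_all add: pd_add)

lemma pd_Const [simp]: "pd i (Const c) = 0"
  by (simp add: Const_def pd_single)

lemma pd_Var: "pd i (Var j) = (if i = j then 1 else 0)"
  by (simp add: Var_def pd_single lookup_single)

text \<open>The truncated subtraction of exponents in \<open>pd\<close> is harmless: where the
  exponent of \<open>i\<close> is zero, the coefficient factor is zero as well, so exponents have to
  match only in the remaining case.\<close>

lemma pd_mult_single:
  "pd i (single m a * single n b) = pd i (single m a) * single n b + single m a * pd i (single n b)"
proof -
  have 1: "m - single i 1 + n = m + n - single i 1" if "lookup m i \<noteq> 0" for m n :: monom4
    using that by (intro poly_mapping_eqI) (auto simp: lookup_add lookup_minus lookup_single when_def)
  have "single (m - single i 1 + n) (of_nat (lookup m i) * a * b)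
      = single (m + n - single i 1) (of_nat (lookup m i) * a * b)"
    by (cases "lookup m i = 0") (simp_all add: 1[unfolded One_nat_def])
  moreover have "single (m + (n - single i 1)) (of_nat (lookup n i) * (a * b))
      = single (m + n - single i 1) (of_nat (lookup n i) * (a * b))"
    using 1[of n m, unfolded One_nat_def] by (cases "lookup n i = 0") (simp_all add: add.commute)
  ultimately show ?thesis
    by (simp add: pd_single mult_single lookup_add distrib_right single_add[symmetric] algebra_simps)
qed

lemma pd_mult: "pd i (p * q) = pd i p * q + p * pd i q"
proof -
  have "pd i (p * q) = (\<Sum>m\<in>keys p. \<Sum>n\<in>keys q. pd i (single m (lookup p m) * single n (lookup q n)))"
    by (subst (1) sum_singles[of p, symmetric], subst (1) sum_singles[of q, symmetric])
       (simp add: sum_product pd_sum)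
  also have "\<dots> = pd i (\<Sum>m\<in>keys p. single m (lookup p m)) * (\<Sum>n\<in>keys q. single n (lookup q n))
      + (\<Sum>m\<in>keys p. single m (lookup p m)) * pd i (\<Sum>n\<in>keys q. single n (lookup q n))"
    by (simp add: pd_mult_single sum_product pd_sum sum.distrib)
  finally show ?thesis by (simp add: sum_singles)
qed

text \<open>The twist by \<open>h\<close> allows derivations followed by a change of coordinates; it
  is applied with \<open>h\<close> equal to \<open>Phi v\<close> and to \<open>loc\<close>, where it
  gives the chain rule.\<close>

lemma derivation_unique:
  fixes h :: "poly4 \<Rightarrow> 'b::comm_ring_1"
  assumes "\<And>p q. D (p + q) = D p + D q" "\<And>p q. D' (p + q) = D' p + D' q"
    and "\<And>p q. D (p * q) = D p * h q + h p * D q" "\<And>p q. D' (p * q) = D' p * h q + h p * D' q"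
    and "\<And>c. D (Const c) = D' (Const c)" "\<And>i. D (Var i) = D' (Var i)"
  shows "D p = D' p"
  by (induction p rule: poly4_induct) (simp_all add: assms)

section \<open>Homogeneous polynomials\<close>

lemma mdeg_add [simp]: "mdeg (m + n) = mdeg m + mdeg n"
  by (simp add: mdeg_def lookup_add sum.distrib)

lemma mdeg_0 [simp]: "mdeg 0 = 0"
  by (simp add: mdeg_def)

lemma mdeg_single [simp]: "mdeg (single i n) = n"
  by (simp add: mdeg_def lookup_single when_def sum.delta)

lemma mdeg_eq_0_iff: "mdeg m = 0 \<longleftrightarrow> m = 0"
  by (auto simp: mdeg_def intro!: poly_mapping_eqI)

lemma homogeneous_0 [simp]: "homogeneous k 0"
  by (simp add: homogeneous_def)

lemma homogeneous_add: "homogeneous k p \<Longrightarrow> homogeneous k q \<Longrightarrow> homogeneous k (p + q)"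
  using keys_add[of p q] by (auto simp: homogeneous_def)

lemma homogeneous_uminus [simp]: "homogeneous k (- p) \<longleftrightarrow> homogeneous k p"
  by (simp add: homogeneous_def in_keys_iff)

lemma homogeneous_diff: "homogeneous k p \<Longrightarrow> homogeneous k q \<Longrightarrow> homogeneous k (p - q)"
  using homogeneous_add[of k p "- q"] by simp

lemma homogeneous_sum: "(\<And>x. x \<in> A \<Longrightarrow> homogeneous k (g x)) \<Longrightarrow> homogeneous k (\<Sum>x\<in>A. g x)"
  by (induction A rule: infinite_finite_induct) (auto intro: homogeneous_add)

lemma homogeneous_single: "int (mdeg m) = k \<Longrightarrow> homogeneous k (single m c)"
  by (auto simp: homogeneous_def)

lemma homogeneous_mult: "homogeneous k p \<Longrightarrow> homogeneous l q \<Longrightarrow> homogeneous (k + l) (p * q)"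
  using keys_mult[of p q] by (fastforce simp: homogeneous_def)

lemma homogeneous_Const [simp]: "homogeneous 0 (Const c)"
  by (simp add: Const_def homogeneous_single)

lemma homogeneous_1 [simp]: "homogeneous 0 1"
  using homogeneous_Const[of 1] by simp

lemma homogeneous_Const_mult: "homogeneous k p \<Longrightarrow> homogeneous k (Const c * p)"
  using homogeneous_mult[of 0 "Const c" k p] by simp

lemma homogeneous_Var [simp]: "homogeneous 1 (Var i)"
  by (simp add: Var_def homogeneous_single)

lemma homogeneous_power: "homogeneous k p \<Longrightarrow> homogeneous (int n * k) (p ^ n)"
  by (induction n) (auto simp: algebra_simps dest: homogeneous_mult[of k p])

lemma homogeneous_prod:
  "(\<And>x. x \<in> A \<Longrightarrow> homogeneous (k x) (g x)) \<Longrightarrow> homogeneous (\<Sum>x\<in>A. k x) (\<Prod>x\<in>A. g x)"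
  by (induction A rule: infinite_finite_induct) (auto intro: homogeneous_mult)

lemma homogeneous_neg: "homogeneous k p \<Longrightarrow> k < 0 \<Longrightarrow> p = 0"
  by (metis homogeneous_def keys_eq_empty equals0I of_nat_less_0_iff)

lemma homogeneous_zero_Const:
  assumes "homogeneous 0 p" shows "p = Const (lookup p 0)"
proof (rule poly_mapping_eqI)
  fix m
  show "lookup p m = lookup (Const (lookup p 0)) m"
    using assms by (cases "m = 0") (auto simp: Const_def lookup_single homogeneous_def in_keys_iff mdeg_eq_0_iff when_def)
qed

lemma homogeneous_pos_lookup_0: "homogeneous k p \<Longrightarrow> k \<noteq> 0 \<Longrightarrow> lookup p 0 = 0"
  by (metis homogeneous_def in_keys_iff mdeg_0 of_nat_0)

lemma homogeneous_pd: "homogeneous k p \<Longrightarrow> homogeneous (k - 1) (pd i p)"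
  unfolding pd_def
proof (rule homogeneous_sum)
  fix m assume p: "homogeneous k p" "m \<in> keys p"
  show "homogeneous (k - 1) (single (m - single i 1) (of_nat (lookup m i) * lookup p m))"
  proof (cases "lookup m i = 0")
    case False
    then have "m - single i 1 + single i 1 = m"
      by (intro poly_mapping_eqI) (auto simp: lookup_add lookup_minus lookup_single when_def)
    then have "mdeg m = mdeg (m - single i 1) + 1" by (metis mdeg_add mdeg_single)
    with p show ?thesis by (intro homogeneous_single) (auto simp: homogeneous_def)
  qed simp
qed

lemma euler:
  assumes "homogeneous (int d) p"
  shows "(\<Sum>i\<in>UNIV. Var i * pd i p) = of_nat d * p"
proof -
  have 1: "Var i * single (m - single i 1) (of_nat (lookup m i) * a) = single m (of_nat (lookup m i) * a)" for i m a
  proof (cases "lookup m i = 0")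
    case False
    then have "single i 1 + (m - single i 1) = m"
      by (intro poly_mapping_eqI) (auto simp: lookup_add lookup_minus lookup_single when_def)
    then show ?thesis by (simp add: Var_def mult_single)
  qed simp
  have "(\<Sum>i\<in>UNIV. Var i * pd i p) = (\<Sum>m\<in>keys p. \<Sum>i\<in>UNIV. single m (of_nat (lookup m i) * lookup p m))"
    by (subst sum.swap) (simp add: pd_def sum_distrib_left 1[unfolded One_nat_def])
  also have "\<dots> = (\<Sum>m\<in>keys p. of_nat d * single m (lookup p m))"
  proof (rule sum.cong)
    fix m assume "m \<in> keys p"
    then have "mdeg m = d" using assms by (auto simp: homogeneous_def)
    have "(\<Sum>i\<in>UNIV. single m (of_nat (lookup m i) * lookup p m)) = single m (\<Sum>i\<in>UNIV. of_nat (lookup m i) * lookup p m)"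
      by (rule poly_mapping_eqI) (simp add: lookup_sum lookup_single when_def)
    also have "(\<Sum>i\<in>UNIV. of_nat (lookup m i) * lookup p m) = of_nat d * lookup p m"
      using \<open>mdeg m = d\<close> by (simp add: mdeg_def sum_distrib_right[symmetric] flip: of_nat_sum)
    also have "single m (of_nat d * lookup p m) = of_nat d * single m (lookup p m)"
      by (simp add: mult_single flip: single_of_nat)
    finally show "(\<Sum>i\<in>UNIV. single m (of_nat (lookup m i) * lookup p m)) = of_nat d * single m (lookup p m)" .
  qed simp
  finally show ?thesis by (simp add: sum_distrib_left[symmetric] sum_singles)
qed

definition hcomp :: "int \<Rightarrow> poly4 \<Rightarrow> poly4" where
  "hcomp k p = (\<Sum>m\<in>{m\<in>keys p. int (mdeg m) = k}. single m (lookup p m))"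

lemma lookup_hcomp: "lookup (hcomp k p) m = (if int (mdeg m) = k then lookup p m else 0)"
  by (auto simp: hcomp_def lookup_sum lookup_single when_def sum.delta' in_keys_iff sum.If_cases)

lemma homogeneous_hcomp [simp]: "homogeneous k (hcomp k p)"
  by (auto simp: homogeneous_def in_keys_iff lookup_hcomp split: if_splits)

lemma hcomp_add: "hcomp k (p + q) = hcomp k p + hcomp k q"
  by (rule poly_mapping_eqI) (simp add: lookup_hcomp lookup_add)

lemma hcomp_diff: "hcomp k (p - q) = hcomp k p - hcomp k q"
  by (rule poly_mapping_eqI) (simp add: lookup_hcomp lookup_minus)

lemma hcomp_0 [simp]: "hcomp k 0 = 0"
  by (rule poly_mapping_eqI) (simp add: lookup_hcomp)

lemma hcomp_sum: "hcomp k (\<Sum>x\<in>A. g x) = (\<Sum>x\<in>A. hcomp k (g x))"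
  by (induction A rule: infinite_finite_induct) (simp_all add: hcomp_add)

lemma hcomp_homogeneous: "homogeneous k p \<Longrightarrow> hcomp l p = (if k = l then p else 0)"
  by (rule poly_mapping_eqI) (auto simp: lookup_hcomp homogeneous_def in_keys_iff)

lemma hcomp_eq_0: "k \<notin> (\<lambda>m. int (mdeg m)) ` keys p \<Longrightarrow> hcomp k p = 0"
  by (rule poly_mapping_eqI) (auto simp: lookup_hcomp in_keys_iff)

lemma sum_hcomp_superset:
  assumes "finite A" "(\<lambda>m. int (mdeg m)) ` keys p \<subseteq> A"
  shows "(\<Sum>k\<in>A. hcomp k p) = p"
proof (rule poly_mapping_eqI)
  fix m
  show "lookup (\<Sum>k\<in>A. hcomp k p) m = lookup p m"
    using assms by (cases "m \<in> keys p") (auto simp: lookup_sum lookup_hcomp sum.delta' sum.delta in_keys_iff)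
qed

lemma sum_hcomp: "(\<Sum>k\<in>(\<lambda>m. int (mdeg m)) ` keys p. hcomp k p) = p"
  by (rule sum_hcomp_superset) auto

lemma hcomp_mult:
  assumes "homogeneous j a"
  shows "hcomp k (a * p) = a * hcomp (k - j) p"
proof -
  let ?K = "(\<lambda>m. int (mdeg m)) ` keys p"
  have "hcomp k (a * p) = (\<Sum>i\<in>?K. hcomp k (a * hcomp i p))"
    by (subst sum_hcomp[of p, symmetric]) (simp add: sum_distrib_left hcomp_sum)
  also have "\<dots> = (\<Sum>i\<in>?K. if i = k - j then a * hcomp (k - j) p else 0)"
  proof (intro sum.cong refl)
    fix i
    have "homogeneous (j + i) (a * hcomp i p)" by (intro homogeneous_mult assms homogeneous_hcomp)
    from hcomp_homogeneous[OF this, of k]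
    show "hcomp k (a * hcomp i p) = (if i = k - j then a * hcomp (k - j) p else 0)" by auto
  qed
  also have "\<dots> = a * hcomp (k - j) p"
    by (auto simp: sum.delta hcomp_eq_0)
  finally show ?thesis .
qed

lemma hcomp_Const_mult: "hcomp k (Const c * p) = Const c * hcomp k p"
  using hcomp_mult[of 0 "Const c" k p] by simp

section \<open>Dimensions of quotients\<close>

text \<open>\<open>quot_dim\<close> is a definite description and carries information only once a
  basis is known. This relation keeps existence explicit and is turned into \<open>quot_dim\<close>
  by \<open>quot_dim_eq\<close>.\<close>

definition qdim :: "(complex \<Rightarrow> 'a \<Rightarrow> 'a) \<Rightarrow> 'a::ab_group_add set \<Rightarrow> 'a set \<Rightarrow> nat \<Rightarrow> bool" where
  "qdim scale V W n \<longleftrightarrow> (\<exists>B. quot_basis scale V W B \<and> card B = n)"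

locale cspace = vector_space scale for scale :: "complex \<Rightarrow> 'b::ab_group_add \<Rightarrow> 'b" (infixr "*s" 75)
begin

definition indep_mod :: "'b set \<Rightarrow> 'b set \<Rightarrow> bool" where
  "indep_mod W B \<longleftrightarrow> (\<forall>c. (\<Sum>b\<in>B. c b *s b) \<in> W \<longrightarrow> (\<forall>b\<in>B. c b = 0))"

definition span_mod :: "'b set \<Rightarrow> 'b set \<Rightarrow> 'b set \<Rightarrow> bool" where
  "span_mod W B V \<longleftrightarrow> (\<forall>v\<in>V. \<exists>c. v - (\<Sum>b\<in>B. c b *s b) \<in> W)"

lemma quot_basis_iff: "quot_basis scale V W B \<longleftrightarrow> finite B \<and> B \<subseteq> V \<and> indep_mod W B \<and> span_mod W B V"
  by (auto simp: quot_basis_def indep_mod_def span_mod_def)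

lemma indep_mod_notin:
  assumes "indep_mod W B" "finite B" "b \<in> B" shows "b \<notin> W"
proof
  assume "b \<in> W"
  moreover have "(\<Sum>x\<in>B. (if x = b then 1 else 0) *s x) = (\<Sum>x\<in>B. if x = b then b else 0)"
    by (rule sum.cong) auto
  ultimately have "(\<Sum>x\<in>B. (if x = b then 1 else 0) *s x) \<in> W" using assms by (simp add: sum.delta')
  then have "\<forall>x\<in>B. (if x = b then 1 else 0 :: complex) = 0" using assms(1)[unfolded indep_mod_def, rule_format, of "\<lambda>x. if x = b then 1 else 0"] by blast
  with assms(3) show False by auto
qed

text \<open>Exchange lemma modulo \<open>W\<close>. Expressing \<open>B\<close> through
  \<open>B'\<close> leaves error terms in \<open>W\<close>; a basis \<open>D\<close> of their span
  makes \<open>B \<union> D\<close> independent and contained in the span of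
  \<open>B' \<union> D\<close>, and the contribution of \<open>D\<close> cancels from the
  count.\<close>

lemma indep_mod_card_le:
  assumes W: "subspace W" and B: "finite B" "indep_mod W B" and B': "finite B'" "span_mod W B' B"
  shows "card B \<le> card B'"
proof -
  from B' obtain c where c: "\<And>b. b \<in> B \<Longrightarrow> b - (\<Sum>x\<in>B'. c b x *s x) \<in> W"
    unfolding span_mod_def by metis
  define w where "w b = b - (\<Sum>x\<in>B'. c b x *s x)" for b
  obtain D where D: "D \<subseteq> w ` B" "independent D" "w ` B \<subseteq> span D"
    using maximal_independent_subset[of "w ` B"] by blast
  have finD: "finite D" using D(1) B(1) finite_surj by auto
  have DW: "D \<subseteq> W" using D(1) c by (auto simp: w_def)
  have disj: "B \<inter> D = {}" using indep_mod_notin[OF B(2,1)] DW by auto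
  have "independent (B \<union> D)"
  proof
    assume "dependent (B \<union> D)"
    then obtain u where u: "\<exists>v\<in>B \<union> D. u v \<noteq> 0" "(\<Sum>v\<in>B \<union> D. u v *s v) = 0"
      using dependent_finite[of "B \<union> D"] B(1) finD by auto
    have s: "(\<Sum>v\<in>B. u v *s v) + (\<Sum>v\<in>D. u v *s v) = 0"
      using u(2) B(1) finD disj by (simp add: sum.union_disjoint)
    have "(\<Sum>v\<in>D. u v *s v) \<in> W" using DW by (intro subspace_sum[OF W] subspace_scale[OF W]) auto
    with s have "(\<Sum>v\<in>B. u v *s v) \<in> W" by (metis W add_eq_0_iff2 subspace_neg)
    then have uB: "\<forall>b\<in>B. u b = 0" using B(2) by (auto simp: indep_mod_def)
    then have "(\<Sum>v\<in>D. u v *s v) = 0" using s by simp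
    then have "\<forall>v\<in>D. u v = 0" using D(2) finD dependent_finite[of D] by auto
    with uB u(1) show False by auto
  qed
  moreover have "B \<union> D \<subseteq> span (B' \<union> D)"
  proof (intro Un_least subsetI)
    fix b assume b: "b \<in> B"
    have "w b \<in> span (B' \<union> D)" using D(3) b span_mono[of D "B' \<union> D"] by auto
    moreover have "(\<Sum>x\<in>B'. c b x *s x) \<in> span (B' \<union> D)"
      by (intro span_sum span_scale span_base) auto
    ultimately have "w b + (\<Sum>x\<in>B'. c b x *s x) \<in> span (B' \<union> D)" by (rule span_add)
    then show "b \<in> span (B' \<union> D)" by (simp add: w_def)
  next
    fix b assume "b \<in> D" then show "b \<in> span (B' \<union> D)" by (auto intro: span_base)
  qed
  ultimately have "card (B \<union> D) \<le> card (B' \<union> D)"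
    using independent_span_bound[of "B' \<union> D" "B \<union> D"] B'(1) finD by auto
  also have "\<dots> \<le> card B' + card D" by (rule card_Un_le)
  finally show ?thesis using card_Un_disjoint[OF B(1) finD disj] by simp
qed

lemma qdim_unique:
  assumes "subspace W" "qdim scale V W n" "qdim scale V W m" shows "n = m"
proof -
  have "n \<le> m" if "qdim scale V W n" "qdim scale V W m" for n m
  proof -
    from that obtain B B' where "quot_basis scale V W B" "card B = n" "quot_basis scale V W B'" "card B' = m"
      by (auto simp: qdim_def)
    then show ?thesis using indep_mod_card_le[OF assms(1), of B B']
      by (force simp: quot_basis_iff span_mod_def)
  qed
  then show ?thesis using assms(2,3) by (simp add: order_antisym)
qed

lemma quot_dim_eq: "subspace W \<Longrightarrow> qdim scale V W n \<Longrightarrow> quot_dim scale V W = n"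
  unfolding quot_dim_def by (rule the_equality) (use qdim_unique in \<open>auto simp: qdim_def\<close>)

text \<open>A family independent modulo \<open>W\<close> of maximal size is a basis, and sizes are
  bounded by the exchange lemma. \<open>F\<close> may lie outside \<open>V\<close>, which lets
  \<open>qdim_split\<close> use one spanning set for both factors.\<close>

lemma qdim_exists:
  assumes V: "subspace V" and W: "subspace W" and F: "finite F" "span_mod W F V"
  obtains n where "qdim scale V W n" "n \<le> card F"
proof -
  let ?P = "\<lambda>n. \<exists>B. finite B \<and> B \<subseteq> V \<and> indep_mod W B \<and> card B = n"
  have bound: "n \<le> card F" if "?P n" for n
    using that indep_mod_card_le[OF W _ _ F(1)] F(2) by (auto simp: span_mod_def)
  have "?P 0" by (intro exI[of _ "{}"]) (auto simp: indep_mod_def)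
  then obtain n where n: "?P n" "\<And>m. ?P m \<Longrightarrow> m \<le> n"
    using bound Greatest_le_nat[of ?P _ "card F"] GreatestI_nat[of ?P 0 "card F"] by blast
  then obtain B where B: "finite B" "B \<subseteq> V" "indep_mod W B" "card B = n" by blast
  have "span_mod W B V" unfolding span_mod_def
  proof
    fix v assume v: "v \<in> V"
    show "\<exists>c. v - (\<Sum>b\<in>B. c b *s b) \<in> W"
    proof (cases "v \<in> B")
      case True
      have "(\<Sum>b\<in>B. (if b = v then 1 else 0) *s b) = (\<Sum>b\<in>B. if b = v then v else 0)"
        by (rule sum.cong) auto
      then have "v - (\<Sum>b\<in>B. (if b = v then 1 else 0) *s b) = 0" using True B(1) by (simp add: sum.delta')
      then show ?thesis by (metis W subspace_0)
    next
      case False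
      have "\<not> indep_mod W (insert v B)"
      proof
        assume "indep_mod W (insert v B)"
        then have "card (insert v B) \<le> n" using B v by (intro n(2) exI[of _ "insert v B"]) auto
        then show False using B False by simp
      qed
      then obtain c where c: "(\<Sum>b\<in>insert v B. c b *s b) \<in> W" "\<exists>b\<in>insert v B. c b \<noteq> 0"
        by (auto simp: indep_mod_def)
      have c': "c v *s v + (\<Sum>b\<in>B. c b *s b) \<in> W" using c(1) B(1) False by simp
      have "c v \<noteq> 0"
      proof
        assume "c v = 0"
        then have "(\<Sum>b\<in>B. c b *s b) \<in> W" using c' by simp
        then show False using B(3) c(2) \<open>c v = 0\<close> by (auto simp: indep_mod_def)
      qed
      then have "v - (\<Sum>b\<in>B. (- c b / c v) *s b) = (1 / c v) *s (c v *s v + (\<Sum>b\<in>B. c b *s b))"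
        by (simp add: scale_right_distrib scale_sum_right sum_negf)
      also have "\<dots> \<in> W" by (intro subspace_scale W c')
      finally show ?thesis by (intro exI[of _ "\<lambda>b. - c b / c v"])
    qed
  qed
  then have "qdim scale V W n" using B by (auto simp: qdim_def quot_basis_iff)
  with bound[OF n(1)] show ?thesis using that by blast
qed

text \<open>Independence of the indexed family forces \<open>b\<close> to be injective: a repeated
  value would give a relation with coefficients 1 and -1. Bases can thus be presented by their index
  set.\<close>

lemma qdim_familyI:
  assumes W: "subspace W" and I: "finite I" "\<And>i. i \<in> I \<Longrightarrow> b i \<in> V"
    and ind: "\<And>c. (\<Sum>i\<in>I. c i *s b i) \<in> W \<Longrightarrow> \<forall>i\<in>I. c i = 0"
    and sp: "\<And>v. v \<in> V \<Longrightarrow> \<exists>c. v - (\<Sum>i\<in>I. c i *s b i) \<in> W"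
  shows "qdim scale V W (card I)"
proof -
  have inj: "inj_on b I"
  proof (rule inj_onI, rule ccontr)
    fix i j assume ij: "i \<in> I" "j \<in> I" "b i = b j" "i \<noteq> j"
    let ?c = "\<lambda>k. if k = i then 1 else if k = j then -1 else (0::complex)"
    have "(\<Sum>k\<in>I. ?c k *s b k) = (\<Sum>k\<in>{i,j}. ?c k *s b k)"
      by (rule sum.mono_neutral_right) (use ij I in auto)
    also have "\<dots> = 0" using ij by simp
    finally have "\<forall>k\<in>I. ?c k = 0" using ind[of ?c] subspace_0[OF W] by simp
    then show False using ij by auto
  qed
  have "indep_mod W (b ` I)" unfolding indep_mod_def
  proof (intro allI impI ballI)
    fix c x assume "(\<Sum>b\<in>b ` I. c b *s b) \<in> W" "x \<in> b ` I"
    then show "c x = 0" using ind[of "\<lambda>i. c (b i)"] by (auto simp: sum.reindex[OF inj])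
  qed
  moreover have "span_mod W (b ` I) V" unfolding span_mod_def
  proof
    fix v assume "v \<in> V"
    then obtain c where c: "v - (\<Sum>i\<in>I. c i *s b i) \<in> W" using sp by blast
    have "(\<Sum>i\<in>I. c i *s b i) = (\<Sum>x\<in>b ` I. c (inv_into I b x) *s x)"
      by (simp add: sum.reindex[OF inj] inv_into_f_f[OF inj])
    with c show "\<exists>c. v - (\<Sum>b\<in>b ` I. c b *s b) \<in> W" by metis
  qed
  ultimately have "quot_basis scale V W (b ` I)" using I by (auto simp: quot_basis_iff)
  then show ?thesis using card_image[OF inj] by (auto simp: qdim_def)
qed

lemma qdim_span_mod: "qdim scale V W n \<Longrightarrow> \<exists>F. finite F \<and> card F = n \<and> span_mod W F V"
  by (auto simp: qdim_def quot_basis_iff)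

lemma qdim_refl: "subspace V \<Longrightarrow> qdim scale V V 0"
  unfolding qdim_def quot_basis_iff by (intro exI[of _ "{}"]) (auto simp: indep_mod_def span_mod_def)

lemma qdim_0_subset: "qdim scale V W 0 \<Longrightarrow> V \<subseteq> W"
  by (auto simp: qdim_def quot_basis_iff span_mod_def)

lemma qdim_add:
  assumes V: "subspace V" and W: "subspace W" and sub: "W \<subseteq> V" "V \<subseteq> U"
    and 1: "qdim scale V W n" and 2: "qdim scale U V m"
  shows "qdim scale U W (n + m)"
proof -
  from 1 2 obtain B C where B: "finite B" "B \<subseteq> V" "indep_mod W B" "span_mod W B V" "card B = n"
    and C: "finite C" "C \<subseteq> U" "indep_mod V C" "span_mod V C U" "card C = m"
    by (auto simp: qdim_def quot_basis_iff)
  have disj: "B \<inter> C = {}" using indep_mod_notin[OF C(3,1)] B(2) by auto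
  have "indep_mod W (B \<union> C)" unfolding indep_mod_def
  proof (intro allI impI)
    fix c assume "(\<Sum>b\<in>B \<union> C. c b *s b) \<in> W"
    then have s: "(\<Sum>b\<in>B. c b *s b) + (\<Sum>b\<in>C. c b *s b) \<in> W"
      using B(1) C(1) disj by (simp add: sum.union_disjoint)
    have "(\<Sum>b\<in>B. c b *s b) \<in> V" using B(2) by (intro subspace_sum[OF V] subspace_scale[OF V]) auto
    moreover have "(\<Sum>b\<in>B. c b *s b) + (\<Sum>b\<in>C. c b *s b) \<in> V" using s sub(1) by auto
    ultimately have "(\<Sum>b\<in>C. c b *s b) \<in> V" by (metis V add_diff_cancel_left' subspace_diff)
    then have cC: "\<forall>b\<in>C. c b = 0" using C(3) by (auto simp: indep_mod_def)
    then have "(\<Sum>b\<in>B. c b *s b) \<in> W" using s by simp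
    then have "\<forall>b\<in>B. c b = 0" using B(3) by (auto simp: indep_mod_def)
    with cC show "\<forall>b\<in>B \<union> C. c b = 0" by auto
  qed
  moreover have "span_mod W (B \<union> C) U" unfolding span_mod_def
  proof
    fix u assume "u \<in> U"
    then obtain c where "u - (\<Sum>b\<in>C. c b *s b) \<in> V" using C(4) by (auto simp: span_mod_def)
    then obtain c' where c': "u - (\<Sum>b\<in>C. c b *s b) - (\<Sum>b\<in>B. c' b *s b) \<in> W"
      using B(4) by (auto simp: span_mod_def)
    have "(\<Sum>b\<in>B \<union> C. (if b \<in> B then c' b else c b) *s b) =
      (\<Sum>b\<in>B. (if b \<in> B then c' b else c b) *s b) + (\<Sum>b\<in>C. (if b \<in> B then c' b else c b) *s b)"
      using B(1) C(1) disj by (simp add: sum.union_disjoint)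
    also have "(\<Sum>b\<in>B. (if b \<in> B then c' b else c b) *s b) = (\<Sum>b\<in>B. c' b *s b)"
      by (rule sum.cong) auto
    also have "(\<Sum>b\<in>C. (if b \<in> B then c' b else c b) *s b) = (\<Sum>b\<in>C. c b *s b)"
      using disj by (intro sum.cong) auto
    finally have e: "u - (\<Sum>b\<in>B \<union> C. (if b \<in> B then c' b else c b) *s b) =
      u - (\<Sum>b\<in>C. c b *s b) - (\<Sum>b\<in>B. c' b *s b)" by (simp add: algebra_simps)
    then show "\<exists>c. u - (\<Sum>b\<in>B \<union> C. c b *s b) \<in> W"
      by (intro exI[of _ "\<lambda>b. if b \<in> B then c' b else c b"]) (subst e, rule c')
  qed
  ultimately have "quot_basis scale U W (B \<union> C)" using B C sub by (auto simp: quot_basis_iff)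
  then show ?thesis using card_Un_disjoint[OF B(1) C(1) disj] B C by (auto simp: qdim_def)
qed

lemma qdim_split:
  assumes V: "subspace V" and W: "subspace W" and U: "subspace U" and sub: "W \<subseteq> V" "V \<subseteq> U" and "qdim scale U W n"
  obtains a b where "qdim scale V W a" "qdim scale U V b" "a + b = n"
proof -
  from qdim_span_mod[OF assms(6)] obtain F where F: "finite F" "span_mod W F U" by blast
  then have "span_mod W F V" "span_mod V F U" using sub by (force simp: span_mod_def)+
  then obtain a b where ab: "qdim scale V W a" "qdim scale U V b"
    using qdim_exists[OF V W F(1)] qdim_exists[OF U V F(1)] by metis
  have "qdim scale U W (a + b)" by (rule qdim_add[OF V W sub ab])
  then have "a + b = n" by (rule qdim_unique[OF W _ assms(6)])
  with ab that show ?thesis by blast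
qed

end

section \<open>Transport of quotient dimensions along linear maps, and the Chinese remainder
  theorem\<close>

locale cspace_linear = A: cspace s1 + B: cspace s2 
  for s1 :: "complex \<Rightarrow> 'a::ab_group_add \<Rightarrow> 'a" and s2 :: "complex \<Rightarrow> 'b::ab_group_add \<Rightarrow> 'b" +
  fixes g :: "'a \<Rightarrow> 'b"
  assumes g_add: "g (x + y) = g x + g y" and g_scale: "g (s1 c x) = s2 c (g x)"
begin

lemma g_0: "g 0 = 0"
  using g_add[of 0 0] by simp

lemma g_sum: "g (\<Sum>i\<in>I. h i) = (\<Sum>i\<in>I. g (h i))"
  by (induction I rule: infinite_finite_induct) (auto simp: g_0 g_add)

lemma g_diff: "g (x - y) = g x - g y"
  using g_add[of "x - y" y] by (simp add: algebra_simps)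

text \<open>\<open>g\<close> induces an isomorphism from V/W to V'/W'. Both directions are stated
  because a basis is known sometimes on the source side and sometimes on the target side.\<close>

lemma qdim_iso:
  assumes V: "A.subspace V" and W: "A.subspace W" and V': "B.subspace V'" and W': "B.subspace W'"
    and gV: "\<And>v. v \<in> V \<Longrightarrow> g v \<in> V'" and ker: "\<And>v. v \<in> V \<Longrightarrow> g v \<in> W' \<longleftrightarrow> v \<in> W"
    and surj: "\<And>v'. v' \<in> V' \<Longrightarrow> \<exists>v\<in>V. v' - g v \<in> W'"
  shows "qdim s1 V W n \<longleftrightarrow> qdim s2 V' W' n"
proof
  assume "qdim s1 V W n"
  then obtain B where B: "finite B" "B \<subseteq> V" "A.indep_mod W B" "A.span_mod W B V" and n: "n = card B"
    by (auto simp: qdim_def A.quot_basis_iff)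
  have lin: "(\<Sum>b\<in>B. s2 (c b) (g b)) = g (\<Sum>b\<in>B. s1 (c b) b)" for c by (simp add: g_sum g_scale)
  have BV: "(\<Sum>b\<in>B. s1 (c b) b) \<in> V" for c
    using B(2) by (intro A.subspace_sum[OF V] A.subspace_scale[OF V]) auto
  show "qdim s2 V' W' n" unfolding n
  proof (rule B.qdim_familyI[OF W' B(1)])
    fix c assume "(\<Sum>b\<in>B. s2 (c b) (g b)) \<in> W'"
    then have "(\<Sum>b\<in>B. s1 (c b) b) \<in> W" unfolding lin using BV ker by blast
    then show "\<forall>b\<in>B. c b = 0" using B(3) by (auto simp: A.indep_mod_def)
  next
    fix v' assume "v' \<in> V'"
    then obtain v where v: "v \<in> V" "v' - g v \<in> W'" using surj by blast
    obtain c where c: "v - (\<Sum>b\<in>B. s1 (c b) b) \<in> W" using v B(4) by (auto simp: A.span_mod_def)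
    then have "g (v - (\<Sum>b\<in>B. s1 (c b) b)) \<in> W'" using ker A.subspace_diff[OF V v(1) BV] by blast
    with v(2) have "v' - g v + g (v - (\<Sum>b\<in>B. s1 (c b) b)) \<in> W'" by (rule B.subspace_add[OF W'])
    then show "\<exists>c. v' - (\<Sum>b\<in>B. s2 (c b) (g b)) \<in> W'"
      by (intro exI[of _ c]) (simp add: lin g_diff)
  qed (use B gV in auto)
next
  assume "qdim s2 V' W' n"
  then obtain B where B: "finite B" "B \<subseteq> V'" "B.indep_mod W' B" "B.span_mod W' B V'" and n: "n = card B"
    by (auto simp: qdim_def B.quot_basis_iff)
  obtain h where h: "\<And>b. b \<in> B \<Longrightarrow> h b \<in> V" "\<And>b. b \<in> B \<Longrightarrow> b - g (h b) \<in> W'"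
    using surj B(2) by (metis subset_iff)
  have BV: "(\<Sum>b\<in>B. s1 (c b) (h b)) \<in> V" for c
    using h(1) by (intro A.subspace_sum[OF V] A.subspace_scale[OF V]) auto
  have lin: "(\<Sum>b\<in>B. s2 (c b) b) - g (\<Sum>b\<in>B. s1 (c b) (h b)) \<in> W'" for c
  proof -
    have "(\<Sum>b\<in>B. s2 (c b) b) - g (\<Sum>b\<in>B. s1 (c b) (h b)) = (\<Sum>b\<in>B. s2 (c b) (b - g (h b)))"
      by (simp add: g_sum g_scale sum_subtractf B.scale_right_diff_distrib)
    then show ?thesis using h(2) by (auto intro!: B.subspace_sum[OF W'] B.subspace_scale[OF W'])
  qed
  show "qdim s1 V W n" unfolding n
  proof (rule A.qdim_familyI[OF W B(1)])
    fix c assume "(\<Sum>b\<in>B. s1 (c b) (h b)) \<in> W"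
    then have "g (\<Sum>b\<in>B. s1 (c b) (h b)) \<in> W'" using ker BV by blast
    with lin[of c] have "(\<Sum>b\<in>B. s2 (c b) b) \<in> W'" by (metis B.subspace_add W' diff_add_cancel)
    then show "\<forall>b\<in>B. c b = 0" using B(3) by (auto simp: B.indep_mod_def)
  next
    fix v assume v: "v \<in> V"
    then obtain c where c: "g v - (\<Sum>b\<in>B. s2 (c b) b) \<in> W'" using gV B(4) by (fastforce simp: B.span_mod_def)
    have "g v - (\<Sum>b\<in>B. s2 (c b) b) + ((\<Sum>b\<in>B. s2 (c b) b) - g (\<Sum>b\<in>B. s1 (c b) (h b))) \<in> W'"
      by (rule B.subspace_add[OF W' c lin])
    then have "g (v - (\<Sum>b\<in>B. s1 (c b) (h b))) \<in> W'" by (simp add: g_diff)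
    then have "v - (\<Sum>b\<in>B. s1 (c b) (h b)) \<in> W" using ker A.subspace_diff[OF V v BV] by blast
    then show "\<exists>c. v - (\<Sum>b\<in>B. s1 (c b) (h b)) \<in> W" by blast
  qed (use h in auto)
qed

end

lemma (in cspace) cspace_linear_id: "cspace_linear scale scale (\<lambda>x. x)"
  by unfold_locales auto

lemma (in cspace) subspace_INT: "(\<And>s. s \<in> A \<Longrightarrow> subspace (K s)) \<Longrightarrow> subspace (\<Inter>s\<in>A. K s)"
  by (auto simp: subspace_def)

text \<open>By \<open>crt\<close>, the intersection of the subspaces \<open>K t\<close> already
  treated still maps onto V/(V \<inter> K s), so each further \<open>s\<close> adds exactly
  \<open>n s\<close>. The \<open>K s\<close> will be the forms vanishing at a point, or those whose
  germ lies in a Tjurina ideal.\<close>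

lemma (in cspace) qdim_crt:
  assumes A: "finite A" and V: "subspace V" and K: "\<And>s. s \<in> A \<Longrightarrow> subspace (K s)"
    and n: "\<And>s. s \<in> A \<Longrightarrow> qdim scale V (V \<inter> K s) (n s)"
    and crt: "\<And>s v. s \<in> A \<Longrightarrow> v \<in> V \<Longrightarrow> \<exists>u\<in>V. v - u \<in> K s \<and> (\<forall>t\<in>A - {s}. u \<in> K t)"
  shows "qdim scale V (V \<inter> (\<Inter>s\<in>A. K s)) (\<Sum>s\<in>A. n s)"
proof -
  have "A' \<subseteq> A \<Longrightarrow> qdim scale V (V \<inter> (\<Inter>s\<in>A'. K s)) (\<Sum>s\<in>A'. n s)" if "finite A'" for A'
    using that
  proof (induction A' rule: finite_induct)
    case empty
    then show ?case using qdim_refl[OF V] by simp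
  next
    case (insert s A')
    let ?U = "V \<inter> (\<Inter>s\<in>A'. K s)"
    have sU: "subspace ?U" using insert K by (intro subspace_inter V subspace_INT) auto
    interpret I: cspace_linear scale scale "\<lambda>x. x" by (rule cspace_linear_id)
    have sA: "s \<in> A" using insert by auto
    have "qdim scale ?U (?U \<inter> K s) (n s) \<longleftrightarrow> qdim scale V (V \<inter> K s) (n s)"
    proof (rule I.qdim_iso[OF sU _ V])
      show "subspace (?U \<inter> K s)" "subspace (V \<inter> K s)" using sU K[OF sA] V by (auto intro: subspace_inter)
      fix v assume v: "v \<in> V"
      then obtain u where u: "u \<in> V" "v - u \<in> K s" "\<forall>t\<in>A - {s}. u \<in> K t" using crt[OF sA] by blast
      then have "u \<in> ?U" using insert by auto
      then show "\<exists>u\<in>?U. v - u \<in> V \<inter> K s" using u v subspace_diff[OF V] by blast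
    qed auto
    then have "qdim scale ?U (?U \<inter> K s) (n s)" using n[OF sA] by simp
    then have "qdim scale V (?U \<inter> K s) (n s + (\<Sum>s\<in>A'. n s))"
      using insert K[OF sA] sU by (intro qdim_add[of ?U]) (auto intro: subspace_inter)
    moreover have "?U \<inter> K s = V \<inter> (\<Inter>s\<in>insert s A'. K s)" by auto
    ultimately show ?case using insert by simp
  qed
  then show ?thesis using A by blast
qed

section \<open>The spaces of forms\<close>

interpretation S: cspace "\<lambda>c p. Const c * p"
  by unfold_locales (simp_all add: algebra_simps Const.hom_add Const.hom_mult)

abbreviation forms :: "int \<Rightarrow> poly4 set" where
  "forms k \<equiv> {p. homogeneous k p}"

lemma subspace_forms: "S.subspace (forms k)"
  by (auto simp: S.subspace_def homogeneous_add homogeneous_Const_mult)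

lemma ex_lookup: "\<exists>m :: monom4. lookup m = g"
proof
  show "lookup (\<Sum>i\<in>UNIV. single i (g i)) = g"
    by (auto simp: lookup_sum lookup_single when_def sum.delta fun_eq_iff)
qed

lemma sum_UNIV_4: "(\<Sum>i\<in>UNIV. g (i :: 4)) = g 0 + g 1 + g 2 + (g 3 :: 'a::comm_monoid_add)"
  unfolding sum_4 by (simp add: numeral_eq_Suc lessThan_Suc add_ac)

lemma card_mdeg: "finite {m. mdeg m = k}" "card {m. mdeg m = k} = (k + 3) choose 3"
proof -
  let ?h = "\<lambda>m :: monom4. [lookup m 0, lookup m 1, lookup m 2, lookup m 3]"
  have "bij_betw ?h {m. mdeg m = k} {l :: nat list. size l = 4 \<and> sum_list l = k}"
  proof (rule bij_betwI')
    fix x y :: monom4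
    have "lookup x = lookup y" if "lookup x 0 = lookup y 0" "lookup x 1 = lookup y 1"
      "lookup x 2 = lookup y 2" "lookup x 3 = lookup y 3"
    proof
      fix i :: 4
      have "i \<in> {0,1,2,3}" unfolding UNIV_4[symmetric] by simp
      then consider "i = 0" | "i = 1" | "i = 2" | "i = 3" by blast
      then show "lookup x i = lookup y i" by cases (simp_all add: that)
    qed
    then show "(?h x = ?h y) = (x = y)" by (auto intro: poly_mapping_eqI)
  next
    fix x :: monom4 assume "x \<in> {m. mdeg m = k}"
    then show "?h x \<in> {l. size l = 4 \<and> sum_list l = k}" by (simp add: mdeg_def sum_UNIV_4)
  next
    fix l :: "nat list" assume l: "l \<in> {l. size l = 4 \<and> sum_list l = k}"
    obtain m where m: "lookup m = (\<lambda>i::4. if i = 0 then l ! 0 else if i = 1 then l ! 1 else if i = 2 then l ! 2 else l ! 3)"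
      using ex_lookup by blast
    have "l = ?h m" using l by (auto simp: m numeral_eq_Suc length_Suc_conv)
    moreover have "mdeg m = k" using l by (auto simp: m mdeg_def sum_UNIV_4 numeral_eq_Suc length_Suc_conv)
    ultimately show "\<exists>m\<in>{m. mdeg m = k}. l = ?h m" by blast
  qed
  moreover have c: "card {l :: nat list. size l = 4 \<and> sum_list l = k} = (k + 3) choose k"
    by (simp add: card_length_sum_list add.commute)
  moreover have "(k + 3) choose k = (k + 3) choose 3" using binomial_symmetric[of k "k + 3"] by simp
  ultimately show "card {m. mdeg m = k} = (k + 3) choose 3" using bij_betw_same_card by fastforce
  \<comment> \<open>An infinite set has \<open>card\<close> 0, while the binomial coefficient is
    positive.\<close>
  then show "finite {m. mdeg m = k}" by (metis card.infinite binomial_eq_0_iff not_less le_add2)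
qed

lemma qdim_forms: "qdim (\<lambda>c p. Const c * p) (forms (int k)) {0} ((k + 3) choose 3)"
proof -
  have lk: "lookup (\<Sum>m\<in>{m. mdeg m = k}. Const (c m) * single m 1) n = (if mdeg n = k then c n else 0)" for c n
  proof -
    have "lookup (\<Sum>m\<in>{m. mdeg m = k}. Const (c m) * single m 1) n = (\<Sum>m\<in>{m. mdeg m = k}. if m = n then c n else 0)"
      unfolding lookup_sum lookup_Const_mult by (rule sum.cong) (auto simp: lookup_single)
    then show ?thesis by (simp add: sum.delta[OF card_mdeg(1)])
  qed
  have "qdim (\<lambda>c p. Const c * p) (forms (int k)) {0} (card {m. mdeg m = k})"
  proof (rule S.qdim_familyI[where b = "\<lambda>m. single m 1"])
    fix c assume 0: "(\<Sum>m\<in>{m. mdeg m = k}. Const (c m) * single m 1) \<in> {0}"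
    show "\<forall>m\<in>{m. mdeg m = k}. c m = 0"
    proof
      fix m assume "m \<in> {m. mdeg m = k}"
      then have "c m = lookup (\<Sum>m\<in>{m. mdeg m = k}. Const (c m) * single m 1) m" by (simp add: lk)
      also have "\<dots> = 0" using 0 by (simp del: lookup_sum)
      finally show "c m = 0" .
    qed
  next
    fix p assume p: "p \<in> forms (int k)"
    have "p = (\<Sum>m\<in>{m. mdeg m = k}. Const (lookup p m) * single m 1)"
      by (rule poly_mapping_eqI) (use p lk in \<open>auto simp: homogeneous_def in_keys_iff\<close>)
    then show "\<exists>c. p - (\<Sum>m\<in>{m. mdeg m = k}. Const (c m) * single m 1) \<in> {0}"
      by (intro exI[of _ "lookup p"]) simp
  qed (use card_mdeg in \<open>auto simp: homogeneous_single S.subspace_0 S.subspace_single_0\<close>)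
  then show ?thesis by (simp add: card_mdeg)
qed

section \<open>Nullstellensatz\<close>

definition ideal4 :: "poly4 set \<Rightarrow> bool" where
  "ideal4 I \<longleftrightarrow> 0 \<in> I \<and> (\<forall>p\<in>I. \<forall>q\<in>I. p + q \<in> I) \<and> (\<forall>p\<in>I. \<forall>a. a * p \<in> I)"

definition homog_ideal :: "poly4 set \<Rightarrow> bool" where
  "homog_ideal I \<longleftrightarrow> ideal4 I \<and> (\<forall>p\<in>I. \<forall>k. hcomp k p \<in> I)"

definition ideal_plus :: "poly4 set \<Rightarrow> poly4 \<Rightarrow> poly4 set" where
  "ideal_plus I h = {a + h * b | a b. a \<in> I}"

lemma ideal4D:
  assumes "ideal4 I"
  shows "0 \<in> I" "p \<in> I \<Longrightarrow> q \<in> I \<Longrightarrow> p + q \<in> I" "p \<in> I \<Longrightarrow> a * p \<in> I" "p \<in> I \<Longrightarrow> p * a \<in> I"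
  using assms by (auto simp: ideal4_def mult.commute[of p a])

lemma ideal4_uminus: "ideal4 I \<Longrightarrow> p \<in> I \<Longrightarrow> - p \<in> I"
  using ideal4D(3)[of I p "- 1"] by simp

lemma ideal4_diff: "ideal4 I \<Longrightarrow> p \<in> I \<Longrightarrow> q \<in> I \<Longrightarrow> p - q \<in> I"
  using ideal4D(2)[of I p "- q"] ideal4_uminus[of I q] by simp

lemma ideal4_sum: "ideal4 I \<Longrightarrow> (\<And>x. x \<in> A \<Longrightarrow> g x \<in> I) \<Longrightarrow> (\<Sum>x\<in>A. g x) \<in> I"
  by (induction A rule: infinite_finite_induct) (auto simp: ideal4D)

lemma ideal4_subspace: "ideal4 I \<Longrightarrow> S.subspace I"
  by (auto simp: S.subspace_def ideal4D)

lemma ideal4_plus: "ideal4 I \<Longrightarrow> ideal4 (ideal_plus I h)"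
proof -
  assume I: "ideal4 I"
  have "0 \<in> ideal_plus I h" using ideal4D(1)[OF I] by (auto simp: ideal_plus_def intro!: exI[of _ 0])
  moreover have "p + q \<in> ideal_plus I h" if "p \<in> ideal_plus I h" "q \<in> ideal_plus I h" for p q
  proof -
    from that obtain a b a' b' where "p = a + h * b" "q = a' + h * b'" "a \<in> I" "a' \<in> I"
      by (auto simp: ideal_plus_def)
    then have "p + q = (a + a') + h * (b + b')" "a + a' \<in> I" using ideal4D[OF I] by (auto simp: algebra_simps)
    then show ?thesis unfolding ideal_plus_def by blast
  qed
  moreover have "c * p \<in> ideal_plus I h" if "p \<in> ideal_plus I h" for p c
  proof -
    from that obtain a b where "p = a + h * b" "a \<in> I" by (auto simp: ideal_plus_def)
    then have "c * p = c * a + h * (c * b)" "c * a \<in> I" using ideal4D[OF I] by (auto simp: algebra_simps)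
    then show ?thesis unfolding ideal_plus_def by blast
  qed
  ultimately show ?thesis by (auto simp: ideal4_def)
qed

lemma ideal_plus_contains: "ideal4 I \<Longrightarrow> I \<subseteq> ideal_plus I h" "ideal4 I \<Longrightarrow> h \<in> ideal_plus I h"
proof -
  assume I: "ideal4 I"
  show "I \<subseteq> ideal_plus I h" by (force simp: ideal_plus_def intro: exI[of _ 0])
  have "h = 0 + h * 1" by simp
  then show "h \<in> ideal_plus I h" unfolding ideal_plus_def using ideal4D(1)[OF I] by blast
qed

lemma homog_ideal_plus:
  assumes I: "homog_ideal I" and h: "homogeneous e h" shows "homog_ideal (ideal_plus I h)"
proof -
  have "hcomp k (a + h * b) \<in> ideal_plus I h" if "a \<in> I" for a b k
  proof -
    have "hcomp k (a + h * b) = hcomp k a + h * hcomp (k - e) b" by (simp add: hcomp_add hcomp_mult[OF h])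
    moreover have "hcomp k a \<in> I" using I that by (auto simp: homog_ideal_def)
    ultimately show ?thesis unfolding ideal_plus_def by blast
  qed
  then show ?thesis using I ideal4_plus[of I h] by (auto simp: homog_ideal_def ideal_plus_def)
qed

lemma single_1_inject: "single m (1::complex) = single n 1 \<longleftrightarrow> m = n"
  by (metis keys_single singleton_inject zero_neq_one)

lemma maximal_ideal4_exists:
  assumes "ideal4 I" "1 \<notin> I"
  obtains M where "ideal4 M" "1 \<notin> M" "I \<subseteq> M" "\<And>x. x \<notin> M \<Longrightarrow> \<exists>g. g * x - 1 \<in> M"
proof -
  let ?A = "{M. ideal4 M \<and> 1 \<notin> M \<and> I \<subseteq> M}"
  have "\<exists>M\<in>?A. \<forall>X\<in>?A. M \<subseteq> X \<longrightarrow> X = M"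
  proof (rule subset_Zorn_nonempty)
    show "?A \<noteq> {}" using assms by auto
    fix C assume C: "C \<noteq> {}" "subset.chain ?A C"
    then have CA: "\<And>M. M \<in> C \<Longrightarrow> ideal4 M \<and> 1 \<notin> M \<and> I \<subseteq> M" and ch: "\<And>M N. M \<in> C \<Longrightarrow> N \<in> C \<Longrightarrow> M \<subseteq> N \<or> N \<subseteq> M"
      by (auto simp: subset.chain_def)
    have "ideal4 (\<Union>C)" unfolding ideal4_def
    proof (intro conjI ballI allI)
      from C(1) obtain M where "M \<in> C" by blast
      then show "0 \<in> \<Union>C" using CA[of M] ideal4D(1)[of M] by blast
    next
      fix p q assume "p \<in> \<Union>C" "q \<in> \<Union>C"
      then obtain M N where "M \<in> C" "N \<in> C" "p \<in> M" "q \<in> N" by blast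
      then obtain L where "L \<in> C" "p \<in> L" "q \<in> L" using ch[of M N] by blast
      then show "p + q \<in> \<Union>C" using CA[of L] ideal4D(2)[of L p q] by blast
    next
      fix p a assume "p \<in> \<Union>C"
      then obtain M where "M \<in> C" "p \<in> M" by blast
      then show "a * p \<in> \<Union>C" using CA[of M] ideal4D(3)[of M p a] by blast
    qed
    then show "\<Union>C \<in> ?A" using CA C(1) by blast
  qed
  then obtain M where MA: "M \<in> ?A" and mx: "\<forall>X\<in>?A. M \<subseteq> X \<longrightarrow> X = M" by (rule bexE)
  from MA have M: "ideal4 M" "1 \<notin> M" "I \<subseteq> M" by simp_all
  have max: "X = M" if "ideal4 X" "1 \<notin> X" "M \<subseteq> X" for X
    using mx that M(3) by simp
  have "\<exists>g. g * x - 1 \<in> M" if x: "x \<notin> M" for x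
  proof -
    have "ideal_plus M x \<noteq> M" using ideal_plus_contains(2)[OF M(1)] x by blast
    then have "1 \<in> ideal_plus M x" using max[OF ideal4_plus[OF M(1)]] ideal_plus_contains(1)[OF M(1)] by blast
    then obtain a b where "1 = a + x * b" "a \<in> M" by (auto simp: ideal_plus_def)
    then have "b * x - 1 = - a" by (simp add: algebra_simps)
    then show ?thesis using ideal4_uminus[OF M(1) \<open>a \<in> M\<close>] by metis
  qed
  with M that show ?thesis by blast
qed

lemma map_poly_Const_hom: "comm_ring_hom (\<lambda>q. poly (map_poly Const q) x)"
proof -
  interpret map_poly_comm_ring_hom Const ..
  show ?thesis by unfold_locales (auto simp: hom_add hom_mult)
qed

text \<open>Over the complex numbers \<open>q\<close> splits into linear factors, and each of them
  is a unit modulo \<open>M\<close>; thus \<open>x\<close> is transcendental modulo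
  \<open>M\<close>.\<close>

lemma poly_invertible_mod:
  assumes M: "ideal4 M" "1 \<notin> M" and inv: "\<And>c. \<exists>g. g * (x - Const c) - 1 \<in> M"
    and q: "q \<noteq> 0"
  shows "poly (map_poly Const q) x \<notin> M"
  using q
proof (induction "degree q" arbitrary: q)
  case 0
  then obtain a where "q = [:a:]" "a \<noteq> 0" by (metis degree_eq_zeroE pCons_0_0)
  moreover have "Const a \<notin> M" if "a \<noteq> 0"
  proof
    assume "Const a \<in> M"
    then have "Const (1 / a) * Const a \<in> M" by (rule ideal4D(3)[OF M(1)])
    then show False using that M(2) by (simp flip: Const.hom_mult)
  qed
  ultimately show ?case by simp
next
  case (Suc n)
  then have "\<not> constant (poly q)" by (simp add: constant_degree)
  then obtain r where "poly q r = 0" using fundamental_theorem_of_algebra by blast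
  then obtain q' where q': "q = [:-r, 1:] * q'" by (metis dvdE poly_eq_0_iff_dvd)
  with Suc(3) have "q' \<noteq> 0" by auto
  have "degree q = degree [:-r, 1:] + degree q'" unfolding q' by (rule degree_mult_eq) (use \<open>q' \<noteq> 0\<close> in auto)
  with Suc(2) have "degree q' = n" by simp
  then have IH: "poly (map_poly Const q') x \<notin> M" using Suc(1)[of q'] \<open>q' \<noteq> 0\<close> by blast
  interpret h: comm_ring_hom "\<lambda>q. poly (map_poly Const q) x" by (rule map_poly_Const_hom)
  have eq: "poly (map_poly Const q) x = (x - Const r) * poly (map_poly Const q') x"
    unfolding q' h.hom_mult by (simp add: Const.hom_uminus)
  show ?case
  proof
    assume "poly (map_poly Const q) x \<in> M"
    then have 1: "(x - Const r) * poly (map_poly Const q') x \<in> M" by (simp add: eq)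
    obtain g where g: "g * (x - Const r) - 1 \<in> M" using inv by blast
    have "g * ((x - Const r) * poly (map_poly Const q') x) - (g * (x - Const r) - 1) * poly (map_poly Const q') x \<in> M"
      by (intro ideal4_diff[OF M(1)] ideal4D[OF M(1)] 1 g)
    moreover have "g * ((x - Const r) * poly (map_poly Const q') x) - (g * (x - Const r) - 1) * poly (map_poly Const q') x
      = poly (map_poly Const q') x" by (simp add: algebra_simps)
    ultimately show False using IH by simp
  qed
qed

text \<open>If no \<open>x - c\<close> were in \<open>M\<close>, their inverses modulo \<open>M\<close> would form an uncountable linearly
  independent family in a space of countable dimension.\<close>
lemma maximal_ideal4_contains_linear:
  assumes M: "ideal4 M" "1 \<notin> M" and max: "\<And>x. x \<notin> M \<Longrightarrow> \<exists>g. g * x - 1 \<in> M"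
  shows "\<exists>c. x - Const c \<in> M"
proof (rule ccontr)
  assume "\<not> ?thesis"
  then have inv: "\<exists>g. g * (x - Const c) - 1 \<in> M" for c using max by blast
  then obtain g where g: "\<And>c. g c * (x - Const c) - 1 \<in> M" by metis
  define n where "n p = Max (insert 0 (mdeg ` keys p))" for p :: poly4
  have n: "mdeg m \<le> n p" if "m \<in> keys p" for m p using that by (auto simp: n_def intro: Max_ge)
  \<comment> \<open>Uncountably many \<open>c\<close> but only countably many degree bounds:
    infinitely many of the inverses lie in one finite-dimensional space.\<close>
  have "\<exists>N. infinite {c. n (g c) = N}"
  proof (rule ccontr)
    assume "\<not> ?thesis"
    then have "countable (\<Union>N. {c. n (g c) = N})" by (intro countable_UN) (auto intro: countable_finite)
    moreover have "(\<Union>N. {c. n (g c) = N}) = UNIV" by auto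
    ultimately show False using uncountable_UNIV_complex by simp
  qed
  then obtain N where N: "infinite {c. n (g c) = N}" by blast
  let ?T = "{m :: monom4. mdeg m \<le> N}"
  have "?T = (\<Union>k\<in>{..N}. {m. mdeg m = k})" by auto
  then have finT: "finite ?T" using card_mdeg(1) by (metis (no_types, lifting) finite_UN_I finite_atMost)
  obtain C where C: "C \<subseteq> {c. n (g c) = N}" "finite C" "card C = card ?T + 1"
    using infinite_arbitrarily_large[OF N] by metis
  have ind: "a c0 = 0" if 0: "(\<Sum>c\<in>C. Const (a c) * g c) \<in> M" and c0: "c0 \<in> C" for a c0
  proof -
    \<comment> \<open>Clearing denominators: multiply the relation by the product of all
      \<open>x - Const c\<close> and replace each \<open>g c * (x - Const c)\<close> by 1 modulo
      \<open>M\<close>. What remains is \<open>q\<close> at \<open>x\<close>, so \<open>q\<close> is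
      zero by transcendence.\<close>
    define q where "q = (\<Sum>c\<in>C. [:a c:] * (\<Prod>c'\<in>C - {c}. [:-c', 1:]))"
    interpret h: comm_ring_hom "\<lambda>q. poly (map_poly Const q) x" by (rule map_poly_Const_hom)
    have hc: "poly (map_poly Const [:b:]) x = Const b" for b
      by (cases "b = 0") (simp_all add: map_poly_pCons)
    have hq: "poly (map_poly Const q) x = (\<Sum>c\<in>C. Const (a c) * (\<Prod>c'\<in>C - {c}. x - Const c'))"
      unfolding q_def h.hom_sum h.hom_mult h.hom_prod by (simp add: hc Const.hom_uminus)
    let ?P = "\<Prod>c\<in>C. x - Const c"
    have "?P * (\<Sum>c\<in>C. Const (a c) * g c) - (\<Sum>c\<in>C. Const (a c) * (\<Prod>c'\<in>C - {c}. x - Const c') * (g c * (x - Const c) - 1)) \<in> M"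
      by (intro ideal4_diff[OF M(1)] ideal4D(3)[OF M(1)] ideal4_sum[OF M(1)] 0 g)
    moreover have "?P * (\<Sum>c\<in>C. Const (a c) * g c) = (\<Sum>c\<in>C. Const (a c) * (\<Prod>c'\<in>C - {c}. x - Const c') * (g c * (x - Const c)))"
      unfolding sum_distrib_left
    proof (rule sum.cong)
      fix c assume "c \<in> C"
      then have "?P = (x - Const c) * (\<Prod>c'\<in>C - {c}. x - Const c')" using C(2) by (simp add: prod.remove)
      then show "?P * (Const (a c) * g c) = Const (a c) * (\<Prod>c'\<in>C - {c}. x - Const c') * (g c * (x - Const c))"
        by (simp add: mult_ac)
    qed simp
    ultimately have "poly (map_poly Const q) x \<in> M" unfolding hq by (simp add: right_diff_distrib sum_subtractf)
    then have "q = 0" using poly_invertible_mod[OF M inv] by blast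
    then have "poly q c0 = 0" by simp
    \<comment> \<open>At \<open>c0\<close> every summand except that of \<open>c0\<close> contains a
      vanishing factor.\<close>
    moreover have "poly q c0 = (\<Sum>c\<in>C. if c = c0 then a c0 * (\<Prod>c'\<in>C - {c0}. c0 - c') else 0)"
      unfolding q_def poly_sum
    proof (intro sum.cong refl)
      fix c assume "c \<in> C"
      have "(\<Prod>c'\<in>C - {c}. c0 - c') = 0" if "c \<noteq> c0" using that c0 C(2) by (intro prod_zero) auto
      then show "poly ([:a c:] * (\<Prod>c'\<in>C - {c}. [:-c', 1:])) c0 = (if c = c0 then a c0 * (\<Prod>c'\<in>C - {c0}. c0 - c') else 0)"
        by (auto simp: poly_prod)
    qed
    ultimately have "a c0 * (\<Prod>c'\<in>C - {c0}. c0 - c') = 0" using c0 C(2) by (simp add: sum.delta)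
    moreover have "(\<Prod>c'\<in>C - {c0}. c0 - c') \<noteq> 0" using C(2) by auto
    ultimately show ?thesis by simp
  qed
  have W: "S.subspace M" by (rule ideal4_subspace[OF M(1)])
  define V where "V = {p. keys p \<subseteq> ?T}"
  have inj: "inj_on g C"
  proof (rule inj_onI, rule ccontr)
    fix i j assume ij: "i \<in> C" "j \<in> C" "g i = g j" "i \<noteq> j"
    let ?c = "\<lambda>k. if k = i then 1 else if k = j then -1 else (0::complex)"
    have "(\<Sum>k\<in>C. Const (?c k) * g k) = (\<Sum>k\<in>{i,j}. Const (?c k) * g k)"
      by (rule sum.mono_neutral_right) (use ij C in auto)
    also have "\<dots> = 0" using ij by (simp add: Const.hom_uminus)
    finally have "?c i = 0" using ind[of ?c i] ij(1) ideal4D(1)[OF M(1)] by simp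
    then show False by simp
  qed
  have "S.indep_mod M (g ` C)" unfolding S.indep_mod_def
  proof (intro allI impI ballI)
    fix c y assume "(\<Sum>b\<in>g ` C. Const (c b) * b) \<in> M" "y \<in> g ` C"
    then show "c y = 0" using ind[of "\<lambda>i. c (g i)"] by (auto simp: sum.reindex[OF inj])
  qed
  moreover have "S.span_mod M ((\<lambda>m. single m 1) ` ?T) (g ` C)" unfolding S.span_mod_def
  proof
    fix p assume "p \<in> g ` C"
    then have "keys p \<subseteq> ?T" using C(1) n by fastforce
    then have "p = (\<Sum>m\<in>?T. single m (lookup p m))"
      using sum.mono_neutral_left[OF finT \<open>keys p \<subseteq> ?T\<close>, of "\<lambda>m. single m (lookup p m)"] sum_singles[of p]
      by (auto simp: in_keys_iff)
    also have "\<dots> = (\<Sum>m\<in>?T. Const (lookup p m) * single m 1)"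
      by (simp add: Const_def mult_single)
    also have "\<dots> = (\<Sum>b\<in>(\<lambda>m. single m 1) ` ?T. Const (lookup p (THE m. b = single m 1)) * b)"
      by (subst sum.reindex) (auto simp: inj_on_def single_1_inject)
    finally have e: "p = (\<Sum>b\<in>(\<lambda>m. single m 1) ` ?T. Const (lookup p (THE m. b = single m 1)) * b)" .
    have "p - (\<Sum>b\<in>(\<lambda>m. single m 1) ` ?T. Const (lookup p (THE m. b = single m 1)) * b) \<in> M"
      unfolding e[symmetric] using ideal4D(1)[OF M(1)] by simp
    then show "\<exists>c. p - (\<Sum>b\<in>(\<lambda>m. single m 1) ` ?T. Const (c b) * b) \<in> M"
      by (rule exI[of _ "\<lambda>b. lookup p (THE m. b = single m 1)"])
  qed
  ultimately have "card (g ` C) \<le> card ((\<lambda>m :: monom4. single m (1::complex)) ` ?T)"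
    using C(2) finT by (intro S.indep_mod_card_le[OF W]) auto
  also have "\<dots> \<le> card ?T" by (rule card_image_le[OF finT])
  finally show False using C(3) card_image[OF inj] by simp
qed

text \<open>Modulo a maximal ideal containing \<open>I\<close> every variable is congruent to a
  constant; these constants are the coordinates of the common zero.\<close>

lemma weak_nullstellensatz:
  assumes "ideal4 I" "1 \<notin> I"
  obtains v where "\<And>p. p \<in> I \<Longrightarrow> peval v p = 0"
proof -
  obtain M where M: "ideal4 M" "1 \<notin> M" "I \<subseteq> M" and max: "\<And>x. x \<notin> M \<Longrightarrow> \<exists>g. g * x - 1 \<in> M"
    using maximal_ideal4_exists[OF assms] by blast
  have "\<exists>c. Var i - Const c \<in> M" for i
    by (rule maximal_ideal4_contains_linear[OF M(1,2)]) (rule max)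
  then obtain v where v: "\<And>i. Var i - Const (v i) \<in> M" by metis
  have cong: "p - Const (peval v p) \<in> M" for p
  proof (induction p rule: poly4_induct)
    case (add p q)
    then show ?case using ideal4D(2)[OF M(1) add] by (simp add: peval.hom_add Const.hom_add algebra_simps)
  next
    case (mult p q)
    have "(p - Const (peval v p)) * q + Const (peval v p) * (q - Const (peval v q)) \<in> M"
      by (intro ideal4D[OF M(1)] mult)
    then show ?case by (simp add: peval.hom_mult Const.hom_mult algebra_simps)
  qed (use v ideal4D(1)[OF M(1)] in auto)
  have "peval v p = 0" if "p \<in> I" for p
  proof (rule ccontr)
    assume nz: "peval v p \<noteq> 0"
    have "p - (p - Const (peval v p)) \<in> M" by (rule ideal4_diff[OF M(1) _ cong]) (use that M in auto)
    then have "Const (1 / peval v p) * Const (peval v p) \<in> M" by (intro ideal4D(3)[OF M(1)]) simp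
    then show False using nz M(2) by (simp flip: Const.hom_mult)
  qed
  then show ?thesis using that by blast
qed

lemma peval_zero: "peval (\<lambda>_. 0) p = lookup p 0"
proof (induction p rule: poly4_induct)
  case (mult p q)
  have "lookup (p * q) 0 = lookup p 0 * lookup q 0"
  proof -
    have "p = Const (lookup p 0) + (p - Const (lookup p 0))" by simp
    have h: "hcomp 0 p = Const (lookup p 0)" for p
      using homogeneous_zero_Const[of "hcomp 0 p"] by (simp add: lookup_hcomp)
    let ?K = "(\<lambda>m. int (mdeg m)) ` keys p"
    have "hcomp 0 (p * q) = (\<Sum>k\<in>?K. hcomp 0 (hcomp k p * q))"
      by (subst sum_hcomp[of p, symmetric]) (simp add: sum_distrib_right hcomp_sum)
    also have "\<dots> = (\<Sum>k\<in>?K. if k = 0 then hcomp 0 p * hcomp 0 q else 0)"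
    proof (intro sum.cong refl)
      fix k assume "k \<in> ?K"
      then have "hcomp (0 - k) q = 0" if "k \<noteq> 0" using that homogeneous_neg[OF homogeneous_hcomp, of "0 - k" q] by auto
      then show "hcomp 0 (hcomp k p * q) = (if k = 0 then hcomp 0 p * hcomp 0 q else 0)"
        using hcomp_mult[of k "hcomp k p" 0 q] by auto
    qed
    also have "\<dots> = hcomp 0 p * hcomp 0 q" by (auto simp: sum.delta hcomp_eq_0)
    finally show ?thesis unfolding h by (metis Const.hom_mult Const_inject)
  qed
  then show ?case using mult by (simp add: peval.hom_mult)
next
  case (Const c) show ?case by simp (simp add: Const_def)
next
  case (Var i)
  have "single i (1::nat) \<noteq> 0" by (metis mdeg_single mdeg_0 zero_neq_one)
  then show ?case by simp (simp add: Var_def lookup_single)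
qed (auto simp: peval.hom_add lookup_add)

text \<open>Setting \<open>h = 1\<close> in the manner of Rabinowitsch leaves no common zero, hence
  a relation \<open>1 = j + (h - 1) * a\<close>. Comparing homogeneous components turns it into
  membership of a power of \<open>h\<close>, without an additional variable.\<close>

theorem homogeneous_nullstellensatz:
  assumes J: "homog_ideal J" and h: "homogeneous e h" "e > 0"
    and van: "\<And>v. v \<noteq> (\<lambda>_. 0) \<Longrightarrow> (\<forall>p\<in>J. peval v p = 0) \<Longrightarrow> peval v h = 0"
  obtains N where "h ^ N \<in> J"
proof -
  have iJ: "ideal4 J" using J by (simp add: homog_ideal_def)
  have "1 \<in> ideal_plus J (h - 1)"
  proof (rule ccontr)
    assume "1 \<notin> ideal_plus J (h - 1)"
    then obtain v where v: "\<And>p. p \<in> ideal_plus J (h - 1) \<Longrightarrow> peval v p = 0"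
      using weak_nullstellensatz[OF ideal4_plus[OF iJ]] by blast
    then have "peval v h = 1" using v[OF ideal_plus_contains(2)[OF iJ, of "h - 1"]] by (simp add: peval.hom_minus)
    moreover have "\<forall>p\<in>J. peval v p = 0" using v ideal_plus_contains(1)[OF iJ] by blast
    \<comment> \<open>The origin is excluded because a form of positive degree vanishes
      there.\<close>
    moreover have "v \<noteq> (\<lambda>_. 0)" using \<open>peval v h = 1\<close> homogeneous_pos_lookup_0[OF h(1)] h(2) by (auto simp: peval_zero)
    ultimately show False using van by auto
  qed
  then obtain j a where ja: "1 = j + (h - 1) * a" "j \<in> J" by (auto simp: ideal_plus_def)
  have comp: "hcomp k 1 = hcomp k j + h * hcomp (k - e) a - hcomp k a" for k
    by (subst ja(1)) (simp add: hcomp_add left_diff_distrib hcomp_diff hcomp_mult[OF h(1)])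
  have hj: "hcomp k j \<in> J" for k using ja(2) J by (auto simp: homog_ideal_def)
  \<comment> \<open>Modulo \<open>J\<close> the relation says that the component of \<open>a\<close>
    in degree 0 is -1 and that each step by \<open>e\<close> multiplies the component by
    \<open>h\<close>; so in degree \<open>m * e\<close> it is -h^m.\<close>
  have m: "hcomp (int m * e) a + h ^ m \<in> J" for m
  proof (induction m)
    case 0
    have "hcomp (- e) a = 0" using homogeneous_neg[OF homogeneous_hcomp, of "- e" a] h(2) by simp
    then have "hcomp 0 a + 1 = hcomp 0 j" using comp[of 0] hcomp_homogeneous[OF homogeneous_1, of 0] by (simp add: algebra_simps)
    then show ?case using hj[of 0] by simp
  next
    case (Suc m)
    have "hcomp (int (Suc m) * e) 1 = 0" using hcomp_homogeneous[OF homogeneous_1, of "int (Suc m) * e"] h(2) by auto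
    moreover have "int (Suc m) * e - e = int m * e" by (simp add: algebra_simps)
    ultimately have "hcomp (int (Suc m) * e) a = hcomp (int (Suc m) * e) j + h * hcomp (int m * e) a"
      using comp[of "int (Suc m) * e"] by (simp add: algebra_simps)
    then have "hcomp (int (Suc m) * e) a + h ^ Suc m = hcomp (int (Suc m) * e) j + h * (hcomp (int m * e) a + h ^ m)"
      by (simp add: algebra_simps)
    also have "\<dots> \<in> J" by (intro ideal4D[OF iJ] hj Suc)
    finally show ?case .
  qed
  \<comment> \<open>\<open>a\<close> has finitely many components. In degree
    \<open>nat b * e\<close>, beyond all of them, only the power of \<open>h\<close> is
    left.\<close>
  have "finite ((\<lambda>m. int (mdeg m)) ` keys a)" by simp
  then obtain b where b: "\<And>m. m \<in> keys a \<Longrightarrow> int (mdeg m) < b"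
    by (metis Max_ge imageI zless_add1_eq order_le_less)
  have "hcomp (int (nat b) * e) a = 0"
  proof (rule hcomp_eq_0)
    show "int (nat b) * e \<notin> (\<lambda>m. int (mdeg m)) ` keys a"
    proof
      assume "int (nat b) * e \<in> (\<lambda>m. int (mdeg m)) ` keys a"
      then obtain m where "m \<in> keys a" and m: "int (nat b) * e = int (mdeg m)" by auto
      then have lt: "int (mdeg m) < b" using b by blast
      then have "b \<le> b * e" using h(2) by (simp add: mult_le_cancel_left1)
      with lt m show False by simp
    qed
  qed
  with m[of "nat b"] that show ?thesis by simp
qed

lemma single_mem_ideal:
  assumes I: "ideal4 I" and i: "Var i ^ N \<in> I" and m: "N \<le> lookup m i"
  shows "single m c \<in> I"
proof -
  have "m = single i N + (m - single i N)"
    using m by (intro poly_mapping_eqI) (auto simp: lookup_add lookup_minus lookup_single when_def)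
  then have "single m c = Var i ^ N * single (m - single i N) c" by (simp add: Var_power mult_single)
  then show ?thesis using ideal4D(4)[OF I i] by simp
qed

text \<open>Pigeonhole: a monomial in four variables with all exponents below \<open>N\<close> has
  degree below 4N.\<close>

lemma forms_subset_of_Var_powers:
  assumes I: "ideal4 I" and N: "\<And>i. Var i ^ N \<in> I" and k: "k \<ge> 4 * N" "N > 0"
  shows "forms (int k) \<subseteq> I"
proof
  fix p assume "p \<in> forms (int k)"
  then have hom: "mdeg m = k" if "m \<in> keys p" for m using that by (auto simp: homogeneous_def)
  have "(\<Sum>m\<in>keys p. single m (lookup p m)) \<in> I"
  proof (rule ideal4_sum[OF I])
    fix m assume "m \<in> keys p"
    then have "mdeg m = k" by (rule hom)
    have "\<exists>i. N \<le> lookup m i"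
    proof (rule ccontr)
      assume "\<not> ?thesis"
      then have "mdeg m < card (UNIV :: 4 set) * N" unfolding mdeg_def
        using sum_bounded_above_strict[of UNIV "lookup m" N] by (auto simp: not_le)
      then show False using \<open>mdeg m = k\<close> k by simp
    qed
    then show "single m (lookup p m) \<in> I" using single_mem_ideal[OF I N] by blast
  qed
  then show "p \<in> I" by (simp add: sum_singles)
qed

lemma power_mem_ideal_mono: "ideal4 I \<Longrightarrow> p ^ n \<in> I \<Longrightarrow> n \<le> m \<Longrightarrow> p ^ m \<in> I"
  using ideal4D(3)[of I "p ^ n" "p ^ (m - n)"] by (simp flip: power_add)

lemma finite_common_bound:
  fixes P :: "'a::finite \<Rightarrow> nat \<Rightarrow> bool"
  assumes "\<And>i. \<exists>n. P i n" "\<And>i n m. P i n \<Longrightarrow> n \<le> m \<Longrightarrow> P i m"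
  obtains n where "n > 0" "\<And>i. P i n"
proof -
  obtain g where g: "\<And>i. P i (g i)" using assms(1) by metis
  have "g i \<le> Suc (\<Sum>i\<in>UNIV. g i)" for i using member_le_sum[of i UNIV g] by simp
  then show ?thesis using that[of "Suc (\<Sum>i\<in>UNIV. g i)"] g assms(2) by blast
qed

theorem projective_nullstellensatz:
  assumes J: "homog_ideal J" and empty: "\<And>v. v \<noteq> (\<lambda>_. 0) \<Longrightarrow> \<exists>p\<in>J. peval v p \<noteq> 0"
  obtains N where "\<And>i. Var i ^ N \<in> J" "N > 0" "\<And>k. k \<ge> 4 * N \<Longrightarrow> forms (int k) \<subseteq> J"
proof -
  have iJ: "ideal4 J" using J by (simp add: homog_ideal_def)
  have ex: "\<exists>n. Var i ^ n \<in> J" for i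
  proof -
    have V: "peval v (Var i) = 0" if "v \<noteq> (\<lambda>_. 0)" "\<forall>p\<in>J. peval v p = 0" for v
      using empty[OF that(1)] that(2) by blast
    show ?thesis
      by (rule homogeneous_nullstellensatz[of J 1 "Var i", OF J homogeneous_Var]) (use V in auto)
  qed
  show ?thesis
  proof (rule finite_common_bound[of "\<lambda>i n. Var i ^ n \<in> J"])
    fix i n m assume "Var i ^ n \<in> J" "n \<le> m"
    then show "Var i ^ m \<in> J" by (rule power_mem_ideal_mono[OF iJ])
  next
    fix N assume N: "N > 0" "\<And>i. Var i ^ N \<in> J"
    show ?thesis by (rule that[OF N(2,1) forms_subset_of_Var_powers[OF iJ N(2) _ N(1)]])
  qed (rule ex)
qed

section \<open>Hilbert functions of homogeneous ideals\<close>

abbreviation "qdim4 \<equiv> qdim (\<lambda>c p. Const c * p :: poly4)"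

definition HF :: "poly4 set \<Rightarrow> nat \<Rightarrow> nat" where
  "HF I k = quot_dim (\<lambda>c p. Const c * p) (forms (int k)) (I \<inter> forms (int k))"

lemma hilbert_fun_eq: "hilbert_fun f = HF (jacobian_ideal f)"
  by (simp add: fun_eq_iff hilbert_fun_def HF_def)

lemma subspace_ideal_forms: "ideal4 I \<Longrightarrow> S.subspace (I \<inter> forms k)"
  by (intro S.subspace_inter ideal4_subspace subspace_forms)

lemma qdim_HF: "ideal4 I \<Longrightarrow> qdim4 (forms (int k)) (I \<inter> forms (int k)) (HF I k)"
proof -
  assume I: "ideal4 I"
  have s: "S.subspace {0}" by (rule S.subspace_single_0)
  have "{0} \<subseteq> I \<inter> forms (int k)" using ideal4D(1)[OF I] by auto
  then obtain b where b: "qdim4 (forms (int k)) (I \<inter> forms (int k)) b"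
    using S.qdim_split[OF subspace_ideal_forms[OF I] s subspace_forms _ Int_lower2 qdim_forms] by blast
  then show ?thesis unfolding HF_def using S.quot_dim_eq[OF subspace_ideal_forms[OF I] b] by simp
qed

lemma HF_eq_0_iff: "ideal4 I \<Longrightarrow> HF I k = 0 \<longleftrightarrow> forms (int k) \<subseteq> I"
proof
  assume I: "ideal4 I"
  { assume "HF I k = 0" then show "forms (int k) \<subseteq> I" using S.qdim_0_subset qdim_HF[OF I, of k] by fastforce }
  assume "forms (int k) \<subseteq> I"
  then have "I \<inter> forms (int k) = forms (int k)" by auto
  then show "HF I k = 0" 
    using qdim_HF[OF I, of k] by (intro S.qdim_unique[OF subspace_forms _ S.qdim_refl[OF subspace_forms]]) simp
qed

text \<open>Multiplication by a linear form \<open>l\<close> gives the exact sequence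
  \<open>0 \<rightarrow> K \<rightarrow> (S/I)\<^sub>k \<rightarrow> (S/I)\<^sub>k\<^sub>+\<^sub>1 \<rightarrow> (S/(I + l))\<^sub>k\<^sub>+\<^sub>1 \<rightarrow> 0\<close>.\<close>
lemma HF_linear_form:
  assumes I: "homog_ideal I" and l: "homogeneous 1 l"
  obtains a where "qdim4 {p \<in> forms (int k). l * p \<in> I} (I \<inter> forms (int k)) a"
    "HF I (Suc k) + a = HF I k + HF (ideal_plus I l) (Suc k)"
proof -
  have iI: "ideal4 I" using I by (simp add: homog_ideal_def)
  let ?I' = "ideal_plus I l" and ?K = "{p \<in> forms (int k). l * p \<in> I}"
  have iI': "ideal4 ?I'" by (rule ideal4_plus[OF iI])
  note sub = subspace_ideal_forms
  have sK: "S.subspace ?K"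
    using ideal4D[OF iI] homogeneous_add homogeneous_Const_mult
    by (auto simp: S.subspace_def distrib_left mult.left_commute[of l])
  have IK: "I \<inter> forms (int k) \<subseteq> ?K" "?K \<subseteq> forms (int k)" using ideal4D[OF iI] by auto
  obtain a m where a: "qdim4 ?K (I \<inter> forms (int k)) a" and m: "qdim4 (forms (int k)) ?K m" and am: "a + m = HF I k"
    using S.qdim_split[OF sK sub[OF iI] subspace_forms IK qdim_HF[OF iI]] by blast
  interpret L: cspace_linear "\<lambda>c p. Const c * p" "\<lambda>c p. Const c * p" "\<lambda>p. l * p"
    by unfold_locales (auto simp: algebra_simps)
  have "qdim4 (forms (int k)) ?K m \<longleftrightarrow> qdim4 (?I' \<inter> forms (int (Suc k))) (I \<inter> forms (int (Suc k))) m"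
  proof (rule L.qdim_iso[OF subspace_forms sK sub[OF iI'] sub[OF iI]])
    fix v assume v: "v \<in> forms (int k)"
    then have hv: "homogeneous (int (Suc k)) (l * v)" using homogeneous_mult[OF l, of "int k" v] by (simp add: add.commute)
    moreover have "l * v \<in> ?I'" using ideal4D(4)[OF iI' ideal_plus_contains(2)[OF iI]] .
    ultimately show "l * v \<in> ?I' \<inter> forms (int (Suc k))" by simp
    show "(l * v \<in> I \<inter> forms (int (Suc k))) = (v \<in> ?K)" using v hv by auto
  next
    fix p assume "p \<in> ?I' \<inter> forms (int (Suc k))"
    then obtain x y where xy: "p = x + l * y" "x \<in> I" and p: "homogeneous (int (Suc k)) p" by (auto simp: ideal_plus_def)
    have "p = hcomp (int (Suc k)) p" using hcomp_homogeneous[OF p] by simp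
    also have "\<dots> = hcomp (int (Suc k)) x + l * hcomp (int k) y"
      by (simp add: xy(1) hcomp_add hcomp_mult[OF l])
    finally have "p - l * hcomp (int k) y = hcomp (int (Suc k)) x" by (simp add: algebra_simps)
    moreover have "hcomp (int (Suc k)) x \<in> I" using xy(2) I by (simp add: homog_ideal_def)
    ultimately show "\<exists>v\<in>forms (int k). p - l * v \<in> I \<inter> forms (int (Suc k))"
      by (intro bexI[of _ "hcomp (int k) y"]) auto
  qed
  with m have "qdim4 (?I' \<inter> forms (int (Suc k))) (I \<inter> forms (int (Suc k))) m" by simp
  then have "qdim4 (forms (int (Suc k))) (I \<inter> forms (int (Suc k))) (m + HF ?I' (Suc k))"
    using ideal_plus_contains(1)[OF iI] by (intro S.qdim_add[OF sub[OF iI'] sub[OF iI] _ _ _ qdim_HF[OF iI']]) blast+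
  then have "m + HF ?I' (Suc k) = HF I (Suc k)" by (rule S.qdim_unique[OF sub[OF iI] _ qdim_HF[OF iI]])
  with a am that show ?thesis by simp
qed

lemma HF_Suc_le: "homog_ideal I \<Longrightarrow> homogeneous 1 l \<Longrightarrow> HF I (Suc k) \<le> HF I k + HF (ideal_plus I l) (Suc k)"
  by (rule HF_linear_form[of I l k]) auto

text \<open>In the count of \<open>HF_linear_form\<close> the hypotheses leave dimension 0 for the
  kernel of multiplication by \<open>l\<close>.\<close>

lemma HF_Suc_eq_imp_injective:
  assumes I: "homog_ideal I" and l: "homogeneous 1 l"
    and "HF (ideal_plus I l) (Suc k) = 0" "HF I (Suc k) = HF I k" "homogeneous (int k) p" "l * p \<in> I"
  shows "p \<in> I"
proof -
  obtain a where a: "qdim4 {p \<in> forms (int k). l * p \<in> I} (I \<inter> forms (int k)) a"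
    "HF I (Suc k) + a = HF I k + HF (ideal_plus I l) (Suc k)" by (rule HF_linear_form[OF I l])
  from a(2) assms(3,4) have "a = 0" by simp
  with a(1) have "{p \<in> forms (int k). l * p \<in> I} \<subseteq> I \<inter> forms (int k)" using S.qdim_0_subset by blast
  then show ?thesis using assms(5,6) by auto
qed

declare pCons_one [simp del]

section \<open>A line avoiding the singular locus\<close>

lemma peval_scale:
  assumes "homogeneous (int k) p" shows "peval (\<lambda>i. c * v i) p = c ^ k * peval v p"
  unfolding peval_def sum_distrib_left
proof (rule sum.cong)
  fix m assume "m \<in> keys p"
  then have "mdeg m = k" using assms by (auto simp: homogeneous_def)
  then have "(\<Prod>i\<in>UNIV. c ^ lookup m i) = c ^ k" by (simp add: mdeg_def power_sum[symmetric])
  then show "lookup p m * (\<Prod>i\<in>UNIV. (c * v i) ^ lookup m i) = c ^ k * (lookup p m * (\<Prod>i\<in>UNIV. v i ^ lookup m i))"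
    by (simp add: power_mult_distrib prod.distrib)
qed simp

lemma hom_eval: "comm_ring_hom h \<Longrightarrow> comm_ring_hom (\<lambda>p. poly (map_poly h p) a)"
proof -
  assume "comm_ring_hom h"
  then interpret h: comm_ring_hom h .
  interpret map_poly_comm_ring_hom h ..
  show ?thesis by unfold_locales (auto simp: hom_add hom_mult)
qed

lemma hom_eval_simps:
  assumes "comm_ring_hom h"
  shows "poly (map_poly h [:c:]) a = h c" "poly (map_poly h [:b, c:]) a = h b + a * h c"
proof -
  from assms interpret h: comm_ring_hom h .
  show "poly (map_poly h [:c:]) a = h c" "poly (map_poly h [:b, c:]) a = h b + a * h c"
    by (simp_all add: Polynomial.map_poly_pCons)
qed

lemma poly_hom_unique:
  fixes g h :: "'a::comm_ring_1 poly \<Rightarrow> 'b::comm_ring_1"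
  assumes "comm_ring_hom g" "comm_ring_hom h" "\<And>c. g [:c:] = h [:c:]" "g [:0, 1:] = h [:0, 1:]"
  shows "g p = h p"
proof -
  interpret g: comm_ring_hom g by fact
  interpret h: comm_ring_hom h by fact
  show ?thesis
  proof (induction p)
    case (pCons a p)
    have eq: "pCons a p = [:a:] + [:0, 1:] * p" by simp
    show ?case unfolding eq g.hom_add h.hom_add g.hom_mult h.hom_mult by (simp add: assms pCons)
  qed simp
qed

lemma pCons_0_hom: "comm_ring_hom (\<lambda>c. [:c:])"
  by unfold_locales (auto simp: one_pCons)

section \<open>Polynomials restricted to lines in a fixed direction\<close>

definition K3 :: "complex \<Rightarrow> complex poly poly poly" where "K3 c = [:[:[:c:]:]:]"

text \<open>C[x_0, x_1, x_2] is modelled by nested univariate polynomials, x_0 innermost. Resultants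
  and prime factorisation are then at hand, and points are specialised one variable at a
  time.\<close>

definition X3 :: "4 \<Rightarrow> complex poly poly poly" where
  "X3 i = (if i = 0 then [:[:[:0, 1:]:]:] else if i = 1 then [:[:0, 1:]:] else if i = 2 then [:0, 1:] else 0)"

text \<open>The substitution \<open>p \<mapsto> p(x + T v)\<close> with \<open>x\<^sub>3 = 0\<close>, an isomorphism when \<open>v 3 \<noteq> 0\<close>; the outermost
  variable of the iterated polynomial ring is \<open>T\<close>.\<close>
definition Phi :: "(4 \<Rightarrow> complex) \<Rightarrow> poly4 \<Rightarrow> complex poly poly poly poly" where
  "Phi v = subst_hom (\<lambda>c. [:K3 c:]) (\<lambda>i. [:X3 i, K3 (v i):])"

definition E3 :: "complex \<Rightarrow> complex \<Rightarrow> complex \<Rightarrow> complex poly poly poly \<Rightarrow> complex" where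
  "E3 x y z r = poly (poly (poly r [:[:z:]:]) [:y:]) x"

lemma K3_hom: "comm_ring_hom K3"
  by unfold_locales (auto simp: K3_def one_pCons)

lemma E3_hom: "comm_ring_hom (E3 x y z)"
  by unfold_locales (auto simp: E3_def)

lemma K3_const_hom: "comm_ring_hom (\<lambda>c. [:K3 c:])"
  by (rule comm_ring_hom_compose[OF pCons_0_hom K3_hom])

lemma Phi_hom: "comm_ring_hom (Phi v)"
  unfolding Phi_def by (rule subst_hom_hom[OF K3_const_hom])

lemma Phi_Const: "Phi v (Const c) = [:K3 c:]" and Phi_Var: "Phi v (Var i) = [:X3 i, K3 (v i):]"
  by (simp_all add: Phi_def subst_hom_Const subst_hom_Var K3_const_hom)

interpretation Phi: comm_ring_hom "Phi v" by (rule Phi_hom)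

lemma cases_4: "(i::4) = 0 \<or> i = 1 \<or> i = 2 \<or> i = 3"
proof -
  have "i \<in> {0,1,2,3}" unfolding UNIV_4[symmetric] by (rule UNIV_I)
  then show ?thesis unfolding insert_iff empty_iff by (elim disjE FalseE) simp_all
qed

text \<open>Writing a point w as x + T v with x_3 = 0 forces T = w_3 / v_3 and x_i = w_i - (v_i /
  v_3) w_3. The inverse evaluates the nested variables at these linear forms, from the innermost
  outwards.\<close>

lemma Phi_inverse:
  assumes v: "v 3 \<noteq> 0"
  obtains Psi where "comm_ring_hom Psi" "\<And>p. Psi (Phi v p) = p" "\<And>q. Phi v (Psi q) = q"
proof -
  define a where "a i = Var i - Const (v i / v 3) * Var 3" for i
  define P1 where "P1 p = poly (map_poly Const p) (a 0)" for p
  define P2 where "P2 p = poly (map_poly P1 p) (a 1)" for p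
  define P3 where "P3 p = poly (map_poly P2 p) (a 2)" for p
  define P4 where "P4 p = poly (map_poly P3 p) (Const (1 / v 3) * Var 3)" for p
  have h1: "comm_ring_hom P1" unfolding P1_def by (rule hom_eval[OF Const_hom])
  have h2: "comm_ring_hom P2" unfolding P2_def by (rule hom_eval[OF h1])
  have h3: "comm_ring_hom P3" unfolding P3_def by (rule hom_eval[OF h2])
  have h4: "comm_ring_hom P4" unfolding P4_def by (rule hom_eval[OF h3])
  interpret h1: comm_ring_hom P1 by (rule h1)
  interpret h2: comm_ring_hom P2 by (rule h2)
  interpret h3: comm_ring_hom P3 by (rule h3)
  interpret h4: comm_ring_hom P4 by (rule h4)
  have s1: "P1 [:c:] = Const c" "P1 [:0, 1:] = a 0" for c
    unfolding P1_def hom_eval_simps[OF Const_hom] by simp_all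
  have s2: "P2 [:c:] = P1 c" "P2 [:0, 1:] = a 1" for c
    unfolding P2_def hom_eval_simps[OF h1] by simp_all
  have s3: "P3 [:c:] = P2 c" "P3 [:0, 1:] = a 2" for c
    unfolding P3_def hom_eval_simps[OF h2] by simp_all
  have s4: "P4 [:c:] = P3 c" "P4 [:b, c:] = P3 b + Const (1 / v 3) * Var 3 * P3 c" for b c
    unfolding P4_def hom_eval_simps[OF h3] by simp_all
  have K: "P3 (K3 c) = Const c" for c by (simp add: K3_def s1 s2 s3)
  have X: "P3 (X3 i) = a i" for i
    using cases_4[of i] v by (elim disjE) (simp_all add: X3_def s1 s2 s3 a_def)
  have "P4 (Phi v p) = p" for p
  proof (rule hom_unique[OF comm_ring_hom_compose[OF h4 Phi_hom] comm_ring_hom_id])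
    fix i
    have "Const (1 / v 3) * Var 3 * Const (v i) = Const (1 / v 3 * v i) * Var 3"
      unfolding Const.hom_mult by (simp only: mult_ac)
    moreover have "1 / v 3 * v i = v i / v 3" by simp
    ultimately have "Const (1 / v 3) * Var 3 * Const (v i) = Const (v i / v 3) * Var 3" by (simp only:)
    then show "P4 (Phi v (Var i)) = Var i" by (simp add: Phi_Var s4 K X a_def)
  qed (simp add: Phi_Const s4 K)
  moreover have "Phi v (P4 q) = q" for q
  proof (rule poly_hom_unique[OF comm_ring_hom_compose[OF Phi_hom h4] comm_ring_hom_id])
    have Pa: "Phi v (a i) = [:X3 i:]" for i
    proof -
      have "K3 (v i / v 3) * K3 (v 3) = K3 (v i)" using v by (simp add: K3_def one_pCons)
      moreover have "X3 3 = 0" by (simp add: X3_def)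
      ultimately show ?thesis by (simp add: a_def Phi.hom_minus Phi.hom_mult Phi_Const Phi_Var mult.commute)
    qed
    have PT: "Phi v (Const (1 / v 3) * Var 3) = [:0, 1:]"
      using v by (simp add: Phi.hom_mult Phi_Const Phi_Var X3_def K3_def one_pCons)
    show "Phi v (P4 [:0, 1:]) = [:0, 1:]" using PT by (simp add: s4)
    fix c
    have "Phi v (P3 c) = [:c:]"
    proof (rule poly_hom_unique[OF comm_ring_hom_compose[OF Phi_hom h3] pCons_0_hom])
      show "Phi v (P3 [:0, 1:]) = [:[:0, 1:]:]" by (simp add: s3 Pa X3_def)
      fix c
      have "Phi v (P2 c) = [:[:c:]:]"
      proof (rule poly_hom_unique[OF comm_ring_hom_compose[OF Phi_hom h2] comm_ring_hom_compose[OF pCons_0_hom pCons_0_hom]])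
        show "Phi v (P2 [:0, 1:]) = [:[:[:0, 1:]:]:]" by (simp add: s2 Pa X3_def)
        fix c
        have "Phi v (P1 c) = [:[:[:c:]:]:]"
        proof (rule poly_hom_unique[OF comm_ring_hom_compose[OF Phi_hom h1]
              comm_ring_hom_compose[OF pCons_0_hom comm_ring_hom_compose[OF pCons_0_hom pCons_0_hom]]])
          show "Phi v (P1 [:0, 1:]) = [:[:[:[:0, 1:]:]:]:]" by (simp add: s1 Pa X3_def)
        qed (simp add: s1 Phi_Const K3_def)
        then show "Phi v (P2 [:c:]) = [:[:[:c:]:]:]" by (simp add: s2)
      qed
      then show "Phi v (P3 [:c:]) = [:[:c:]:]" by (simp add: s3)
    qed
    then show "Phi v (P4 [:c:]) = [:c:]" by (simp add: s4)
  qed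
  ultimately show ?thesis using that h4 by blast
qed

lemma squarefree_Phi:
  assumes "v 3 \<noteq> 0" "squarefree f" shows "squarefree (Phi v f)"
proof (rule squarefreeI)
  obtain Psi where Psi: "comm_ring_hom Psi" "\<And>p. Psi (Phi v p) = p" "\<And>q. Phi v (Psi q) = q"
    using Phi_inverse[of v, OF assms(1)] by blast
  interpret Psi: comm_ring_hom Psi by (rule Psi(1))
  fix x assume "x ^ 2 dvd Phi v f"
  then obtain w where "Phi v f = x ^ 2 * w" by (auto elim: dvdE)
  then have "f = Psi x ^ 2 * Psi w" by (metis Psi(2) Psi.hom_mult Psi.hom_power)
  then have "Psi x dvd 1" using squarefreeD[OF assms(2), of "Psi x"] by simp
  then obtain y where "1 = Psi x * y" by (auto elim: dvdE)
  then have "1 = x * Phi v y" by (metis Phi.hom_one Phi.hom_mult Psi(3))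
  then show "x dvd 1" by (rule dvdI)
qed

text \<open>The degree bound \<open>n\<close> is prescribed and \<open>a\<close> may be zero, unlike
  for \<open>lead_coeff\<close>; the notion is therefore stable under sums and products even if
  leading terms cancel.\<close>

definition top_coeff :: "nat \<Rightarrow> 'a::comm_ring_1 poly \<Rightarrow> 'a \<Rightarrow> bool" where
  "top_coeff n q a \<longleftrightarrow> degree q \<le> n \<and> coeff q n = a"

lemma top_coeff_mult:
  assumes "top_coeff m p a" "top_coeff n q b" shows "top_coeff (m + n) (p * q) (a * b)"
proof -
  have le: "degree p \<le> m" "degree q \<le> n" using assms by (auto simp: top_coeff_def)
  have "coeff (p * q) (m + n) = coeff p m * coeff q n"
  proof (cases "degree p = m \<and> degree q = n")
    case True then show ?thesis using coeff_mult_degree_sum[of p q] by simp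
  next
    case False
    then have "coeff p m * coeff q n = 0" using le by (auto simp: coeff_eq_0)
    moreover have "degree (p * q) < m + n" using False le degree_mult_le[of p q] by linarith
    ultimately show ?thesis by (simp add: coeff_eq_0)
  qed
  moreover have "degree (p * q) \<le> m + n" using le degree_mult_le[of p q] by linarith
  ultimately show ?thesis using assms by (simp add: top_coeff_def)
qed

lemma top_coeff_1: "top_coeff 0 1 1"
  by (simp add: top_coeff_def)

lemma top_coeff_power: "top_coeff m p a \<Longrightarrow> top_coeff (n * m) (p ^ n) (a ^ n)"
  by (induction n) (auto simp: top_coeff_1 intro: top_coeff_mult)

lemma top_coeff_prod:
  "(\<And>i. i \<in> A \<Longrightarrow> top_coeff (n i) (p i) (a i)) \<Longrightarrow> top_coeff (\<Sum>i\<in>A. n i) (\<Prod>i\<in>A. p i) (\<Prod>i\<in>A. a i)"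
  by (induction A rule: infinite_finite_induct) (auto simp: top_coeff_1 intro: top_coeff_mult)

lemma top_coeff_sum:
  "(\<And>i. i \<in> A \<Longrightarrow> top_coeff n (p i) (a i)) \<Longrightarrow> top_coeff n (\<Sum>i\<in>A. p i) (\<Sum>i\<in>A. a i)"
  by (induction A rule: infinite_finite_induct) (auto simp: top_coeff_def intro: degree_add_le)

text \<open>The highest power of T arises by taking T v_i from every factor. If f(v) is nonzero, f(x
  + T v) thus has a constant unit as leading coefficient.\<close>

lemma Phi_top_coeff:
  assumes "homogeneous (int k) p" shows "top_coeff k (Phi v p) (K3 (peval v p))"
proof -
  interpret K3: comm_ring_hom K3 by (rule K3_hom)
  have K: "K3 (peval v p) = (\<Sum>m\<in>keys p. K3 (lookup p m) * (\<Prod>i\<in>UNIV. K3 (v i) ^ lookup m i))"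
    by (simp add: peval_def K3.hom_sum K3.hom_mult K3.hom_prod K3.hom_power)
  show ?thesis unfolding K Phi_def subst_hom_def
  proof (rule top_coeff_sum)
    fix m assume "m \<in> keys p"
    then have m: "mdeg m = k" using assms by (auto simp: homogeneous_def)
    have "top_coeff (0 + (\<Sum>i\<in>UNIV. lookup m i * 1)) ([:K3 (lookup p m):] * (\<Prod>i\<in>UNIV. [:X3 i, K3 (v i):] ^ lookup m i))
        (K3 (lookup p m) * (\<Prod>i\<in>UNIV. K3 (v i) ^ lookup m i))"
      by (intro top_coeff_mult top_coeff_prod top_coeff_power) (auto simp: top_coeff_def)
    then show "top_coeff k ([:K3 (lookup p m):] * (\<Prod>i\<in>UNIV. [:X3 i, K3 (v i):] ^ lookup m i))
        (K3 (lookup p m) * (\<Prod>i\<in>UNIV. K3 (v i) ^ lookup m i))"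
      using m by (simp add: mdeg_def)
  qed
qed

text \<open>Chain rule: differentiating along T is the directional derivative along
  \<open>v\<close>. Both sides are derivations over \<open>Phi v\<close> that agree on
  generators.\<close>

lemma pderiv_Phi: "pderiv (Phi v p) = Phi v (\<Sum>i\<in>UNIV. Const (v i) * pd i p)"
proof (rule derivation_unique[where h = "Phi v" and D = "\<lambda>p. pderiv (Phi v p)"
      and D' = "\<lambda>p. Phi v (\<Sum>i\<in>UNIV. Const (v i) * pd i p)"])
  fix i
  have "(\<Sum>j\<in>UNIV. Const (v j) * pd j (Var i)) = (\<Sum>j\<in>UNIV. if j = i then Const (v i) else 0)"
    by (rule sum.cong) (auto simp: pd_Var)
  then show "pderiv (Phi v (Var i)) = Phi v (\<Sum>j\<in>UNIV. Const (v j) * pd j (Var i))"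
    by (simp add: Phi_Var Phi_Const pderiv_pCons)
qed (simp_all add: Phi.hom_add Phi.hom_mult Phi.hom_sum pderiv_add pderiv_mult pd_add pd_mult Phi_Const
    sum.distrib sum_distrib_left sum_distrib_right algebra_simps)

lemma eval_Phi:
  "poly (map_poly (E3 x y z) (Phi v p)) t = peval (\<lambda>i. E3 x y z (X3 i) + t * v i) p"
proof (rule hom_unique[OF comm_ring_hom_compose[OF hom_eval[OF E3_hom] Phi_hom] peval.comm_ring_hom_axioms])
  have E: "E3 x y z (K3 c) = c" for c by (simp add: E3_def K3_def)
  show "poly (map_poly (E3 x y z) (Phi v (Const c))) t = peval (\<lambda>i. E3 x y z (X3 i) + t * v i) (Const c)" for c
    by (simp add: Phi_Const hom_eval_simps[OF E3_hom] E)
  show "poly (map_poly (E3 x y z) (Phi v (Var i))) t = peval (\<lambda>i. E3 x y z (X3 i) + t * v i) (Var i)" for i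
    by (simp add: Phi_Var hom_eval_simps[OF E3_hom] E)
qed

lemma ex_nonroot:
  fixes r :: "'a::idom poly"
  assumes "r \<noteq> 0" "infinite A" obtains a where "a \<in> A" "poly r a \<noteq> 0"
proof -
  have "finite {a. poly r a = 0}" by (rule poly_roots_finite[OF assms(1)])
  then have "\<not> A \<subseteq> {a. poly r a = 0}" using assms(2) finite_subset by blast
  then show ?thesis using that by blast
qed

lemma infinite_range_const: "infinite (range (\<lambda>c::complex. [:c:]))" "infinite (range (\<lambda>c::complex. [:[:c:]:]))"
    "infinite (range K3)"
  by (auto simp: finite_image_iff inj_on_def K3_def infinite_UNIV_char_0)

lemma E3_nonzero:
  assumes "r \<noteq> 0" obtains x y z where "E3 x y z r \<noteq> 0"
proof -
  obtain z where z: "poly r [:[:z:]:] \<noteq> 0" using ex_nonroot[OF assms infinite_range_const(2)] by blast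
  obtain y where y: "poly (poly r [:[:z:]:]) [:y:] \<noteq> 0" using ex_nonroot[OF z infinite_range_const(1)] by blast
  obtain x where "poly (poly (poly r [:[:z:]:]) [:y:]) x \<noteq> 0" using ex_nonroot[OF y infinite_UNIV_char_0] by blast
  then show ?thesis using that by (auto simp: E3_def)
qed

text \<open>The isomorphism \<open>Phi v\<close> turns \<open>p\<close> into a nonzero iterated
  univariate polynomial, where non-roots are chosen one variable at a time.\<close>

lemma peval_nonzero:
  assumes "p \<noteq> 0" obtains v where "peval v p \<noteq> 0"
proof -
  define v where "v i = (1 :: complex)" for i :: 4
  have v3: "v 3 \<noteq> 0" by (simp add: v_def)
  obtain Psi where Psi: "comm_ring_hom Psi" "\<And>p. Psi (Phi v p) = p" 
    using Phi_inverse[of v, OF v3] by metis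
  interpret Psi: comm_ring_hom Psi by (rule Psi(1))
  have "Phi v p \<noteq> 0" using Psi(2)[of p] assms Psi.hom_zero by metis
  then obtain t where "poly (Phi v p) (K3 t) \<noteq> 0" using ex_nonroot[OF _ infinite_range_const(3)] by blast
  then obtain x y z where xyz: "E3 x y z (poly (Phi v p) (K3 t)) \<noteq> 0" using E3_nonzero by blast
  interpret E3: comm_ring_hom "E3 x y z" by (rule E3_hom)
  have "E3 x y z (poly (Phi v p) (K3 t)) = poly (map_poly (E3 x y z) (Phi v p)) (E3 x y z (K3 t))" by simp
  with xyz that show ?thesis by (metis eval_Phi)
qed

text \<open>A prime \<open>g\<close> dividing \<open>F = g * h\<close> and its derivative divides
  \<open>h * pderiv g\<close>. The case \<open>g dvd h\<close> contradicts squarefreeness, and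
  \<open>g dvd pderiv g\<close> makes \<open>g\<close> constant. The coefficients form a ring and
  not a field, so a constant \<open>g\<close> must still be excluded; it would divide the leading
  coefficient, a unit.\<close>

lemma coprime_pderiv_Phi:
  fixes F :: "complex poly poly poly poly"
  assumes sf: "squarefree F" and lc: "lead_coeff F dvd 1"
  shows "resultant F (pderiv F) \<noteq> 0"
proof -
  have "F \<noteq> 0" using sf by auto
  have "degree (gcd F (pderiv F)) = 0"
  proof (rule ccontr)
    assume deg: "degree (gcd F (pderiv F)) \<noteq> 0"
    then have nu: "\<not> is_unit (gcd F (pderiv F))" using poly_dvd_1[of "gcd F (pderiv F)"] by auto
    have "gcd F (pderiv F) \<noteq> 0" using \<open>F \<noteq> 0\<close> by simp
    from prime_divisor_exists[OF this nu] obtain g where g: "prime g" "g dvd gcd F (pderiv F)" by blast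
    then have g1: "g dvd F" and g2: "g dvd pderiv F" by auto
    then obtain h where h: "F = g * h" by (auto elim: dvdE)
    have "g dvd g * pderiv h + h * pderiv g" using g2 by (simp add: h pderiv_mult)
    then have "g dvd h * pderiv g" using dvd_add_right_iff[of g "g * pderiv h" "h * pderiv g"] by simp
    then have "g dvd h \<or> g dvd pderiv g" by (rule prime_dvd_multD[OF g(1)])
    moreover have "\<not> g dvd h"
    proof
      assume "g dvd h"
      then have "g ^ 2 dvd F" by (auto simp: h power2_eq_square)
      then have "is_unit g" by (rule squarefreeD[OF sf])
      then show False using g(1) not_prime_unit[of g] by simp
    qed
    moreover have "degree g = 0" if "g dvd pderiv g" using that by simp
    ultimately have "degree g = 0" by blast
    then obtain c where c: "g = [:c:]" by (rule degree_eq_zeroE)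
    then have "c dvd lead_coeff F" using g1 const_poly_dvd_iff[of c F] by simp
    then have "c dvd 1" using lc by (rule dvd_trans)
    then have "is_unit g" using c is_unit_const_poly_iff[of c] by simp
    then show False using g(1) not_prime_unit[of g] by simp
  qed
  then show ?thesis by (simp add: resultant_0_gcd)
qed

lemma resultant_no_common_root:
  fixes p q :: "complex poly"
  assumes "resultant p q \<noteq> 0" "p \<noteq> 0" "poly p t = 0" shows "poly q t \<noteq> 0"
proof
  assume "poly q t = 0"
  with assms(3) have "[:-t, 1:] dvd gcd p q" by (auto simp: poly_eq_0_iff_dvd)
  moreover have "degree (gcd p q) = 0" using assms(1) by (simp add: resultant_0_gcd)
  moreover have "gcd p q \<noteq> 0" using assms(2) by simp
  ultimately show False using dvd_imp_degree_le[of "[:-t, 1:]" "gcd p q"] by simp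
qed

text \<open>The line is spanned by \<open>v\<close> with f(v) nonzero and a point \<open>u\<close>
  at which the discriminant of f(u + T v) is nonzero. By Euler's formula a singular point lies on f
  = 0, so it is not \<open>v\<close>; at u + t v it would give a multiple root t.\<close>

theorem line_avoiding_singular_locus:
  assumes sf: "squarefree f" and hom: "homogeneous (int d) f" and d: "d > 0"
  obtains l1 l2 where "homogeneous 1 l1" "homogeneous 1 l2"
    "\<And>w. w \<noteq> (\<lambda>_. 0) \<Longrightarrow> peval w l1 = 0 \<Longrightarrow> peval w l2 = 0 \<Longrightarrow> \<exists>i. peval w (pd i f) \<noteq> 0"
proof -
  have "f \<noteq> 0" using sf by auto
  moreover have "Var 3 \<noteq> 0" using peval_Var[of "\<lambda>_. 1" 3] by (metis peval.hom_zero zero_neq_one)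
  ultimately obtain v where "peval v (f * Var 3) \<noteq> 0" using peval_nonzero[of "f * Var 3"] by auto
  then have v: "v 3 \<noteq> 0" "peval v f \<noteq> 0" by (auto simp: peval.hom_mult)
  define F where "F = Phi v f"
  have top: "degree F \<le> d" "coeff F d = K3 (peval v f)"
    using Phi_top_coeff[OF hom, of v] by (auto simp: top_coeff_def F_def)
  have K0: "K3 c = 0 \<longleftrightarrow> c = 0" for c by (simp add: K3_def one_pCons)
  have degF: "degree F = d" using top v(2) K0 le_degree[of F d] by (metis order_antisym)
  have "K3 (peval v f) * K3 (1 / peval v f) = 1" using v(2) by (simp add: K3_def one_pCons)
  then have lc: "lead_coeff F dvd 1" using degF top(2) by (metis dvdI)
  define r where "r = resultant F (pderiv F)"
  have "r \<noteq> 0" unfolding r_def F_def using coprime_pderiv_Phi[OF squarefree_Phi[of v f, OF v(1) sf]] lc by (simp add: F_def)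
  \<comment> \<open>The factor \<open>X3 0\<close> ensures u_0 = x \<noteq> 0. With u_3 = 0 and v_3
    \<noteq> 0 this makes \<open>u\<close> and \<open>v\<close> linearly independent.\<close>
  moreover have "X3 0 \<noteq> 0" by (simp add: X3_def)
  ultimately obtain x y z where xyz: "E3 x y z (r * X3 0) \<noteq> 0" using E3_nonzero[of "r * X3 0"] by auto
  interpret E3: comm_ring_hom "E3 x y z" by (rule E3_hom)
  define u where "u i = E3 x y z (X3 i)" for i
  have u: "u 0 = x" "u 3 = 0" by (simp_all add: u_def E3_def X3_def)
  have Er: "E3 x y z r \<noteq> 0" and x: "x \<noteq> 0" using xyz u(1) by (auto simp: E3.hom_mult u_def)
  have EK: "E3 x y z (K3 c) = c" for c by (simp add: E3_def K3_def)
  \<comment> \<open>The resultant commutes with the specialisation provided the degrees do not drop;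
    both leading coefficients are nonzero constants by the choice of \<open>v\<close>.\<close>
  have degE: "degree (map_poly (E3 x y z) F) = degree F"
    using v(2) top(2) degF d by (intro degree_map_poly) (auto simp: EK)
  have degE': "degree (map_poly (E3 x y z) (pderiv F)) = degree (pderiv F)"
  proof -
    have "coeff (pderiv F) (d - 1) = of_nat d * K3 (peval v f)" using top(2) d by (simp add: coeff_pderiv)
    moreover have "degree (pderiv F) = d - 1" by (simp add: degree_pderiv degF)
    ultimately have "E3 x y z (lead_coeff (pderiv F)) \<noteq> 0"
      using d v(2) by (simp add: E3.hom_mult EK E3.hom_of_nat)
    then show ?thesis by (intro degree_map_poly) auto
  qed
  have res: "resultant (map_poly (E3 x y z) F) (map_poly (E3 x y z) (pderiv F)) \<noteq> 0"
    using E3.resultant_map_poly[OF degE degE'] Er by (simp add: r_def)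
  \<comment> \<open>The equations \<open>l 1 = 0\<close> and \<open>l 2 = 0\<close> cut out the span
    of \<open>u\<close> and \<open>v\<close>: subtracting the multiple of \<open>v\<close> that
    removes x_3 leaves a vector proportional to \<open>u\<close>.\<close>
  define l where "l i = Const x * (Var i - Const (v i / v 3) * Var 3) - Const (u i) * (Var 0 - Const (v 0 / v 3) * Var 3)" for i
  have hl: "homogeneous 1 (l i)" for i
    unfolding l_def by (intro homogeneous_diff homogeneous_Const_mult homogeneous_Var)
  have "\<exists>i. peval w (pd i f) \<noteq> 0" if w: "w \<noteq> (\<lambda>_. 0)" "peval w (l 1) = 0" "peval w (l 2) = 0" for w
  proof (rule ccontr)
    assume "\<not> ?thesis"
    then have sing: "peval w (pd i f) = 0" for i by simp
    define T where "T = w 3 / v 3"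
    define x0 where "x0 = w 0 - v 0 * T"
    have li: "x * (w i - v i * T) = u i * x0" for i
      using cases_4[of i]
    proof (elim disjE)
      assume "i = 0" then show ?thesis by (simp add: u x0_def)
    next
      assume "i = 3" then show ?thesis using v(1) by (simp add: u T_def)
    qed (use w(2,3) in \<open>simp_all add: l_def x0_def T_def peval.hom_minus peval.hom_mult\<close>)
    have crit: "peval q f = 0" if "\<And>i. peval q (pd i f) = 0" for q
    proof -
      have "peval q (of_nat d * f) = (\<Sum>i\<in>UNIV. peval q (Var i) * peval q (pd i f))"
        unfolding euler[OF hom, symmetric] peval.hom_sum peval.hom_mult ..
      then show ?thesis using that d by (simp add: peval.hom_mult peval.hom_of_nat)
    qed
    have weq: "w i = v i * T + (x0 / x) * u i" for i using li[of i] x by (simp add: field_simps)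
    show False
    proof (cases "x0 = 0")
      case True
      then have "w = (\<lambda>i. T * v i)" using weq by (auto simp: mult.commute)
      moreover from this have "T \<noteq> 0" using w(1) by auto
      ultimately have "peval w f \<noteq> 0" using peval_scale[OF hom, of T v] v(2) by simp
      then show False using crit sing by blast
    next
      case False
      define t where "t = T * x / x0"
      have weq': "w = (\<lambda>i. (x0 / x) * (u i + t * v i))"
      proof
        fix i
        have "(x0 / x) * (u i + t * v i) = (x0 / x) * u i + ((x0 / x) * t) * v i" by (simp add: algebra_simps)
        also have "(x0 / x) * t = T" using False x by (simp add: t_def)
        finally show "w i = (x0 / x) * (u i + t * v i)" using weq[of i] by (simp add: mult.commute)
      qed
      have hpd: "homogeneous (int (d - 1)) (pd i f)" for i using homogeneous_pd[OF hom, of i] d by simp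
      have sing': "peval (\<lambda>i. u i + t * v i) (pd i f) = 0" for i
      proof -
        have "(x0 / x) ^ (d - 1) * peval (\<lambda>i. u i + t * v i) (pd i f) = 0"
          using sing[of i] peval_scale[OF hpd, of "x0 / x" "\<lambda>i. u i + t * v i" i] unfolding weq' by simp
        then show ?thesis using False x by simp
      qed
      have "poly (map_poly (E3 x y z) F) t = 0" unfolding F_def eval_Phi u_def[symmetric] by (rule crit[OF sing'])
      moreover have "poly (map_poly (E3 x y z) (pderiv F)) t = 0"
        unfolding F_def pderiv_Phi eval_Phi u_def[symmetric] by (simp add: peval.hom_sum peval.hom_mult sing')
      ultimately show False using resultant_no_common_root[OF res] degE degF d by fastforce
    qed
  qed
  then show ?thesis using that[OF hl hl] by blast
qed

declare pCons_one [simp]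

section \<open>The Jacobian ideal\<close>

lemma jacobian_ideal_iff: "p \<in> jacobian_ideal f \<longleftrightarrow> (\<exists>a. p = (\<Sum>i\<in>UNIV. a i * pd i f))"
  by (auto simp: jacobian_ideal_def)

lemma ideal4_jacobian: "ideal4 (jacobian_ideal f)"
  unfolding ideal4_def
proof (intro conjI ballI allI)
  show "0 \<in> jacobian_ideal f" unfolding jacobian_ideal_iff by (intro exI[of _ "\<lambda>_. 0"]) simp
next
  fix p q assume "p \<in> jacobian_ideal f" "q \<in> jacobian_ideal f"
  then obtain a b where "p = (\<Sum>i\<in>UNIV. a i * pd i f)" "q = (\<Sum>i\<in>UNIV. b i * pd i f)"
    unfolding jacobian_ideal_iff by blast
  then have "p + q = (\<Sum>i\<in>UNIV. (a i + b i) * pd i f)" by (simp add: distrib_right sum.distrib)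
  then show "p + q \<in> jacobian_ideal f" unfolding jacobian_ideal_iff by (rule exI[of _ "\<lambda>i. a i + b i"])
next
  fix p c assume "p \<in> jacobian_ideal f"
  then obtain a where "p = (\<Sum>i\<in>UNIV. a i * pd i f)" unfolding jacobian_ideal_iff by blast
  then have "c * p = (\<Sum>i\<in>UNIV. (c * a i) * pd i f)" by (simp add: sum_distrib_left mult.assoc)
  then show "c * p \<in> jacobian_ideal f" unfolding jacobian_ideal_iff by (rule exI[of _ "\<lambda>i. c * a i"])
qed

lemma pd_mem_jacobian: "pd i f \<in> jacobian_ideal f"
proof -
  have "(\<Sum>j\<in>UNIV. (if j = i then 1 else 0) * pd j f) = (\<Sum>j\<in>UNIV. if j = i then pd i f else 0)"
    by (rule sum.cong) auto
  then have "pd i f = (\<Sum>j\<in>UNIV. (if j = i then 1 else 0) * pd j f)" by simp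
  then show ?thesis unfolding jacobian_ideal_iff by (rule exI[of _ "\<lambda>j. if j = i then 1 else 0"])
qed

lemma hcomp_jacobian_sum:
  assumes "homogeneous d f"
  shows "hcomp k (\<Sum>i\<in>UNIV. a i * pd i f) = (\<Sum>i\<in>UNIV. hcomp (k - (d - 1)) (a i) * pd i f)"
  unfolding hcomp_sum
  by (intro sum.cong refl) (use hcomp_mult[OF homogeneous_pd[OF assms]] in \<open>simp add: mult.commute\<close>)

lemma homog_ideal_jacobian:
  assumes "homogeneous d f" shows "homog_ideal (jacobian_ideal f)"
  unfolding homog_ideal_def
proof (intro conjI ballI allI)
  fix p k assume "p \<in> jacobian_ideal f"
  then obtain a where "p = (\<Sum>i\<in>UNIV. a i * pd i f)" unfolding jacobian_ideal_iff by blast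
  then show "hcomp k p \<in> jacobian_ideal f" unfolding jacobian_ideal_iff
    using hcomp_jacobian_sum[OF assms, of k a] by (intro exI[of _ "\<lambda>i. hcomp (k - (d - 1)) (a i)"]) simp
qed (rule ideal4_jacobian)

lemma zero_locus_jacobian: "(\<forall>p\<in>jacobian_ideal f. peval v p = 0) \<longleftrightarrow> (\<forall>i. peval v (pd i f) = 0)"
proof safe
  fix p assume "\<forall>i. peval v (pd i f) = 0" "p \<in> jacobian_ideal f"
  then show "peval v p = 0" unfolding jacobian_ideal_iff by (auto simp: peval.hom_sum peval.hom_mult)
qed (use pd_mem_jacobian in blast)

text \<open>The hyperplane of \<open>l\<close> misses the zero locus of \<open>I\<close>, so by the
  Nullstellensatz I + (l) contains all forms of high degree. Multiplication by \<open>l\<close> on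
  S/I is therefore eventually surjective.\<close>

lemma HF_nonincreasing:
  assumes I: "homog_ideal I" and l: "homogeneous 1 l"
    and van: "\<And>w. w \<noteq> (\<lambda>_. 0) \<Longrightarrow> peval w l = 0 \<Longrightarrow> \<exists>p\<in>I. peval w p \<noteq> 0"
  obtains K where "\<And>k. k \<ge> K \<Longrightarrow> HF (ideal_plus I l) k = 0" "\<And>k. k \<ge> K \<Longrightarrow> HF I (Suc k) \<le> HF I k"
    "\<And>k. k \<ge> K \<Longrightarrow> HF I k \<le> HF I K"
proof -
  have iI: "ideal4 I" using I by (simp add: homog_ideal_def)
  have "\<exists>p\<in>ideal_plus I l. peval w p \<noteq> 0" if "w \<noteq> (\<lambda>_. 0)" for w
    using van[OF that] ideal_plus_contains[OF iI, of l] by blast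
  from projective_nullstellensatz[OF homog_ideal_plus[OF I l] this]
  obtain N where N: "\<And>k. k \<ge> 4 * N \<Longrightarrow> forms (int k) \<subseteq> ideal_plus I l" by metis
  have 0: "HF (ideal_plus I l) k = 0" if "k \<ge> 4 * N" for k
    using N[OF that] HF_eq_0_iff[OF ideal4_plus[OF iI]] by blast
  have le: "HF I (Suc k) \<le> HF I k" if "k \<ge> 4 * N" for k
    using HF_Suc_le[OF I l, of k] 0[of "Suc k"] that by simp
  have "HF I k \<le> HF I (4 * N)" if "k \<ge> 4 * N" for k
    using that by (induction k rule: dec_induct) (use le order_trans in blast)+
  with 0 le that show ?thesis by blast
qed

text \<open>Modulo \<open>l1\<close> the zero locus no longer meets \<open>l2 = 0\<close>, so the
  Hilbert function of J + (l1) is bounded. It bounds the increments of the Hilbert function of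
  J.\<close>

lemma HF_jacobian_linear_bound:
  assumes sf: "squarefree f" and hom: "homogeneous (int d) f" and d: "d > 0"
  obtains K c where "\<And>k. HF (jacobian_ideal f) (K + k) \<le> c * (k + 1)"
proof -
  let ?J = "jacobian_ideal f"
  obtain l1 l2 where l: "homogeneous 1 l1" "homogeneous 1 l2"
    and avoid: "\<And>w. w \<noteq> (\<lambda>_. 0) \<Longrightarrow> peval w l1 = 0 \<Longrightarrow> peval w l2 = 0 \<Longrightarrow> \<exists>i. peval w (pd i f) \<noteq> 0"
    using line_avoiding_singular_locus[OF assms] by blast
  have J: "homog_ideal ?J" by (rule homog_ideal_jacobian[OF hom])
  have iJ: "ideal4 ?J" by (rule ideal4_jacobian)
  have J1: "homog_ideal (ideal_plus ?J l1)" by (rule homog_ideal_plus[OF J l(1)])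
  have "\<exists>p\<in>ideal_plus ?J l1. peval w p \<noteq> 0" if w: "w \<noteq> (\<lambda>_. 0)" "peval w l2 = 0" for w
  proof (cases "peval w l1 = 0")
    case True
    then obtain i where "peval w (pd i f) \<noteq> 0" using avoid w by blast
    then show ?thesis using pd_mem_jacobian[of i f] ideal_plus_contains(1)[OF iJ, of l1] by blast
  next
    case False then show ?thesis using ideal_plus_contains(2)[OF iJ, of l1] by blast
  qed
  then obtain K where K: "\<And>k. k \<ge> K \<Longrightarrow> HF (ideal_plus ?J l1) k \<le> HF (ideal_plus ?J l1) K"
    using HF_nonincreasing[OF J1 l(2)] by metis
  define c where "c = HF ?J K + HF (ideal_plus ?J l1) K"
  have "HF ?J (K + k) \<le> HF ?J K + k * HF (ideal_plus ?J l1) K" for k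
  proof (induction k)
    case (Suc k)
    have "HF ?J (Suc (K + k)) \<le> HF ?J (K + k) + HF (ideal_plus ?J l1) (Suc (K + k))" by (rule HF_Suc_le[OF J l(1)])
    also have "\<dots> \<le> (HF ?J K + k * HF (ideal_plus ?J l1) K) + HF (ideal_plus ?J l1) K"
      using Suc K[of "Suc (K + k)"] by (intro add_mono) auto
    finally show ?case by (simp add: algebra_simps)
  qed simp
  also have "HF ?J K + k * HF (ideal_plus ?J l1) K \<le> c * (k + 1)" for k by (simp add: c_def algebra_simps)
  finally show ?thesis by (rule that)
qed

section \<open>Graded free modules\<close>

interpretation V: cspace "\<lambda>c (v :: nat \<Rightarrow> poly4) i. Const c * v i"
  by unfold_locales (auto simp: fun_eq_iff algebra_simps Const.hom_add Const.hom_mult)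

abbreviation "qdimV \<equiv> qdim (\<lambda>c (v :: nat \<Rightarrow> poly4) i. Const c * v i)"

text \<open>Vectors are encoded as functions vanishing from index \<open>n\<close> on, so that free
  modules of all ranks lie in one abelian group and the quotient dimensions above apply to
  them.\<close>

definition funs :: "nat \<Rightarrow> (nat \<Rightarrow> poly4) set" where
  "funs n = {v. \<forall>i\<ge>n. v i = 0}"

text \<open>The degree \<open>k\<close> piece of the graded free module with generators in degrees
  \<open>ds\<close>.\<close>

definition FM :: "int list \<Rightarrow> int \<Rightarrow> (nat \<Rightarrow> poly4) set" where
  "FM ds k = {v. (\<forall>i<length ds. homogeneous (k - ds ! i) (v i)) \<and> (\<forall>i\<ge>length ds. v i = 0)}"

definition mapm :: "poly4 mat \<Rightarrow> (nat \<Rightarrow> poly4) \<Rightarrow> nat \<Rightarrow> poly4" where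
  "mapm A v i = (if i < dim_row A then \<Sum>j<dim_col A. A $$ (i, j) * v j else 0)"

definition hcompv :: "int list \<Rightarrow> int \<Rightarrow> (nat \<Rightarrow> poly4) \<Rightarrow> nat \<Rightarrow> poly4" where
  "hcompv ds k v i = (if i < length ds then hcomp (k - ds ! i) (v i) else 0)"

lemma FM_subset_funs: "FM ds k \<subseteq> funs (length ds)"
  by (auto simp: FM_def funs_def)

lemma subspace_FM: "V.subspace (FM ds k)"
  by (auto simp: V.subspace_def FM_def homogeneous_add homogeneous_Const_mult)

lemma subspace_V0: "V.subspace {0}"
  by (rule V.subspace_single_0)

lemma hcompv_in_FM: "hcompv ds k v \<in> FM ds k"
  by (auto simp: hcompv_def FM_def)

lemma hcompv_id: "v \<in> FM ds k \<Longrightarrow> hcompv ds k v = v"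
  by (auto simp: hcompv_def FM_def hcomp_homogeneous fun_eq_iff)

lemma mapm_add: "mapm A (v + w) = mapm A v + mapm A w"
  by (auto simp: mapm_def fun_eq_iff distrib_left sum.distrib)

lemma mapm_scale: "mapm A (\<lambda>i. p * v i) = (\<lambda>i. p * mapm A v i)"
  by (auto simp: mapm_def fun_eq_iff sum_distrib_left mult.left_commute)

lemma mapm_0 [simp]: "mapm A 0 = 0"
  by (auto simp: mapm_def fun_eq_iff)

interpretation mapm: cspace_linear "\<lambda>c (v :: nat \<Rightarrow> poly4) i. Const c * v i" "\<lambda>c (v :: nat \<Rightarrow> poly4) i. Const c * v i" "mapm A"
  by unfold_locales (auto simp: mapm_add mapm_scale)

lemma mapm_funs: "mapm A v \<in> funs (dim_row A)"
  by (auto simp: mapm_def funs_def)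

lemma hcompv_mapm:
  assumes "graded_mat es ds A" shows "hcompv es k (mapm A v) = mapm A (hcompv ds k v)"
proof
  fix i
  have dim: "dim_row A = length es" "dim_col A = length ds" using assms by (auto simp: graded_mat_def)
  have "hcomp (k - es ! i) (A $$ (i, j) * v j) = A $$ (i, j) * hcomp (k - ds ! j) (v j)"
    if "i < length es" "j < length ds" for j
    using hcomp_mult[of "ds ! j - es ! i" "A $$ (i, j)" "k - es ! i" "v j"] assms that by (auto simp: graded_mat_def)
  then show "hcompv es k (mapm A v) i = mapm A (hcompv ds k v) i"
    by (auto simp: hcompv_def mapm_def dim hcomp_sum intro!: sum.cong)
qed

lemma mapm_FM: "graded_mat es ds A \<Longrightarrow> v \<in> FM ds k \<Longrightarrow> mapm A v \<in> FM es k"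
  by (metis hcompv_id hcompv_mapm hcompv_in_FM)

lemma vec_mapm:
  assumes "A \<in> carrier_mat n m" shows "A *\<^sub>v vec m v = vec n (mapm A v)"
  using assms by (intro eq_vecI) (auto simp: mapm_def scalar_prod_def lessThan_atLeast0)

lemma funs_vec: "u \<in> carrier_vec n \<Longrightarrow> \<exists>v\<in>funs n. u = vec n v"
  by (rule bexI[of _ "\<lambda>i. if i < n then u $ i else 0"]) (auto simp: funs_def)

lemma vec_inj: "v \<in> funs n \<Longrightarrow> w \<in> funs n \<Longrightarrow> vec n v = vec n w \<Longrightarrow> v = w"
proof
  fix i assume *: "v \<in> funs n" "w \<in> funs n" "vec n v = vec n w"
  then show "v i = w i" by (cases "i < n") (auto simp: funs_def dest: arg_cong[of _ _ "\<lambda>u. u $ i"])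
qed

lemma vec_eq_0_iff: "v \<in> funs n \<Longrightarrow> vec n v = 0\<^sub>v n \<longleftrightarrow> v = 0"
proof -
  have "(0\<^sub>v n :: poly4 vec) = vec n 0" by (auto simp: zero_fun_def)
  moreover have "0 \<in> funs n" by (simp add: funs_def)
  ultimately show "v \<in> funs n \<Longrightarrow> vec n v = 0\<^sub>v n \<longleftrightarrow> v = 0" using vec_inj by metis
qed

lemma image_mapm_vec:
  assumes A: "A \<in> carrier_mat n m" and im: "(\<lambda>v. A *\<^sub>v v) ` carrier_vec m = {u \<in> carrier_vec n. P u}"
  shows "mapm A ` funs m = {w \<in> funs n. P (vec n w)}"
proof safe
  fix v assume "v \<in> funs m"
  have "A *\<^sub>v vec m v \<in> {u \<in> carrier_vec n. P u}" unfolding im[symmetric] by auto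
  then show "P (vec n (mapm A v))" by (simp add: vec_mapm[OF A])
  show "mapm A v \<in> funs n" using mapm_funs[of A v] A by auto
next
  fix w assume w: "w \<in> funs n" "P (vec n w)"
  then have "vec n w \<in> (\<lambda>v. A *\<^sub>v v) ` carrier_vec m" unfolding im by simp
  then obtain u where "u \<in> carrier_vec m" "vec n w = A *\<^sub>v u" by blast
  then obtain v where v: "v \<in> funs m" "vec n w = vec n (mapm A v)" using funs_vec vec_mapm[OF A] by metis
  then have "w = mapm A v" using vec_inj[OF w(1)] mapm_funs[of A v] A by auto
  with v show "w \<in> mapm A ` funs m" by blast
qed

section \<open>The resolution as an exact sequence of graded free modules\<close>

definition grad_map :: "poly4 \<Rightarrow> (nat \<Rightarrow> poly4) \<Rightarrow> poly4" where
  "grad_map f v = (\<Sum>i<4. v i * pd (of_nat i) f)"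

locale resolution =
  fixes f :: poly4 and ds cs bs :: "int list" and A B C :: "poly4 mat"
  assumes gA: "graded_mat [0, 0, 0, 0] ds A" and gB: "graded_mat ds cs B" and gC: "graded_mat cs bs C"
    and mB: "minimal_mat B" and mC: "minimal_mat C"
    and imA: "mapm A ` funs (length ds) = {w \<in> funs 4. grad_map f w = 0}"
    and imB: "mapm B ` funs (length cs) = {w \<in> funs (length ds). mapm A w = 0}"
    and imC: "mapm C ` funs (length bs) = {w \<in> funs (length cs). mapm B w = 0}"
    and injC: "\<And>v. v \<in> funs (length bs) \<Longrightarrow> mapm C v = 0 \<Longrightarrow> v = 0"

lemma graded_betti_resolution:
  assumes "graded_betti f ds cs bs" obtains A B C where "resolution f ds cs bs A B C"
proof -
  from assms obtain A B C where g: "graded_mat [0, 0, 0, 0] ds A" "graded_mat ds cs B" "graded_mat cs bs C"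
    and m: "minimal_mat B" "minimal_mat C"
    and A: "(\<lambda>v. A *\<^sub>v v) ` carrier_vec (length ds) = AR f"
    and B: "(\<lambda>v. B *\<^sub>v v) ` carrier_vec (length cs) = {v \<in> carrier_vec (length ds). A *\<^sub>v v = 0\<^sub>v 4}"
    and C: "(\<lambda>v. C *\<^sub>v v) ` carrier_vec (length bs) = {v \<in> carrier_vec (length cs). B *\<^sub>v v = 0\<^sub>v (length ds)}"
    and inj: "\<forall>v \<in> carrier_vec (length bs). C *\<^sub>v v = 0\<^sub>v (length cs) \<longrightarrow> v = 0\<^sub>v (length bs)"
    unfolding graded_betti_def by (elim conjE exE) (rule that, assumption+)
  have cA: "A \<in> carrier_mat 4 (length ds)" and cB: "B \<in> carrier_mat (length ds) (length cs)"
    and cC: "C \<in> carrier_mat (length cs) (length bs)"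
    using g by (auto simp: graded_mat_def)
  have kA: "vec 4 (mapm A w) = 0\<^sub>v 4 \<longleftrightarrow> mapm A w = 0" for w
    using vec_eq_0_iff[of "mapm A w" 4] mapm_funs[of A w] cA by auto
  have kB: "vec (length ds) (mapm B w) = 0\<^sub>v (length ds) \<longleftrightarrow> mapm B w = 0" for w
    using vec_eq_0_iff[of "mapm B w" "length ds"] mapm_funs[of B w] cB by auto
  have kC: "vec (length cs) (mapm C w) = 0\<^sub>v (length cs) \<longleftrightarrow> mapm C w = 0" for w
    using vec_eq_0_iff[of "mapm C w" "length cs"] mapm_funs[of C w] cC by auto
  have "resolution f ds cs bs A B C"
  proof
    have eq: "(\<Sum>i<4. vec 4 w $ i * pd (of_nat i) f) = grad_map f w" for w
      unfolding grad_map_def by (rule sum.cong) auto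
    have "mapm A ` funs (length ds) = {w \<in> funs 4. (\<Sum>i<4. vec 4 w $ i * pd (of_nat i) f) = 0}"
      by (rule image_mapm_vec[OF cA]) (simp add: A AR_def)
    then show "mapm A ` funs (length ds) = {w \<in> funs 4. grad_map f w = 0}" unfolding eq .
    show "mapm B ` funs (length cs) = {w \<in> funs (length ds). mapm A w = 0}"
      using image_mapm_vec[OF cB B] unfolding vec_mapm[OF cA] kA .
    show "mapm C ` funs (length bs) = {w \<in> funs (length cs). mapm B w = 0}"
      using image_mapm_vec[OF cC C] unfolding vec_mapm[OF cB] kB .
    fix v assume v: "v \<in> funs (length bs)" "mapm C v = 0"
    then have "C *\<^sub>v vec (length bs) v = 0\<^sub>v (length cs)" unfolding vec_mapm[OF cC] kC by simp
    then have "vec (length bs) v = 0\<^sub>v (length bs)" using inj by auto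
    then show "v = 0" using vec_eq_0_iff[OF v(1)] by simp
  qed (use g m in auto)
  then show ?thesis by (rule that)
qed

text \<open>This is the dimension of S_k only for \<open>k \<ge> 0\<close>: for negative
  \<open>k\<close> the truncation by \<open>nat\<close> yields 1 and not 0. Dimension counts along
  the resolution are therefore made only in degrees above all generators.\<close>

definition dimS :: "int \<Rightarrow> nat" where
  "dimS k = (nat k + 3) choose 3"

lemma FM_snoc_iff: "v \<in> FM (ds @ [x]) k \<longleftrightarrow>
  homogeneous (k - x) (v (length ds)) \<and> v(length ds := 0) \<in> FM ds k"
  by (auto simp: FM_def nth_append less_Suc_eq le_Suc_eq Suc_le_eq)

lemma qdim_FM: "(\<And>x. x \<in> set ds \<Longrightarrow> x \<le> k) \<Longrightarrow> qdimV (FM ds k) {0} (\<Sum>x\<leftarrow>ds. dimS (k - x))"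
proof (induction ds rule: rev_induct)
  case Nil
  have eq: "FM [] k = {0}" by (auto simp: FM_def fun_eq_iff)
  show ?case unfolding eq list.map sum_list.Nil by (rule V.qdim_refl[OF subspace_V0])
next
  case (snoc x ds)
  let ?n = "length ds"
  interpret L: cspace_linear "\<lambda>c (v :: nat \<Rightarrow> poly4) i. Const c * v i" "\<lambda>c p. Const c * p" "\<lambda>v. v ?n"
    by unfold_locales auto
  have sub: "FM ds k \<subseteq> FM (ds @ [x]) k" by (auto simp: FM_def nth_append)
  have "qdimV (FM (ds @ [x]) k) (FM ds k) (dimS (k - x)) \<longleftrightarrow> qdim4 (forms (k - x)) {0} (dimS (k - x))"
  proof (rule L.qdim_iso[OF subspace_FM subspace_FM subspace_forms S.subspace_single_0])
    fix v assume v: "v \<in> FM (ds @ [x]) k"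
    show "v ?n \<in> forms (k - x)" using v by (simp add: FM_snoc_iff)
    show "(v ?n \<in> {0}) = (v \<in> FM ds k)"
    proof
      assume "v ?n \<in> {0}"
      then have "v(?n := 0) = v" by auto
      then show "v \<in> FM ds k" using v by (simp add: FM_snoc_iff)
    qed (simp add: FM_def)
  next
    fix p assume "p \<in> forms (k - x)"
    then have "(\<lambda>i. if i = ?n then p else 0) \<in> FM (ds @ [x]) k" by (auto simp: FM_def nth_append)
    then show "\<exists>v\<in>FM (ds @ [x]) k. p - v ?n \<in> {0}" by (rule bexI[rotated]) simp
  qed
  moreover have "qdim4 (forms (k - x)) {0} (dimS (k - x))"
    using qdim_forms[of "nat (k - x)"] snoc.prems[of x] by (simp add: dimS_def)
  ultimately have "qdimV (FM (ds @ [x]) k) (FM ds k) (dimS (k - x))" by simp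
  moreover have "qdimV (FM ds k) {0} (\<Sum>x\<leftarrow>ds. dimS (k - x))" by (rule snoc.IH) (use snoc.prems in simp)
  moreover have "{0} \<subseteq> FM ds k" by (auto simp: FM_def)
  ultimately have "qdimV (FM (ds @ [x]) k) {0} ((\<Sum>x\<leftarrow>ds. dimS (k - x)) + dimS (k - x))"
    by (intro V.qdim_add[OF subspace_FM subspace_V0 _ sub])
  then show ?case unfolding map_append sum_list_append list.map sum_list.Cons sum_list.Nil add_0_right .
qed

lemma (in cspace_linear) rank_nullity:
  assumes V: "A.subspace V" and n: "qdim s1 V {0} n" and a: "qdim s1 {v \<in> V. g v = 0} {0} a"
  obtains m where "qdim s2 (g ` V) {0} m" "m + a = n"
proof -
  let ?K = "{v \<in> V. g v = 0}"
  have K: "A.subspace ?K" using V by (auto simp: A.subspace_def g_add g_scale g_0)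
  have V': "B.subspace (g ` V)" unfolding B.subspace_def
  proof (intro conjI ballI allI)
    show "0 \<in> g ` V" using A.subspace_0[OF V] g_0 by (metis imageI)
    show "x + y \<in> g ` V" if "x \<in> g ` V" "y \<in> g ` V" for x y
      using that A.subspace_add[OF V] by (auto simp: g_add[symmetric])
    show "s2 c x \<in> g ` V" if "x \<in> g ` V" for c x
      using that A.subspace_scale[OF V] by (auto simp: g_scale[symmetric])
  qed
  have "{0} \<subseteq> ?K" using K A.subspace_0 by blast
  then obtain a' m where am: "qdim s1 ?K {0} a'" "qdim s1 V ?K m" "a' + m = n"
    using A.qdim_split[OF K A.subspace_single_0 V _ _ n] by blast
  have "a' = a" by (rule A.qdim_unique[OF A.subspace_single_0 am(1) a])
  have "qdim s1 V ?K m \<longleftrightarrow> qdim s2 (g ` V) {0} m"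
    by (rule qdim_iso[OF V K V' B.subspace_single_0]) auto
  with am \<open>a' = a\<close> that show ?thesis by simp
qed

text \<open>A map of degree zero commutes with taking components, so a preimage may be replaced by
  its component in degree \<open>k\<close>; exactness thus holds in each degree.\<close>

lemma image_FM:
  assumes "graded_mat es ds A" "mapm A ` funs (length ds) = {w \<in> funs (length es). P w}"
  shows "mapm A ` FM ds k = {w \<in> FM es k. P w}"
proof safe
  fix v assume v: "v \<in> FM ds k"
  then show "mapm A v \<in> FM es k" by (rule mapm_FM[OF assms(1)])
  show "P (mapm A v)" using assms(2) v FM_subset_funs by blast
next
  fix w assume w: "w \<in> FM es k" "P w"
  then have "w \<in> mapm A ` funs (length ds)" using assms(2) FM_subset_funs by blast
  then obtain v where "w = mapm A v" by blast
  then have "w = mapm A (hcompv ds k v)" using hcompv_id[OF w(1)] hcompv_mapm[OF assms(1)] by metis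
  then show "w \<in> mapm A ` FM ds k" using hcompv_in_FM by blast
qed

lemma grad_map_image:
  assumes "homogeneous d f"
  shows "grad_map f ` FM [0, 0, 0, 0] k = jacobian_ideal f \<inter> forms (k + (d - 1))"
proof safe
  fix v assume v: "v \<in> FM [0, 0, 0, 0] k"
  have h: "homogeneous k (v i)" if "i < 4" for i
  proof -
    have "[0, 0, 0, 0 :: int] ! i = 0" using that by (auto simp: numeral_eq_Suc less_Suc_eq)
    moreover have "i < length [0, 0, 0, 0 :: int]" using that by simp
    then have "homogeneous (k - [0, 0, 0, 0] ! i) (v i)" using v unfolding FM_def by blast
    ultimately show ?thesis by simp
  qed
  show "grad_map f v \<in> jacobian_ideal f" unfolding grad_map_def
    by (intro ideal4_sum[OF ideal4_jacobian] ideal4D(3)[OF ideal4_jacobian] pd_mem_jacobian)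
  show "homogeneous (k + (d - 1)) (grad_map f v)" unfolding grad_map_def
    by (intro homogeneous_sum homogeneous_mult h homogeneous_pd assms) simp
next
  fix p assume p: "p \<in> jacobian_ideal f" "homogeneous (k + (d - 1)) p"
  then obtain a where a: "p = (\<Sum>i\<in>UNIV. a i * pd i f)" unfolding jacobian_ideal_iff by blast
  have "p = hcomp (k + (d - 1)) p" using hcomp_homogeneous[OF p(2)] by simp
  also have "\<dots> = (\<Sum>i\<in>UNIV. hcomp k (a i) * pd i f)" using hcomp_jacobian_sum[OF assms, of "k + (d - 1)" a] by (simp add: a)
  also have "\<dots> = grad_map f (\<lambda>i. if i < 4 then hcomp k (a (of_nat i)) else 0)"
    unfolding grad_map_def sum_4 by (rule sum.cong) auto
  finally have "p = grad_map f (\<lambda>i. if i < 4 then hcomp k (a (of_nat i)) else 0)" .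
  moreover have "(\<lambda>i. if i < 4 then hcomp k (a (of_nat i)) else 0) \<in> FM [0, 0, 0, 0] k"
    by (auto simp: FM_def nth_Cons')
  ultimately show "p \<in> grad_map f ` FM [0, 0, 0, 0] k" by (simp only: imageI)
qed

interpretation grad: cspace_linear "\<lambda>c (v :: nat \<Rightarrow> poly4) i. Const c * v i" "\<lambda>c p. Const c * p" "grad_map f"
  by unfold_locales (auto simp: grad_map_def distrib_right sum.distrib sum_distrib_left mult.assoc)

context resolution begin

text \<open>By exactness the kernel of each map is the image of the preceding one, so rank-nullity
  can be applied successively from the injective \<open>C\<close> to the gradient. The gradient
  raises degrees by \<open>d - 1\<close>, whence the shift on the left.\<close>

lemma HF_jacobian_betti:
  assumes f: "homogeneous (int d) f" and d: "d > 0" and k: "k \<ge> 0"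
    and le: "\<And>x. x \<in> set ds \<union> set cs \<union> set bs \<Longrightarrow> x \<le> int k"
  shows "int (HF (jacobian_ideal f) (k + (d - 1))) = int (dimS (int (k + (d - 1)))) - 4 * int (dimS (int k))
    + (\<Sum>x\<leftarrow>ds. int (dimS (int k - x))) - (\<Sum>x\<leftarrow>cs. int (dimS (int k - x))) + (\<Sum>x\<leftarrow>bs. int (dimS (int k - x)))"
proof -
  let ?D = "\<lambda>ds. \<Sum>x\<leftarrow>ds. dimS (int k - x)"
  have D: "qdimV (FM ds (int k)) {0} (?D ds)" "qdimV (FM cs (int k)) {0} (?D cs)" "qdimV (FM bs (int k)) {0} (?D bs)"
    by (rule qdim_FM, use le in blast)+
  have D0: "qdimV (FM [0,0,0,0] (int k)) {0} (?D [0,0,0,0])" by (rule qdim_FM) simp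
  have "{v \<in> FM bs (int k). mapm C v = 0} = {0}"
    using injC FM_subset_funs by (auto simp: FM_def)
  then have k3: "qdimV {v \<in> FM bs (int k). mapm C v = 0} {0} 0" using V.qdim_refl[OF subspace_V0] by simp
  obtain n3 where n3: "qdimV (mapm C ` FM bs (int k)) {0} n3" "n3 + 0 = ?D bs"
    by (rule mapm.rank_nullity[OF subspace_FM D(3) k3])
  have k2: "qdimV {v \<in> FM cs (int k). mapm B v = 0} {0} n3" using n3(1) unfolding image_FM[OF gC imC] .
  obtain n2 where n2: "qdimV (mapm B ` FM cs (int k)) {0} n2" "n2 + n3 = ?D cs"
    by (rule mapm.rank_nullity[OF subspace_FM D(2) k2])
  have k1: "qdimV {v \<in> FM ds (int k). mapm A v = 0} {0} n2" using n2(1) unfolding image_FM[OF gB imB] .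
  obtain n1 where n1: "qdimV (mapm A ` FM ds (int k)) {0} n1" "n1 + n2 = ?D ds"
    by (rule mapm.rank_nullity[OF subspace_FM D(1) k1])
  have imA': "mapm A ` funs (length ds) = {w \<in> funs (length [0,0,0,0::int]). grad_map f w = 0}"
    using imA by (simp add: numeral_eq_Suc)
  have k0: "qdimV {v \<in> FM [0,0,0,0] (int k). grad_map f v = 0} {0} n1" using n1(1) unfolding image_FM[OF gA imA'] .
  obtain n0 where n0: "qdim4 (grad_map f ` FM [0,0,0,0] (int k)) {0} n0" "n0 + n1 = ?D [0,0,0,0]"
    by (rule grad.rank_nullity[OF subspace_FM D0 k0])
  have e: "int k + (int d - 1) = int (k + (d - 1))" using d by simp
  let ?J = "jacobian_ideal f" and ?F = "forms (int (k + (d - 1)))"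
  have J0: "qdim4 (?J \<inter> ?F) {0} n0" using n0(1) unfolding grad_map_image[OF f] e .
  have "{0} \<subseteq> ?J \<inter> ?F" using ideal4D(1)[OF ideal4_jacobian] by auto
  then have "qdim4 ?F {0} (n0 + HF ?J (k + (d - 1)))"
    by (intro S.qdim_add[OF subspace_ideal_forms[OF ideal4_jacobian] S.subspace_single_0 _ _ J0 qdim_HF[OF ideal4_jacobian]]) auto
  then have "n0 + HF ?J (k + (d - 1)) = dimS (int (k + (d - 1)))"
    unfolding dimS_def nat_int by (rule S.qdim_unique[OF S.subspace_single_0 _ qdim_forms])
  moreover have "int (?D xs) = (\<Sum>x\<leftarrow>xs. int (dimS (int k - x)))" for xs by (induction xs) auto
  ultimately show ?thesis using n3(2) n2(2) n1(2) n0(2) by (simp flip: of_nat_add) (smt (verit) of_nat_add)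
qed

end

section \<open>The Hilbert polynomial in terms of the Betti numbers\<close>

lemma six_choose_three: "6 * ((m + 3) choose 3) = (m + 1) * (m + 2) * (m + 3)"
proof -
  have f3: "fact 3 = (6::nat)" by (simp add: fact_numeral)
  have f: "fact (m + 3) = (m + 1) * (m + 2) * (m + 3) * (fact m :: nat)"
    by (simp add: numeral_3_eq_3 algebra_simps)
  have "fact 3 * fact (m + 3 - 3) * ((m + 3) choose 3) = (fact (m + 3) :: nat)"
    by (rule binomial_fact_lemma) simp
  then have "fact m * (6 * ((m + 3) choose 3)) = fact m * ((m + 1) * (m + 2) * (m + 3))"
    unfolding f3 f by (simp only: add_diff_cancel_right' mult_ac)
  then show ?thesis by simp
qed

lemma six_dimS: "k \<ge> 0 \<Longrightarrow> 6 * int (dimS k) = (k + 1) * (k + 2) * (k + 3)"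
proof -
  assume k: "k \<ge> 0"
  have "6 * int (dimS k) = int (6 * ((nat k + 3) choose 3))" by (simp add: dimS_def)
  also have "\<dots> = (k + 1) * (k + 2) * (k + 3)" unfolding six_choose_three using k by (simp add: algebra_simps)
  finally show ?thesis .
qed

lemma sum_list_dimS:
  fixes xs :: "int list"
  assumes "\<And>x. x \<in> set xs \<Longrightarrow> x \<le> k"
  shows "6 * (\<Sum>x\<leftarrow>xs. int (dimS (k - x))) = int (length xs) * ((k + 1) * (k + 2) * (k + 3))
    - (\<Sum>x\<leftarrow>xs. x) * (3 * k^2 + 12 * k + 11) + (\<Sum>x\<leftarrow>xs. x^2) * (3 * k + 6) - (\<Sum>x\<leftarrow>xs. x^3)"
  using assms
proof (induction xs)
  case (Cons x xs)
  have "6 * int (dimS (k - x)) = (k - x + 1) * (k - x + 2) * (k - x + 3)" using Cons.prems[of x] by (intro six_dimS) simp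
  also have "\<dots> = (k + 1) * (k + 2) * (k + 3) - x * (3 * k^2 + 12 * k + 11) + x^2 * (3 * k + 6) - x^3"
    by (simp add: power2_eq_square power3_eq_cube algebra_simps)
  finally show ?case using Cons by (simp add: algebra_simps)
qed simp

text \<open>Dividing by k^3, and once \<open>a = 0\<close> by k^2, squeezes the leading coefficient
  between two sequences tending to 0.\<close>

lemma polynomial_linear_bound:
  fixes a b c d M :: real
  assumes bd: "\<And>k::nat. k \<ge> K \<Longrightarrow> 0 \<le> a * real k^3 + b * real k^2 + c * real k + d \<and> a * real k^3 + b * real k^2 + c * real k + d \<le> M * (real k + 1)"
  shows "a = 0 \<and> b = 0"
proof -
  have lim0: "(\<lambda>k. 1 / real k) \<longlonglongrightarrow> 0" by (rule lim_1_over_n)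
  let ?p = "\<lambda>k. a * real k^3 + b * real k^2 + c * real k + d"
  let ?s = "\<lambda>k. a + b * (1 / real k) + c * (1 / real k)^2 + d * (1 / real k)^3"
  have "?s \<longlonglongrightarrow> a + b * 0 + c * 0^2 + d * 0^3" by (intro tendsto_intros lim0)
  then have s: "?s \<longlonglongrightarrow> a" by (simp only: power_zero_numeral mult_zero_right add_0_right)
  have eq: "?p k / real k^3 = ?s k" if "k > 0" for k
    using that by (simp add: add_divide_distrib distrib_left power2_eq_square power3_eq_cube)
  have "(\<lambda>k. M * (1 / real k)^2 + M * (1 / real k)^3) \<longlonglongrightarrow> M * 0^2 + M * 0^3" by (intro tendsto_intros lim0)
  then have ub: "(\<lambda>k. M * (1 / real k)^2 + M * (1 / real k)^3) \<longlonglongrightarrow> 0"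
    by (simp only: power_zero_numeral mult_zero_right add_0_right)
  have eq2: "M * (real k + 1) / real k^3 = M * (1 / real k)^2 + M * (1 / real k)^3" if "k > 0" for k
    using that by (simp add: add_divide_distrib distrib_left power2_eq_square power3_eq_cube)
  have "0 \<le> a"
  proof (rule tendsto_lowerbound[OF s])
    show "\<forall>\<^sub>F k in sequentially. 0 \<le> ?s k"
      using eventually_ge_at_top[of "K + 1"]
    proof eventually_elim
      case (elim k)
      then show ?case using bd[of k] eq[of k, symmetric] by simp
    qed
  qed simp
  moreover have "a \<le> 0"
  proof (rule tendsto_le[OF _ ub s])
    show "\<forall>\<^sub>F k in sequentially. ?s k \<le> M * (1 / real k)^2 + M * (1 / real k)^3"
      using eventually_ge_at_top[of "K + 1"]
    proof eventually_elim
      case (elim k)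
      then have k: "k > 0" by simp
      have "?p k / real k^3 \<le> M * (real k + 1) / real k^3" using bd[of k] elim by (intro divide_right_mono) auto
      then show ?case unfolding eq[OF k] eq2[OF k] .
    qed
  qed simp
  ultimately have a: "a = 0" by simp
  let ?t = "\<lambda>k. b + c * (1 / real k) + d * (1 / real k)^2"
  have "?t \<longlonglongrightarrow> b + c * 0 + d * 0^2" by (intro tendsto_intros lim0)
  then have t: "?t \<longlonglongrightarrow> b" by (simp only: power_zero_numeral mult_zero_right add_0_right)
  have eqt: "?p k / real k^2 = ?t k" if "k > 0" for k
    using that a by (simp add: add_divide_distrib power2_eq_square)
  have "(\<lambda>k. M * (1 / real k) + M * (1 / real k)^2) \<longlonglongrightarrow> M * 0 + M * 0^2" by (intro tendsto_intros lim0)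
  then have ub': "(\<lambda>k. M * (1 / real k) + M * (1 / real k)^2) \<longlonglongrightarrow> 0"
    by (simp only: power_zero_numeral mult_zero_right add_0_right)
  have eqt2: "M * (real k + 1) / real k^2 = M * (1 / real k) + M * (1 / real k)^2" if "k > 0" for k
    using that by (simp add: add_divide_distrib distrib_left power2_eq_square)
  have "0 \<le> b"
  proof (rule tendsto_lowerbound[OF t])
    show "\<forall>\<^sub>F k in sequentially. 0 \<le> ?t k"
      using eventually_ge_at_top[of "K + 1"]
    proof eventually_elim
      case (elim k)
      then show ?case using bd[of k] eqt[of k, symmetric] by simp
    qed
  qed simp
  moreover have "b \<le> 0"
  proof (rule tendsto_le[OF _ ub' t])
    show "\<forall>\<^sub>F k in sequentially. ?t k \<le> M * (1 / real k) + M * (1 / real k)^2"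
      using eventually_ge_at_top[of "K + 1"]
    proof eventually_elim
      case (elim k)
      then have k: "k > 0" by simp
      have "?p k / real k^2 \<le> M * (real k + 1) / real k^2" using bd[of k] elim by (intro divide_right_mono) auto
      then show ?case unfolding eqt[OF k] eqt2[OF k] .
    qed
  qed simp
  ultimately show ?thesis using a by simp
qed

definition alt_sum :: "nat \<Rightarrow> int list \<Rightarrow> int list \<Rightarrow> int list \<Rightarrow> int" where
  "alt_sum n ds cs bs = (\<Sum>x\<leftarrow>ds. x^n) - (\<Sum>x\<leftarrow>cs. x^n) + (\<Sum>x\<leftarrow>bs. x^n)"

lemma alt_sum_0: "alt_sum 0 ds cs bs = int (length ds) - int (length cs) + int (length bs)"
proof -
  have "(\<Sum>x\<leftarrow>xs. x^0) = int (length xs)" for xs :: "int list" by (induction xs) auto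
  then show ?thesis by (simp add: alt_sum_def)
qed

context resolution begin

text \<open>The sum of absolute values is a crude common upper bound for all Betti degrees, above
  which the binomial formula for \<open>dimS\<close> is valid.\<close>

definition kmin :: nat where "kmin = nat (\<Sum>x\<leftarrow>ds @ cs @ bs. \<bar>x\<bar>)"

lemma le_kmin: "x \<in> set ds \<union> set cs \<union> set bs \<Longrightarrow> kmin \<le> k \<Longrightarrow> x \<le> int k"
proof -
  assume x: "x \<in> set ds \<union> set cs \<union> set bs" and k: "kmin \<le> k"
  have "\<bar>x\<bar> \<le> (\<Sum>x\<leftarrow>ds @ cs @ bs. \<bar>x\<bar>)" by (rule member_le_sum_list) (use x in auto)
  then show ?thesis using k by (simp add: kmin_def)
qed

lemma six_HF:
  assumes f: "homogeneous (int d) f" and d: "d > 0" and k: "k \<ge> kmin"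
  shows "6 * int (HF (jacobian_ideal f) (k + (d - 1))) = (int k + int d) * (int k + int d + 1) * (int k + int d + 2)
    + (alt_sum 0 ds cs bs - 4) * ((int k + 1) * (int k + 2) * (int k + 3))
    - alt_sum 1 ds cs bs * (3 * int k^2 + 12 * int k + 11) + alt_sum 2 ds cs bs * (3 * int k + 6) - alt_sum 3 ds cs bs"
proof -
  let ?s = "\<lambda>xs. \<Sum>x\<leftarrow>xs. int (dimS (int k - x))"
  have le: "\<And>x. x \<in> set ds \<union> set cs \<union> set bs \<Longrightarrow> x \<le> int k" using le_kmin k by blast
  have e: "6 * int (dimS (int (k + (d - 1)))) = (int k + int d) * (int k + int d + 1) * (int k + int d + 2)"
    using d six_dimS[of "int (k + (d - 1))"] by (simp add: of_nat_diff algebra_simps)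
  have "6 * int (HF (jacobian_ideal f) (k + (d - 1))) = 6 * int (dimS (int (k + (d - 1)))) - 4 * (6 * int (dimS (int k)))
    + 6 * ?s ds - 6 * ?s cs + 6 * ?s bs"
    using HF_jacobian_betti[OF f d _ le] by simp
  moreover have "6 * ?s ds = int (length ds) * ((int k + 1) * (int k + 2) * (int k + 3))
    - (\<Sum>x\<leftarrow>ds. x) * (3 * int k^2 + 12 * int k + 11) + (\<Sum>x\<leftarrow>ds. x^2) * (3 * int k + 6) - (\<Sum>x\<leftarrow>ds. x^3)"
    by (rule sum_list_dimS) (use le in auto)
  moreover have "6 * ?s cs = int (length cs) * ((int k + 1) * (int k + 2) * (int k + 3))
    - (\<Sum>x\<leftarrow>cs. x) * (3 * int k^2 + 12 * int k + 11) + (\<Sum>x\<leftarrow>cs. x^2) * (3 * int k + 6) - (\<Sum>x\<leftarrow>cs. x^3)"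
    by (rule sum_list_dimS) (use le in auto)
  moreover have "6 * ?s bs = int (length bs) * ((int k + 1) * (int k + 2) * (int k + 3))
    - (\<Sum>x\<leftarrow>bs. x) * (3 * int k^2 + 12 * int k + 11) + (\<Sum>x\<leftarrow>bs. x^2) * (3 * int k + 6) - (\<Sum>x\<leftarrow>bs. x^3)"
    by (rule sum_list_dimS) (use le in auto)
  moreover have "6 * int (dimS (int k)) = (int k + 1) * (int k + 2) * (int k + 3)" by (rule six_dimS) simp
  ultimately show ?thesis unfolding e alt_sum_0 by (simp add: alt_sum_def left_diff_distrib distrib_right)
qed

lemma betti_identities:
  assumes f: "homogeneous (int d) f" and d: "d > 0" and sf: "squarefree f"
  shows "alt_sum 0 ds cs bs = 3" "alt_sum 1 ds cs bs = int d - 1"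
proof -
  let ?J = "jacobian_ideal f"
  let ?N0 = "alt_sum 0 ds cs bs" and ?N1 = "alt_sum 1 ds cs bs" and ?Q2 = "alt_sum 2 ds cs bs" and ?Q3 = "alt_sum 3 ds cs bs"
  obtain K c where K: "\<And>k. HF ?J (K + k) \<le> c * (k + 1)" using HF_jacobian_linear_bound[OF sf f d] by metis
  \<comment> \<open>The coefficients of 6 HF as a cubic in \<open>k\<close>. The leading one
    collects 1 from S, -4 from S^4(1-d) and the alternating count of the remaining
    generators.\<close>
  define a where "a = ?N0 - 3"
  define b where "b = 3 * int d + 3 + 6 * (?N0 - 4) - 3 * ?N1"
  define c1 where "c1 = 3 * int d^2 + 6 * int d + 2 + 11 * (?N0 - 4) - 12 * ?N1 + 3 * ?Q2"
  define c0 where "c0 = int d * (int d + 1) * (int d + 2) + 6 * (?N0 - 4) - 11 * ?N1 + 6 * ?Q2 - ?Q3"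
  have eq: "6 * int (HF ?J (k + (d - 1))) = a * int k^3 + b * int k^2 + c1 * int k + c0" if "k \<ge> kmin" for k
    unfolding six_HF[OF f d that] a_def b_def c1_def c0_def
    by (simp add: algebra_simps power2_eq_square power3_eq_cube)
  have "real_of_int a = 0 \<and> real_of_int b = 0"
  proof (rule polynomial_linear_bound[where K = "kmin + K" and M = "6 * real c * real d"])
    fix k assume k: "kmin + K \<le> k"
    have "6 * real (HF ?J (k + (d - 1))) = of_int (a * int k^3 + b * int k^2 + c1 * int k + c0)"
      using eq[of k] k by (metis (no_types, lifting) add_leE of_int_mult of_int_numeral of_int_of_nat_eq)
    then have e: "6 * real (HF ?J (k + (d - 1))) = of_int a * real k^3 + of_int b * real k^2 + of_int c1 * real k + of_int c0"
      by simp
    have "HF ?J (k + (d - 1)) \<le> c * ((k + (d - 1) - K) + 1)" using K[of "k + (d - 1) - K"] k by simp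
    also have "\<dots> \<le> c * (d * (k + 1))"
    proof -
      obtain d' where "d = Suc d'" using d by (cases d) auto
      then show ?thesis by (intro mult_left_mono) (auto simp: algebra_simps)
    qed
    finally have "real (HF ?J (k + (d - 1))) \<le> real (c * (d * (k + 1)))" by (simp only: of_nat_le_iff)
    then show "0 \<le> of_int a * real k^3 + of_int b * real k^2 + of_int c1 * real k + of_int c0 \<and>
      of_int a * real k^3 + of_int b * real k^2 + of_int c1 * real k + of_int c0 \<le> 6 * real c * real d * (real k + 1)"
      unfolding e[symmetric] by (simp add: algebra_simps)
  qed
  then have "a = 0" "b = 0" by simp_all
  then show "alt_sum 0 ds cs bs = 3" "alt_sum 1 ds cs bs = int d - 1" by (auto simp: a_def b_def)
qed

lemma six_HF':
  assumes f: "homogeneous (int d) f" and d: "d > 0" and sf: "squarefree f" and k: "k \<ge> kmin"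
  shows "6 * int (HF (jacobian_ideal f) (k + (d - 1))) =
    3 * ((int d - 1)^2 + alt_sum 2 ds cs bs) * int k + (int d - 1)^3 + 6 * ((int d - 1)^2 + alt_sum 2 ds cs bs) - alt_sum 3 ds cs bs"
  unfolding six_HF[OF f d k] betti_identities[OF f d sf]
  by (simp add: algebra_simps power2_eq_square power3_eq_cube)

text \<open>Replacing the degree k by m - (d - 1) in \<open>six_HF'\<close> contributes the
  correction \<open>6 - 3 * (int d - 1)\<close> to the constant term. Two polynomials agreeing at
  all large integers coincide, which settles the definite description.\<close>

lemma hilbert_poly_eq:
  assumes f: "homogeneous (int d) f" and d: "d > 0" and sf: "squarefree f"
  shows "hilbert_poly f = [: of_int ((int d - 1)^3 + (6 - 3 * (int d - 1)) * ((int d - 1)^2 + alt_sum 2 ds cs bs) - alt_sum 3 ds cs bs) / 6,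
    of_int ((int d - 1)^2 + alt_sum 2 ds cs bs) / 2 :]" (is "_ = ?P")
proof -
  have P: "of_nat (hilbert_fun f m) = poly ?P (of_nat m)" if "m \<ge> kmin + (d - 1)" for m
  proof -
    define k where "k = m - (d - 1)"
    have m: "m = k + (d - 1)" "k \<ge> kmin" using that by (auto simp: k_def)
    define Y where "Y = (int d - 1)^2 + alt_sum 2 ds cs bs"
    define X where "X = (int d - 1)^3 + (6 - 3 * (int d - 1)) * Y - alt_sum 3 ds cs bs"
    have "6 * int (hilbert_fun f m) = X + 3 * int m * Y"
      unfolding hilbert_fun_eq m(1) six_HF'[OF f d sf m(2)] X_def Y_def[symmetric] using d
      by (simp add: of_nat_diff algebra_simps)
    then have "(of_int (6 * int (hilbert_fun f m)) :: rat) = of_int (X + 3 * int m * Y)" by (simp only:)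
    then have "6 * of_nat (hilbert_fun f m) = (of_int X + 3 * of_nat m * of_int Y :: rat)" by simp
    also have "\<dots> = 6 * poly [:of_int X / 6, of_int Y / 2:] (of_nat m)" by simp
    finally have "of_nat (hilbert_fun f m) = poly [:of_int X / 6 :: rat, of_int Y / 2:] (of_nat m)"
      by (simp only: mult_cancel_left) simp
    then show ?thesis unfolding X_def Y_def .
  qed
  show ?thesis unfolding hilbert_poly_def
  proof (rule the_equality)
    show "\<exists>k0. \<forall>k\<ge>k0. of_nat (hilbert_fun f k) = poly ?P (of_nat k)" using P by blast
    fix Q :: "rat poly" assume "\<exists>k0. \<forall>k\<ge>k0. of_nat (hilbert_fun f k) = poly Q (of_nat k)"
    then obtain k0 where Q: "\<And>k. k \<ge> k0 \<Longrightarrow> of_nat (hilbert_fun f k) = poly Q (of_nat k)" by blast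
    have "Q - ?P = 0"
    proof (rule ccontr)
      assume "Q - ?P \<noteq> 0"
      then have "finite {x. poly (Q - ?P) x = 0}" by (rule poly_roots_finite)
      moreover have "of_nat ` {max k0 (kmin + (d - 1))..} \<subseteq> {x. poly (Q - ?P) x = 0}"
      proof
        fix x :: rat assume "x \<in> of_nat ` {max k0 (kmin + (d - 1))..}"
        then obtain m where x: "x = of_nat m" and m: "m \<ge> k0" "m \<ge> kmin + (d - 1)" by auto
        have "poly Q x = poly ?P x" unfolding x by (rule trans[OF Q[OF m(1), symmetric] P[OF m(2)]])
        then have "poly (Q - ?P) x = 0" unfolding poly_diff by (simp only: diff_self)
        then show "x \<in> {x. poly (Q - ?P) x = 0}" by (rule CollectI)
      qed
      ultimately have "finite (of_nat ` {max k0 (kmin + (d - 1))..} :: rat set)" using finite_subset by blast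
      then have "finite {max k0 (kmin + (d - 1))..}" by (subst (asm) finite_image_iff) (auto simp: inj_on_def)
      then show False using infinite_Ici by blast
    qed
    then show "Q = ?P" by simp
  qed
qed

end

section \<open>Points of the singular locus\<close>

definition proj_class :: "(4 \<Rightarrow> complex) \<Rightarrow> ppoint" where
  "proj_class v = {\<lambda>i. c * v i | c. c \<noteq> 0}"

lemma mem_proj_class: "v \<in> proj_class v"
  by (auto simp: proj_class_def intro!: exI[of _ 1])

lemma proj_rel_image: "v \<noteq> (\<lambda>_. 0) \<Longrightarrow> proj_rel `` {v} = proj_class v"
  by (auto simp: proj_rel_def proj_class_def)

lemma proj_class_in_P3: "v \<noteq> (\<lambda>_. 0) \<Longrightarrow> proj_class v \<in> P3"
  unfolding P3_def by (metis (mono_tags, lifting) mem_Collect_eq proj_rel_image quotientI)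

lemma proj_class_eq: "w \<in> proj_class v \<Longrightarrow> proj_class w = proj_class v"
proof -
  assume "w \<in> proj_class v"
  then obtain c where c: "c \<noteq> 0" "w = (\<lambda>i. c * v i)" by (auto simp: proj_class_def)
  show ?thesis
  proof safe
    fix u assume "u \<in> proj_class w"
    then obtain b where "b \<noteq> 0" "u = (\<lambda>i. b * (c * v i))" by (auto simp: proj_class_def c)
    then show "u \<in> proj_class v" using c(1) by (auto simp: proj_class_def mult.assoc intro!: exI[of _ "b * c"])
  next
    fix u assume "u \<in> proj_class v"
    then obtain b where "b \<noteq> 0" "u = (\<lambda>i. b * v i)" by (auto simp: proj_class_def)
    then show "u \<in> proj_class w" using c(1) by (auto simp: proj_class_def c(2) intro!: exI[of _ "b / c"])
  qed
qed

lemma P3E: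
  assumes "s \<in> P3" "v \<in> s" shows "v \<noteq> (\<lambda>_. 0)" "s = proj_class v"
proof -
  from assms(1) obtain w where w: "w \<noteq> (\<lambda>_. 0)" "s = proj_class w"
    unfolding P3_def using proj_rel_image by (auto elim!: quotientE)
  then show "s = proj_class v" using assms(2) proj_class_eq by blast
  from w assms(2) obtain c where "c \<noteq> 0" "v = (\<lambda>i. c * w i)" by (auto simp: proj_class_def)
  then show "v \<noteq> (\<lambda>_. 0)" using w(1) by (auto simp: fun_eq_iff)
qed

text \<open>The same choice of representative as in \<open>tjurina\<close>; together with
  \<open>chart_index\<close> it makes \<open>tjurina_eq\<close> a mere unfolding.\<close>

definition rep :: "ppoint \<Rightarrow> 4 \<Rightarrow> complex" where
  "rep s = (SOME v. v \<in> s)"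

lemma rep_in: "s \<in> P3 \<Longrightarrow> rep s \<in> s"
proof -
  assume "s \<in> P3"
  then obtain w where "w \<noteq> (\<lambda>_. 0)" "s = proj_class w"
    unfolding P3_def using proj_rel_image by (auto elim!: quotientE)
  then have "w \<in> s" using mem_proj_class by simp
  then show ?thesis unfolding rep_def by (rule someI[of "\<lambda>v. v \<in> s"])
qed

lemma rep_nonzero: "s \<in> P3 \<Longrightarrow> rep s \<noteq> (\<lambda>_. 0)" and proj_class_rep: "s \<in> P3 \<Longrightarrow> proj_class (rep s) = s"
  using P3E[OF _ rep_in] by auto

lemma sing_locus_P3: "s \<in> sing_locus f \<Longrightarrow> s \<in> P3"
  by (simp add: sing_locus_def)

lemma sing_locus_rep: "s \<in> sing_locus f \<Longrightarrow> peval (rep s) (pd i f) = 0"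
  using rep_in by (auto simp: sing_locus_def)

lemma proj_class_in_sing_locus:
  assumes f: "homogeneous (int d) f" "d > 0" and v: "v \<noteq> (\<lambda>_. 0)" and s: "\<And>i. peval v (pd i f) = 0"
  shows "proj_class v \<in> sing_locus f"
proof -
  have hpd: "homogeneous (int (d - 1)) (pd i f)" for i using homogeneous_pd[OF f(1), of i] f(2) by (simp add: of_nat_diff)
  show ?thesis using proj_class_in_P3[OF v] s peval_scale[OF hpd] by (auto simp: sing_locus_def proj_class_def)
qed

text \<open>Representatives of distinct points are not proportional, so some 2 by 2 minor through a
  nonzero coordinate of \<open>rep t\<close> is nonzero. Read as a linear form, that minor vanishes
  at \<open>rep t\<close>.\<close>

lemma separating_form:
  assumes "s \<in> P3" "t \<in> P3" "s \<noteq> t"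
  shows "\<exists>l. homogeneous 1 l \<and> peval (rep t) l = 0 \<and> peval (rep s) l \<noteq> 0"
proof -
  let ?v = "rep s" and ?w = "rep t"
  obtain i where i: "?w i \<noteq> 0" using rep_nonzero[OF assms(2)] by (auto simp: fun_eq_iff)
  have "\<exists>j. ?w i * ?v j - ?w j * ?v i \<noteq> 0"
  proof (rule ccontr)
    assume "\<not> ?thesis"
    then have "?w i * ?v j = ?w j * ?v i" for j by simp
    then have *: "?v j = (?v i / ?w i) * ?w j" for j using i by (simp add: nonzero_eq_divide_eq mult_ac)
    have "?v i \<noteq> 0"
    proof
      assume 0: "?v i = 0"
      have "?v j = 0" for j using *[of j] unfolding 0 by (simp only: div_0 mult_zero_left)
      then have "?v = (\<lambda>_. 0)" by (rule ext)
      then show False using rep_nonzero[OF assms(1)] by simp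
    qed
    then have "?v i / ?w i \<noteq> 0" using i by simp
    moreover have "?v = (\<lambda>j. (?v i / ?w i) * ?w j)" using * by (rule ext)
    ultimately have "?v \<in> proj_class ?w" unfolding proj_class_def by blast
    then have "proj_class ?v = proj_class ?w" by (rule proj_class_eq)
    then show False using proj_class_rep assms by simp
  qed
  then obtain j where j: "?w i * ?v j - ?w j * ?v i \<noteq> 0" by blast
  have "homogeneous 1 (Const (?w i) * Var j - Const (?w j) * Var i)"
    by (intro homogeneous_diff homogeneous_Const_mult homogeneous_Var)
  then show ?thesis using j
    by (intro exI[of _ "Const (?w i) * Var j - Const (?w j) * Var i"]) (auto simp: peval.hom_minus peval.hom_mult)
qed

lemma isolating_form:
  assumes "finite T" "T \<subseteq> P3" "s \<in> T"
  shows "\<exists>h. homogeneous (int (card T - 1)) h \<and> peval (rep s) h \<noteq> 0 \<and> (\<forall>t\<in>T - {s}. peval (rep t) h = 0)"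
proof -
  have "\<exists>l. homogeneous 1 l \<and> peval (rep t) l = 0 \<and> peval (rep s) l \<noteq> 0" if "t \<in> T - {s}" for t
    using separating_form[of s t] assms that by blast
  then obtain l where l: "\<And>t. t \<in> T - {s} \<Longrightarrow> homogeneous 1 (l t) \<and> peval (rep t) (l t) = 0 \<and> peval (rep s) (l t) \<noteq> 0"
    by metis
  let ?h = "\<Prod>t\<in>T - {s}. l t"
  have "homogeneous (\<Sum>t\<in>T - {s}. 1) ?h" by (rule homogeneous_prod) (use l in blast)
  then have "homogeneous (int (card T - 1)) ?h" using assms by simp
  moreover have "peval (rep s) ?h \<noteq> 0" using l assms(1) by (simp add: peval.hom_prod)
  moreover have "peval (rep t) ?h = 0" if "t \<in> T - {s}" for t
    unfolding peval.hom_prod by (rule prod_zero) (use l that assms(1) in auto)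
  ultimately show ?thesis by blast
qed

text \<open>A multiple of a coordinate that is nonzero at the new point is added to the previous
  form; each point rules out at most one value of the multiplier.\<close>

lemma nonvanishing_linear_form:
  assumes "finite R" "\<And>v. v \<in> R \<Longrightarrow> v \<noteq> (\<lambda>_. 0)"
  shows "\<exists>l. homogeneous 1 l \<and> (\<forall>v\<in>R. peval v l \<noteq> 0)"
  using assms
proof (induction R rule: finite_induct)
  case empty
  then show ?case using homogeneous_Var by blast
next
  case (insert v R)
  then obtain l where l: "homogeneous 1 l" "\<forall>v\<in>R. peval v l \<noteq> 0" by auto
  obtain i where i: "v i \<noteq> 0" using insert.prems[of v] by (auto simp: fun_eq_iff)
  have "finite ((\<lambda>w. - peval w l / w i) ` insert v R)" using insert by simp
  then obtain c where c: "c \<notin> (\<lambda>w. - peval w l / w i) ` insert v R" "c \<noteq> 0"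
    using ex_new_if_finite[OF infinite_UNIV_char_0, of "insert 0 ((\<lambda>w. - peval w l / w i) ` insert v R)"] by auto
  have "peval w (l + Const c * Var i) \<noteq> 0" if w: "w \<in> insert v R" for w
  proof
    assume 0: "peval w (l + Const c * Var i) = 0"
    then have e: "peval w l + c * w i = 0" by (simp add: peval.hom_add peval.hom_mult)
    show False
    proof (cases "w i = 0")
      case True
      then have "w \<noteq> v" using i by auto
      then show False using e True l(2) w by auto
    next
      case False
      then have "c = - peval w l / w i" using e by (simp add: field_simps eq_neg_iff_add_eq_0)
      then show False using c(1) w by blast
    qed
  qed
  moreover have "homogeneous 1 (l + Const c * Var i)"
    by (intro homogeneous_add l homogeneous_Const_mult homogeneous_Var)
  ultimately show ?case by blast
qed

text \<open>In degrees at least \<open>card T\<close> the evaluations at the points of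
  \<open>T\<close> are independent functionals on forms, and all of them vanish on the Jacobian
  ideal.\<close>

lemma card_sing_le_HF:
  assumes T: "finite T" "T \<subseteq> sing_locus f" and k: "k \<ge> card T"
  shows "card T \<le> HF (jacobian_ideal f) k"
proof -
  let ?J = "jacobian_ideal f" and ?F = "forms (int k)"
  let ?K = "\<lambda>s. {p. peval (rep s) p = 0}"
  have TP: "T \<subseteq> P3" using T(2) sing_locus_P3 by blast
  have "\<exists>h. homogeneous (int k) h \<and> peval (rep s) h \<noteq> 0 \<and> (\<forall>t\<in>T - {s}. peval (rep t) h = 0)" if s: "s \<in> T" for s
  proof -
    obtain h where h: "homogeneous (int (card T - 1)) h" "peval (rep s) h \<noteq> 0" "\<forall>t\<in>T - {s}. peval (rep t) h = 0"
      using isolating_form[OF T(1) TP s] by blast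
    obtain i where i: "rep s i \<noteq> 0" using rep_nonzero[of s] s TP by (auto simp: fun_eq_iff)
    have "homogeneous (int (card T - 1) + int (k - (card T - 1)) * 1) (h * Var i ^ (k - (card T - 1)))"
      \<comment> \<open>A power of a coordinate not vanishing at \<open>s\<close> raises the
        isolating form to degree \<open>k\<close> and preserves its zeros at the other
        points.\<close>
      by (intro homogeneous_mult h homogeneous_power homogeneous_Var)
    then have "homogeneous (int k) (h * Var i ^ (k - (card T - 1)))" using k by (simp add: of_nat_diff)
    then show ?thesis using h i
      by (intro exI[of _ "h * Var i ^ (k - (card T - 1))"]) (auto simp: peval.hom_mult peval.hom_power)
  qed
  then obtain h where h: "\<And>s. s \<in> T \<Longrightarrow> homogeneous (int k) (h s) \<and> peval (rep s) (h s) \<noteq> 0 \<and> (\<forall>t\<in>T - {s}. peval (rep t) (h s) = 0)"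
    by metis
  have K: "S.subspace (?K s)" for s by (auto simp: S.subspace_def peval.hom_add peval.hom_mult)
  have "qdim4 ?F (?F \<inter> (\<Inter>s\<in>T. ?K s)) (\<Sum>s\<in>T. 1)"
  proof (rule S.qdim_crt[OF T(1) subspace_forms K])
    fix s assume s: "s \<in> T"
    have "qdim4 ?F (?F \<inter> ?K s) (card {()})"
    proof (rule S.qdim_familyI[where b = "\<lambda>_. h s"])
      show "S.subspace (?F \<inter> ?K s)" by (intro S.subspace_inter subspace_forms K)
      fix v assume v: "v \<in> ?F"
      show "\<exists>c. v - (\<Sum>i\<in>{()}. Const (c i) * h s) \<in> ?F \<inter> ?K s"
        using v h[OF s] by (intro exI[of _ "\<lambda>_. peval (rep s) v / peval (rep s) (h s)"])
          (auto simp: peval.hom_minus peval.hom_mult intro!: homogeneous_diff homogeneous_Const_mult)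
    qed (use h[OF s] in \<open>auto simp: peval.hom_mult\<close>)
    then show "qdim4 ?F (?F \<inter> ?K s) 1" by simp
    fix v assume v: "v \<in> ?F"
    show "\<exists>u\<in>?F. v - u \<in> ?K s \<and> (\<forall>t\<in>T - {s}. u \<in> ?K t)"
      using h[OF s] by (intro bexI[of _ "Const (peval (rep s) v / peval (rep s) (h s)) * h s"])
        (auto simp: peval.hom_minus peval.hom_mult intro!: homogeneous_Const_mult)
  qed
  then have q: "qdim4 ?F (?F \<inter> (\<Inter>s\<in>T. ?K s)) (card T)" by simp
  have sK: "S.subspace (?F \<inter> (\<Inter>s\<in>T. ?K s))" by (intro S.subspace_inter subspace_forms S.subspace_INT K)
  have "?J \<inter> ?F \<subseteq> ?F \<inter> (\<Inter>s\<in>T. ?K s)"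
    using zero_locus_jacobian sing_locus_rep T(2) by blast
  then obtain a b where "qdim4 ?F (?F \<inter> (\<Inter>s\<in>T. ?K s)) b" "a + b = HF ?J k"
    using S.qdim_split[OF sK subspace_ideal_forms[OF ideal4_jacobian] subspace_forms _ _ qdim_HF[OF ideal4_jacobian]] by blast
  moreover from this(1) have "b = card T" using S.qdim_unique[OF sK _ q] by blast
  ultimately show ?thesis by simp
qed

lemma finite_sing_locus_linear_form:
  assumes f: "homogeneous (int d) f" "d > 0" and fin: "finite (sing_locus f)"
  obtains l K where "homogeneous 1 l" "\<And>s. s \<in> sing_locus f \<Longrightarrow> peval (rep s) l \<noteq> 0"
    "\<And>k. k \<ge> K \<Longrightarrow> HF (ideal_plus (jacobian_ideal f) l) k = 0"
    "\<And>k. k \<ge> K \<Longrightarrow> HF (jacobian_ideal f) (Suc k) \<le> HF (jacobian_ideal f) k"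
    "\<And>k. k \<ge> K \<Longrightarrow> HF (jacobian_ideal f) k \<le> HF (jacobian_ideal f) K"
proof -
  have "\<exists>l. homogeneous 1 l \<and> (\<forall>v\<in>rep ` sing_locus f. peval v l \<noteq> 0)"
    by (rule nonvanishing_linear_form) (use fin rep_nonzero sing_locus_P3 in auto)
  then obtain l where l: "homogeneous 1 l" "\<And>s. s \<in> sing_locus f \<Longrightarrow> peval (rep s) l \<noteq> 0" by blast
  have van: "\<exists>p\<in>jacobian_ideal f. peval w p \<noteq> 0" if w: "w \<noteq> (\<lambda>_. 0)" "peval w l = 0" for w
  proof (rule ccontr)
    assume "\<not> ?thesis"
    then have "peval w (pd i f) = 0" for i using pd_mem_jacobian by blast
    then have s: "proj_class w \<in> sing_locus f" using proj_class_in_sing_locus[OF f w(1)] by blast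
    have "rep (proj_class w) \<in> proj_class w" by (rule rep_in[OF sing_locus_P3[OF s]])
    then obtain c where "rep (proj_class w) = (\<lambda>i. c * w i)" by (auto simp: proj_class_def)
    then have "peval (rep (proj_class w)) l = 0" using peval_scale[of 1 l c w] l(1) w(2) by simp
    then show False using l(2)[OF s] by simp
  qed
  show ?thesis
    by (rule HF_nonincreasing[OF homog_ideal_jacobian[OF f(1)] l(1) van]) (assumption | rule that[OF l])+
qed

context resolution begin

lemma isolated_iff:
  assumes f: "homogeneous (int d) f" "d > 0" and sf: "squarefree f"
  shows "finite (sing_locus f) \<longleftrightarrow> (int d - 1)^2 + alt_sum 2 ds cs bs = 0" (is "_ \<longleftrightarrow> ?A = 0")
proof
  let ?J = "jacobian_ideal f"
  note HF = six_HF'[OF f sf]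
  {
    assume "finite (sing_locus f)"
    then obtain l K where K: "\<And>k. k \<ge> K \<Longrightarrow> HF ?J k \<le> HF ?J K"
      using finite_sing_locus_linear_form[OF f] by metis
    define c where "c = (int d - 1)^3 + 6 * ?A - alt_sum 3 ds cs bs"
    \<comment> \<open>The bound on the Hilbert function gives |3 A k| \<le> M for all large
      \<open>k\<close>; choosing \<open>k > M\<close> then rules out a nonzero integer A.\<close>
    define M where "M = 6 * int (HF ?J K) + \<bar>c\<bar>"
    define k where "k = kmin + K + nat (M + 1)"
    have k: "k \<ge> kmin" "int k \<ge> M + 1" by (auto simp: k_def)
    have e: "6 * int (HF ?J (k + (d - 1))) = 3 * ?A * int k + c" using HF[OF k(1)] by (simp add: c_def)
    have "HF ?J (k + (d - 1)) \<le> HF ?J K" by (rule K) (simp add: k_def)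
    then have "6 * int (HF ?J (k + (d - 1))) \<le> 6 * int (HF ?J K)" by simp
    then have b: "\<bar>3 * ?A * int k\<bar> \<le> M" using e unfolding M_def by linarith
    show "?A = 0"
    proof (rule ccontr)
      assume "?A \<noteq> 0"
      then have "1 * int k \<le> \<bar>3 * ?A\<bar> * int k" by (intro mult_right_mono) auto
      then have "int k \<le> \<bar>3 * ?A * int k\<bar>" by (simp add: abs_mult)
      then show False using b k(2) by linarith
    qed
  next
    assume A: "?A = 0"
    show "finite (sing_locus f)"
    proof (rule ccontr)
      assume inf: "infinite (sing_locus f)"
      \<comment> \<open>Six times the now constant Hilbert function, a crude but sufficient bound
        for the number of singular points.\<close>
      let ?c = "nat ((int d - 1)^3 - alt_sum 3 ds cs bs)"
      obtain T where T: "T \<subseteq> sing_locus f" "finite T" "card T = ?c + 1"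
        using infinite_arbitrarily_large[OF inf] by metis
      have "card T \<le> HF ?J (kmin + card T + (d - 1))" by (rule card_sing_le_HF) (use T in auto)
      moreover have "6 * int (HF ?J (kmin + card T + (d - 1))) = (int d - 1)^3 - alt_sum 3 ds cs bs"
        using HF[of "kmin + card T"] unfolding A by simp
      ultimately show False using T(3) by linarith
    qed
  }
qed

end

section \<open>Local rings and Tjurina numbers\<close>

interpretation Q: cspace "\<lambda>c (q :: poly4 fract). Fract (Const c) 1 * q"
  by unfold_locales (simp_all add: algebra_simps Const.hom_add Const.hom_mult flip: to_fract_def)

lemma chart_ring_add: "p \<in> chart_ring j \<Longrightarrow> q \<in> chart_ring j \<Longrightarrow> p + q \<in> chart_ring j"
  using keys_add[of p q] by (auto simp: chart_ring_def)

lemma chart_ring_mult: "p \<in> chart_ring j \<Longrightarrow> q \<in> chart_ring j \<Longrightarrow> p * q \<in> chart_ring j"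
  using keys_mult[of p q] by (fastforce simp: chart_ring_def lookup_add)

lemma chart_ring_Const: "Const c \<in> chart_ring j"
  by (simp add: chart_ring_def Const_def)

lemma chart_ring_1: "1 \<in> chart_ring j"
  using chart_ring_Const[of 1] by simp

lemma chart_ring_Var: "i \<noteq> j \<Longrightarrow> Var i \<in> chart_ring j"
  by (simp add: chart_ring_def Var_def lookup_single when_def)

lemma chart_ring_power: "p \<in> chart_ring j \<Longrightarrow> p ^ n \<in> chart_ring j"
  by (induction n) (auto simp: chart_ring_1 chart_ring_mult)

lemma chart_ring_sum: "(\<And>x. x \<in> A \<Longrightarrow> g x \<in> chart_ring j) \<Longrightarrow> (\<Sum>x\<in>A. g x) \<in> chart_ring j"
  by (induction A rule: infinite_finite_induct) (auto intro: chart_ring_add simp: chart_ring_Const[of 0, simplified])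

lemma chart_ring_uminus: "p \<in> chart_ring j \<Longrightarrow> - p \<in> chart_ring j"
  using chart_ring_mult[OF chart_ring_Const[of "-1"], of p] by (simp add: Const.hom_uminus)

lemma local_ring_iff: "q \<in> local_ring j \<longleftrightarrow> (\<exists>a b. q = to_fract a / to_fract b \<and> a \<in> chart_ring j \<and> b \<in> chart_ring j \<and> peval (\<lambda>_. 0) b \<noteq> 0)"
  by (auto simp: local_ring_def Fract_conv_to_fract)

lemma peval_0_nonzero: "peval v b \<noteq> 0 \<Longrightarrow> b \<noteq> 0"
  by auto

lemma local_ring_to_fract: "a \<in> chart_ring j \<Longrightarrow> to_fract a \<in> local_ring j"
  unfolding local_ring_iff by (intro exI[of _ a] exI[of _ 1]) (auto simp: chart_ring_1)

lemma local_ring_inverse: "b \<in> chart_ring j \<Longrightarrow> peval (\<lambda>_. 0) b \<noteq> 0 \<Longrightarrow> inverse (to_fract b) \<in> local_ring j"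
  unfolding local_ring_iff by (intro exI[of _ 1] exI[of _ b]) (auto simp: chart_ring_1 divide_inverse)

lemma local_ring_add: 
  assumes "p \<in> local_ring j" "q \<in> local_ring j" shows "p + q \<in> local_ring j"
proof -
  from assms obtain a b a' b' where *: "p = to_fract a / to_fract b" "a \<in> chart_ring j" "b \<in> chart_ring j" "peval (\<lambda>_. 0) b \<noteq> 0"
    "q = to_fract a' / to_fract b'" "a' \<in> chart_ring j" "b' \<in> chart_ring j" "peval (\<lambda>_. 0) b' \<noteq> 0"
    unfolding local_ring_iff by metis
  then have "to_fract b \<noteq> 0" "to_fract b' \<noteq> 0" by auto
  then have "p + q = to_fract (a * b' + a' * b) / to_fract (b * b')" unfolding * by (simp add: add_frac_eq)
  moreover have "a * b' + a' * b \<in> chart_ring j" "b * b' \<in> chart_ring j" "peval (\<lambda>_. 0) (b * b') \<noteq> 0"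
    using * by (auto intro: chart_ring_add chart_ring_mult simp: peval.hom_mult)
  ultimately show ?thesis unfolding local_ring_iff by blast
qed

lemma local_ring_mult: 
  assumes "p \<in> local_ring j" "q \<in> local_ring j" shows "p * q \<in> local_ring j"
proof -
  from assms obtain a b a' b' where *: "p = to_fract a / to_fract b" "a \<in> chart_ring j" "b \<in> chart_ring j" "peval (\<lambda>_. 0) b \<noteq> 0"
    "q = to_fract a' / to_fract b'" "a' \<in> chart_ring j" "b' \<in> chart_ring j" "peval (\<lambda>_. 0) b' \<noteq> 0"
    unfolding local_ring_iff by metis
  then have "p * q = to_fract (a * a') / to_fract (b * b')" by simp
  moreover have "a * a' \<in> chart_ring j" "b * b' \<in> chart_ring j" "peval (\<lambda>_. 0) (b * b') \<noteq> 0"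
    using * by (auto intro: chart_ring_mult simp: peval.hom_mult)
  ultimately show ?thesis unfolding local_ring_iff by blast
qed

lemma local_ring_Const: "to_fract (Const c) \<in> local_ring j"
  by (intro local_ring_to_fract chart_ring_Const)

lemma local_ring_0: "0 \<in> local_ring j" and local_ring_1: "1 \<in> local_ring j"
  using local_ring_Const[of 0 j] local_ring_Const[of 1 j] by simp_all

lemma local_ring_power: "q \<in> local_ring j \<Longrightarrow> q ^ n \<in> local_ring j"
  by (induction n) (auto simp: local_ring_1 local_ring_mult)

lemma local_ring_sum: "(\<And>x. x \<in> A \<Longrightarrow> g x \<in> local_ring j) \<Longrightarrow> (\<Sum>x\<in>A. g x) \<in> local_ring j"
  by (induction A rule: infinite_finite_induct) (auto intro: local_ring_add simp: local_ring_0)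

lemma subspace_local_ring: "Q.subspace (local_ring j)"
  unfolding Q.subspace_def unfolding to_fract_def[symmetric]
  by (auto intro: local_ring_add local_ring_mult local_ring_Const local_ring_0)

lemma to_fract_of_nat: "to_fract (of_nat n) = of_nat n"
  by (induction n) simp_all

section \<open>Germs of forms at a point and the Tjurina ideal\<close>

locale chart =
  fixes f :: poly4 and d :: nat and s :: "4 \<Rightarrow> complex" and j :: 4
  assumes f: "homogeneous (int d) f" and d: "d > 0" and sj: "s j \<noteq> 0"
begin

definition loc :: "poly4 \<Rightarrow> poly4" where "loc p = local_equation p j s"

definition germ :: "poly4 \<Rightarrow> poly4 fract" where "germ p = to_fract (loc p)"

definition T :: "poly4 fract set" where "T = tjurina_ideal j (loc f)"

lemma loc_hom: "comm_ring_hom loc"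
proof -
  have "loc = psubst (\<lambda>i. if i = j then Const (s j) else Var i + Const (s i))"
    by (simp add: fun_eq_iff loc_def local_equation_def)
  then show ?thesis using psubst.comm_ring_hom_axioms by simp
qed

sublocale loc: comm_ring_hom loc by (rule loc_hom)

lemma loc_Const: "loc (Const c) = Const c" by (simp add: loc_def local_equation_def)

lemma loc_Var: "loc (Var i) = (if i = j then Const (s j) else Var i + Const (s i))"
  by (simp add: loc_def local_equation_def)

lemma loc_chart: "loc p \<in> chart_ring j"
  by (induction p rule: poly4_induct)
    (auto simp: loc_Const loc_Var loc.hom_add loc.hom_mult chart_ring_Const chart_ring_Var chart_ring_add chart_ring_mult)

lemma peval_loc: "peval (\<lambda>_. 0) (loc p) = peval s p"
proof -
  have "(\<lambda>i. peval (\<lambda>_. 0) (if i = j then Const (s j) else Var i + Const (s i))) = s"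
    by (auto simp: fun_eq_iff peval.hom_add)
  then show ?thesis by (simp add: loc_def local_equation_def peval_psubst)
qed

lemma pd_loc: "i \<noteq> j \<Longrightarrow> pd i (loc p) = loc (pd i p)"
proof (rule derivation_unique[where h = loc and D = "\<lambda>p. pd i (loc p)" and D' = "\<lambda>p. loc (pd i p)"])
  fix k assume "i \<noteq> j"
  then show "pd i (loc (Var k)) = loc (pd i (Var k))" by (auto simp: loc_Var pd_Var pd_add)
qed (simp_all add: loc.hom_add loc.hom_mult pd_add pd_mult loc_Const)

lemma germ_hom: "comm_ring_hom germ"
  by unfold_locales (simp_all add: germ_def loc.hom_add loc.hom_mult)

sublocale germ: comm_ring_hom germ by (rule germ_hom)

lemma germ_Const: "germ (Const c) = to_fract (Const c)" by (simp add: germ_def loc_Const)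

lemma germ_local_ring: "germ p \<in> local_ring j"
  unfolding germ_def by (intro local_ring_to_fract loc_chart)

lemma germ_unit: "peval s p \<noteq> 0 \<Longrightarrow> germ p \<noteq> 0 \<and> inverse (germ p) \<in> local_ring j"
  unfolding germ_def using local_ring_inverse[OF loc_chart, of p] peval_loc[of p] peval_0_nonzero[of "\<lambda>_. 0" "loc p"] by auto

text \<open>Euler's formula in both directions: divided by \<open>d\<close>, it expresses
  \<open>f\<close> through its partial derivatives; and since x_j is the nonzero constant s_j in the
  chart, it can be solved for the germ of the j-th one. Hence \<open>T\<close> is the extension of
  the Jacobian ideal to the local ring.\<close>

lemma T_iff: "q \<in> T \<longleftrightarrow> (\<exists>a. (\<forall>i. a i \<in> local_ring j) \<and> q = (\<Sum>i\<in>UNIV. a i * germ (pd i f)))"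
proof
  have e: "germ f = (\<Sum>i\<in>UNIV. (to_fract (Const (1 / of_nat d)) * germ (Var i)) * germ (pd i f))"
  proof -
    have "Const (1 / of_nat d) * (of_nat d * f) = Const (1 / of_nat d * of_nat d) * f"
      unfolding Const.hom_mult Const.hom_of_nat by (simp only: mult.assoc)
    then have "Const (1 / of_nat d) * (\<Sum>i\<in>UNIV. Var i * pd i f) = f" unfolding euler[OF f] using d by simp
    then have "germ f = germ (Const (1 / of_nat d) * (\<Sum>i\<in>UNIV. Var i * pd i f))" by (simp only:)
    also have "\<dots> = (\<Sum>i\<in>UNIV. (to_fract (Const (1 / of_nat d)) * germ (Var i)) * germ (pd i f))"
      unfolding germ.hom_mult germ.hom_sum germ_Const sum_distrib_left by (simp only: mult.assoc)
    finally show ?thesis .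
  qed
  {
    assume "q \<in> T"
    then obtain h a where q: "q = h * Fract (loc f) 1 + (\<Sum>i\<in>UNIV - {j}. a i * Fract (pd i (loc f)) 1)"
      and h: "h \<in> local_ring j" "\<forall>i. a i \<in> local_ring j"
      unfolding T_def tjurina_ideal_def by blast
    have "(\<Sum>i\<in>UNIV - {j}. a i * Fract (pd i (loc f)) 1) = (\<Sum>i\<in>UNIV - {j}. a i * germ (pd i f))"
      by (rule sum.cong) (auto simp: pd_loc germ_def to_fract_def)
    also have "\<dots> = (\<Sum>i\<in>UNIV - {j}. (if i = j then 0 else a i) * germ (pd i f))"
      by (rule sum.cong) auto
    also have "\<dots> = (\<Sum>i\<in>UNIV. (if i = j then 0 else a i) * germ (pd i f))"
      by (rule sum.mono_neutral_left) auto
    finally have "q = (\<Sum>i\<in>UNIV. (h * (to_fract (Const (1 / of_nat d)) * germ (Var i)) + (if i = j then 0 else a i)) * germ (pd i f))"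
      unfolding q to_fract_def[symmetric] germ_def[symmetric] by (subst e) (simp add: sum_distrib_left distrib_right sum.distrib mult.assoc)
    moreover have "h * (to_fract (Const (1 / of_nat d)) * germ (Var i)) + (if i = j then 0 else a i) \<in> local_ring j" for i
      using h by (auto intro!: local_ring_add local_ring_mult local_ring_Const germ_local_ring local_ring_0)
    ultimately show "\<exists>a. (\<forall>i. a i \<in> local_ring j) \<and> q = (\<Sum>i\<in>UNIV. a i * germ (pd i f))"
      by (intro exI[of _ "\<lambda>i. h * (to_fract (Const (1 / of_nat d)) * germ (Var i)) + (if i = j then 0 else a i)"]) blast
  }
  assume "\<exists>a. (\<forall>i. a i \<in> local_ring j) \<and> q = (\<Sum>i\<in>UNIV. a i * germ (pd i f))"
  then obtain a where a: "\<And>i. a i \<in> local_ring j" and q: "q = (\<Sum>i\<in>UNIV. a i * germ (pd i f))" by blast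
  let ?c = "to_fract (Const (1 / s j))"
  have cs: "?c * to_fract (Const (s j)) = 1" using sj by (simp flip: to_fract_mult Const.hom_mult)
  have split: "(\<Sum>i\<in>UNIV. g i) = g j + (\<Sum>i\<in>UNIV - {j}. g i)" for g :: "4 \<Rightarrow> poly4 fract"
    by (simp add: sum.remove)
  have "germ (of_nat d * f) = to_fract (Const (s j)) * germ (pd j f) + (\<Sum>i\<in>UNIV - {j}. germ (Var i) * germ (pd i f))"
  proof -
    have "germ (Var j) = to_fract (Const (s j))" by (simp add: germ_def loc_Var)
    then show ?thesis unfolding euler[OF f, symmetric] germ.hom_sum germ.hom_mult split by simp
  qed
  then have "?c * germ (of_nat d * f) = (?c * to_fract (Const (s j))) * germ (pd j f) + (\<Sum>i\<in>UNIV - {j}. ?c * (germ (Var i) * germ (pd i f)))"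
    by (simp add: distrib_left mult.assoc sum_distrib_left)
  then have "germ (pd j f) = ?c * germ (of_nat d * f) - (\<Sum>i\<in>UNIV - {j}. ?c * (germ (Var i) * germ (pd i f)))"
    unfolding cs by simp
  then have "a j * germ (pd j f) = a j * ?c * germ (of_nat d) * germ f - (\<Sum>i\<in>UNIV - {j}. a j * ?c * germ (Var i) * germ (pd i f))"
    by (simp add: right_diff_distrib sum_distrib_left mult.assoc germ.hom_mult)
  then have "q = (a j * ?c * germ (of_nat d)) * germ f + (\<Sum>i\<in>UNIV - {j}. (a i - a j * ?c * germ (Var i)) * germ (pd i f))"
    unfolding q split by (simp add: left_diff_distrib sum_subtractf)
  also have "(\<Sum>i\<in>UNIV - {j}. (a i - a j * ?c * germ (Var i)) * germ (pd i f))
    = (\<Sum>i\<in>UNIV - {j}. (a i + to_fract (Const (-1)) * (a j * ?c * germ (Var i))) * Fract (pd i (loc f)) 1)"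
    by (rule sum.cong) (auto simp: pd_loc germ_def to_fract_def[symmetric] Const.hom_uminus)
  finally have "q = (a j * ?c * germ (of_nat d)) * Fract (loc f) 1
    + (\<Sum>i\<in>UNIV - {j}. (a i + to_fract (Const (-1)) * (a j * ?c * germ (Var i))) * Fract (pd i (loc f)) 1)"
    by (simp add: germ_def to_fract_def)
  moreover have "a j * ?c * germ (of_nat d) \<in> local_ring j"
    "\<forall>i. a i + to_fract (Const (-1)) * (a j * ?c * germ (Var i)) \<in> local_ring j"
    by (intro allI local_ring_add local_ring_mult local_ring_Const germ_local_ring a)+
  ultimately show "q \<in> T" unfolding T_def tjurina_ideal_def
    by (intro CollectI exI[of _ "a j * ?c * germ (of_nat d)"]
      exI[of _ "\<lambda>i. a i + to_fract (Const (-1)) * (a j * ?c * germ (Var i))"] conjI)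
qed

lemma T_E:
  assumes "q \<in> T"
  obtains a where "\<And>i. a i \<in> local_ring j" "q = (\<Sum>i\<in>UNIV. a i * germ (pd i f))"
proof -
  from assms obtain a where "(\<forall>i. a i \<in> local_ring j) \<and> q = (\<Sum>i\<in>UNIV. a i * germ (pd i f))"
    unfolding T_iff by (rule exE)
  then show ?thesis by (intro that) auto
qed

lemma T_I: "(\<And>i. a i \<in> local_ring j) \<Longrightarrow> (\<Sum>i\<in>UNIV. a i * germ (pd i f)) \<in> T"
  unfolding T_iff by (intro exI[of _ a] conjI allI refl)

lemma T_add: "p \<in> T \<Longrightarrow> q \<in> T \<Longrightarrow> p + q \<in> T"
proof (elim T_E)
  fix a b assume a: "\<And>i. a i \<in> local_ring j" "p = (\<Sum>i\<in>UNIV. a i * germ (pd i f))"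
    and b: "\<And>i. b i \<in> local_ring j" "q = (\<Sum>i\<in>UNIV. b i * germ (pd i f))"
  have "p + q = (\<Sum>i\<in>UNIV. (a i + b i) * germ (pd i f))" unfolding a b by (simp only: distrib_right sum.distrib)
  also have "\<dots> \<in> T" by (intro T_I local_ring_add a b)
  finally show ?thesis .
qed

lemma T_mult: "r \<in> local_ring j \<Longrightarrow> q \<in> T \<Longrightarrow> r * q \<in> T"
proof (elim T_E)
  fix a assume r: "r \<in> local_ring j" and a: "\<And>i. a i \<in> local_ring j" "q = (\<Sum>i\<in>UNIV. a i * germ (pd i f))"
  have "r * q = (\<Sum>i\<in>UNIV. (r * a i) * germ (pd i f))" unfolding a by (simp only: sum_distrib_left mult.assoc)
  also have "\<dots> \<in> T" by (intro T_I local_ring_mult r a)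
  finally show ?thesis .
qed

lemma T_0: "0 \<in> T"
  using T_I[of "\<lambda>_. 0"] by (simp add: local_ring_0)

lemma T_uminus: "q \<in> T \<Longrightarrow> - q \<in> T"
  using T_mult[OF local_ring_Const[of "-1"], of q] by (simp add: Const.hom_uminus)

lemma T_sum: "(\<And>x. x \<in> A \<Longrightarrow> g x \<in> T) \<Longrightarrow> (\<Sum>x\<in>A. g x) \<in> T"
  by (induction A rule: infinite_finite_induct) (auto intro: T_add simp: T_0)

lemma subspace_T: "Q.subspace T"
  unfolding Q.subspace_def unfolding to_fract_def[symmetric] by (auto intro: T_add T_mult local_ring_Const T_0)

lemma germ_jacobian: "p \<in> jacobian_ideal f \<Longrightarrow> germ p \<in> T"
  unfolding jacobian_ideal_iff using T_I[OF germ_local_ring] by (auto simp: germ.hom_sum germ.hom_mult)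

lemma common_denominator:
  assumes "\<And>i::4. a i \<in> local_ring j"
  obtains u n where "peval (\<lambda>_. 0) u \<noteq> 0" "\<And>i. to_fract u * a i = to_fract (n i)"
proof -
  from assms have "\<forall>i. \<exists>x y. a i = to_fract x / to_fract y \<and> peval (\<lambda>_. 0) y \<noteq> 0" unfolding local_ring_iff by blast
  then obtain x y where xy: "\<And>i. a i = to_fract (x i) / to_fract (y i)" "\<And>i. peval (\<lambda>_. 0) (y i) \<noteq> 0" by metis
  let ?u = "\<Prod>i\<in>UNIV. y i"
  have "to_fract ?u * a i = to_fract (x i * (\<Prod>k\<in>UNIV - {i}. y k))" for i
  proof -
    have "?u = y i * (\<Prod>k\<in>UNIV - {i}. y k)" by (simp add: prod.remove)
    moreover have "to_fract (y i) \<noteq> 0" using xy(2)[of i] by auto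
    ultimately show ?thesis by (simp add: xy(1))
  qed
  moreover have "peval (\<lambda>_. 0) ?u \<noteq> 0" using xy(2) by (simp add: peval.hom_prod)
  ultimately show ?thesis using that[of ?u "\<lambda>i. x i * (\<Prod>k\<in>UNIV - {i}. y k)"] by blast
qed

lemma specialise_Var: "\<exists>r. p - psubst (\<lambda>i. if i = j then Const (s j) else Var i) p = (Var j - Const (s j)) * r"
proof (induction p rule: poly4_induct)
  case (Const c) show ?case by (intro exI[of _ 0]) simp
next
  case (Var i) show ?case
    by (cases "i = j") (auto intro: exI[of _ 0] exI[of _ 1])
next
  case (add p q)
  let ?s = "psubst (\<lambda>i. if i = j then Const (s j) else Var i)"
  from add obtain r r' where r: "p - ?s p = (Var j - Const (s j)) * r" "q - ?s q = (Var j - Const (s j)) * r'" by blast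
  have "p + q - (?s p + ?s q) = (p - ?s p) + (q - ?s q)" by (simp add: algebra_simps)
  also have "\<dots> = (Var j - Const (s j)) * (r + r')" unfolding r by (simp add: distrib_left)
  finally show ?case unfolding psubst.hom_add by blast
next
  case (mult p q)
  let ?s = "psubst (\<lambda>i. if i = j then Const (s j) else Var i)"
  from mult obtain r r' where r: "p - ?s p = (Var j - Const (s j)) * r" "q - ?s q = (Var j - Const (s j)) * r'" by blast
  have "p * q - ?s p * ?s q = (p - ?s p) * q + ?s p * (q - ?s q)" by (simp add: algebra_simps)
  also have "\<dots> = (Var j - Const (s j)) * (r * q + ?s p * r')" unfolding r by (simp add: algebra_simps)
  finally show ?case unfolding psubst.hom_mult by blast
qed

text \<open>Clearing denominators and homogenising with \<open>x\<^sub>j\<close>.\<close>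
lemma germ_mem_T_imp:
  assumes p: "homogeneous (int k) p" and T: "germ p \<in> T"
  obtains U m where "homogeneous m U" "peval s U \<noteq> 0" "U * p \<in> jacobian_ideal f"
proof -
  let ?J = "jacobian_ideal f" and ?x = "Var j" and ?c = "Const (s j)"
  have iJ: "ideal4 ?J" by (rule ideal4_jacobian)
  from T obtain a where a: "\<And>i. a i \<in> local_ring j" "germ p = (\<Sum>i\<in>UNIV. a i * germ (pd i f))" by (rule T_E) (rule that)
  obtain u n where u: "peval (\<lambda>_. 0) u \<noteq> 0" and n: "\<And>i. to_fract u * a i = to_fract (n i)"
    by (rule common_denominator[of a, OF a(1)]) (rule that)
  have "to_fract (u * loc p) = to_fract u * germ p" by (simp add: germ_def)
  also have "\<dots> = (\<Sum>i\<in>UNIV. (to_fract u * a i) * germ (pd i f))" unfolding a(2) by (simp add: sum_distrib_left mult.assoc)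
  also have "\<dots> = to_fract (\<Sum>i\<in>UNIV. n i * loc (pd i f))" by (simp add: n germ_def to_fract_sum)
  finally have ul: "u * loc p = (\<Sum>i\<in>UNIV. n i * loc (pd i f))" by (simp only: to_fract_eq_iff)
  \<comment> \<open>\<open>?t\<close> moves the origin back, so \<open>?t (loc q)\<close> is
    \<open>q\<close> with x_j replaced by s_j. Undoing this replacement costs a multiple of x_j -
    s_j, collected below in \<open>R\<close>.\<close>
  let ?t = "psubst (\<lambda>i. Var i - Const (s i))" and ?s = "psubst (\<lambda>i. if i = j then Const (s j) else Var i)"
  have ts: "?t (loc q) = ?s q" for q
    by (rule hom_unique[OF comm_ring_hom_compose[OF psubst.comm_ring_hom_axioms loc_hom] psubst.comm_ring_hom_axioms])
      (simp_all add: loc_Const loc_Var psubst.hom_add)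
  have "?t u * ?s p = (\<Sum>i\<in>UNIV. ?t (n i) * ?s (pd i f))"
    using arg_cong[OF ul, of ?t] unfolding psubst.hom_mult psubst.hom_sum ts .
  moreover obtain r where r: "\<And>q. q - ?s q = (?x - ?c) * r q" using specialise_Var by metis
  have "?s q = q - (?x - ?c) * r q" for q unfolding r[of q, symmetric] by simp
  ultimately have "?t u * (p - (?x - ?c) * r p) = (\<Sum>i\<in>UNIV. ?t (n i) * (pd i f - (?x - ?c) * r (pd i f)))" by simp
  then have "?t u * p - (?x - ?c) * (?t u * r p - (\<Sum>i\<in>UNIV. ?t (n i) * r (pd i f))) = (\<Sum>i\<in>UNIV. ?t (n i) * pd i f)"
    by (simp add: algebra_simps sum_distrib_left sum_subtractf sum.distrib)
  then have "?t u * p - (?x - ?c) * (?t u * r p - (\<Sum>i\<in>UNIV. ?t (n i) * r (pd i f))) \<in> ?J"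
    unfolding jacobian_ideal_iff by (rule exI[of _ "\<lambda>i. ?t (n i)"])
  then obtain W R where W: "W = ?t u" and WR: "W * p - (?x - ?c) * R \<in> ?J" by blast
  have Ws: "peval s W \<noteq> 0" using u by (simp add: W peval_psubst peval.hom_minus)
  have comp: "hcomp i W * p - ?x * hcomp (i + int k - 1) R + ?c * hcomp (i + int k) R \<in> ?J" for i
  proof -
    have "hcomp (i + int k) (p * W - (?x * R - ?c * R)) \<in> ?J"
    proof -
      have "p * W - (?x * R - ?c * R) \<in> ?J" using WR by (simp only: mult.commute[of p W] left_diff_distrib)
      then show ?thesis using homog_ideal_jacobian[OF f] unfolding homog_ideal_def by blast
    qed
    moreover have "hcomp (i + int k) (p * W) = p * hcomp i W" using hcomp_mult[OF p, of "i + int k" W] by simp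
    ultimately show ?thesis
      using hcomp_mult[OF homogeneous_Var, of "i + int k" j R]
      by (simp add: hcomp_diff hcomp_add hcomp_Const_mult mult.commute[of "hcomp i W"]
        diff_diff_eq2 diff_add_eq)
  qed
  define y where "y i = hcomp (int i - int k) W * p" for i :: nat
  have y: "y i - ?x * hcomp (int i - 1) R + ?c * hcomp (int i) R \<in> ?J" for i
    using comp[of "int i - int k"] by (simp add: y_def)
  \<comment> \<open>With y_i the degree i part of \<open>W * p\<close>, the relation reads y_i = x_j
    R_(i-1) - s_j R_i modulo J. The weights x_j^(m-i) s_j^i make the sum telescope to its last
    term.\<close>
  have sum: "(\<Sum>i\<le>m. ?x ^ (m - i) * ?c ^ i * y i) + ?c ^ Suc m * hcomp (int m) R \<in> ?J" for m
  proof (induction m)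
    case 0
    have "hcomp (-1) R = 0" using homogeneous_neg[OF homogeneous_hcomp, of "-1" R] by simp
    then show ?case using y[of 0] by simp
  next
    case (Suc m)
    have "(\<Sum>i\<le>m. ?x ^ (Suc m - i) * ?c ^ i * y i) = ?x * (\<Sum>i\<le>m. ?x ^ (m - i) * ?c ^ i * y i)"
      unfolding sum_distrib_left by (rule sum.cong) (auto simp: Suc_diff_le mult.assoc)
    then have "(\<Sum>i\<le>Suc m. ?x ^ (Suc m - i) * ?c ^ i * y i) + ?c ^ Suc (Suc m) * hcomp (int (Suc m)) R
      = ?x * ((\<Sum>i\<le>m. ?x ^ (m - i) * ?c ^ i * y i) + ?c ^ Suc m * hcomp (int m) R)
       + ?c ^ Suc m * (y (Suc m) - ?x * hcomp (int (Suc m) - 1) R + ?c * hcomp (int (Suc m)) R)"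
      by (simp add: algebra_simps)
    also have "\<dots> \<in> ?J" by (intro ideal4D[OF iJ] Suc y)
    finally show ?case .
  qed
  have ex: "\<exists>b::nat. \<forall>m\<in>keys q. mdeg m \<le> b" for q :: poly4
    by (intro exI[of _ "\<Sum>m\<in>keys q. mdeg m"] ballI member_le_sum) auto
  obtain b1 where b1: "\<And>m. m \<in> keys R \<Longrightarrow> mdeg m \<le> b1" using ex by metis
  obtain b2 where b2: "\<And>m. m \<in> keys W \<Longrightarrow> mdeg m \<le> b2" using ex by metis
  \<comment> \<open>\<open>n\<close> exceeds the degree of \<open>R\<close>, which removes the
    remaining term, and also reaches all components of \<open>W\<close>, whose indices are shifted
    by \<open>k\<close>.\<close>
  define n where "n = b1 + b2 + k + 1"
  have "hcomp (int n) R = 0" by (rule hcomp_eq_0) (use b1 in \<open>force simp: n_def\<close>)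
  then have "(\<Sum>i\<le>n. ?x ^ (n - i) * ?c ^ i * y i) \<in> ?J" using sum[of n] by simp
  moreover define U where "U = (\<Sum>i\<le>n. ?x ^ (n - i) * (?c ^ i * hcomp (int i - int k) W))"
  ultimately have "U * p \<in> ?J" by (simp add: sum_distrib_right y_def mult.assoc)
  moreover have "homogeneous (int n - int k) U" unfolding U_def
  proof (rule homogeneous_sum)
    fix i assume "i \<in> {..n}"
    then have "int (n - i) * 1 + (int i - int k) = int n - int k" by (simp add: of_nat_diff)
    then show "homogeneous (int n - int k) (?x ^ (n - i) * (?c ^ i * hcomp (int i - int k) W))"
      using homogeneous_mult[OF homogeneous_power[OF homogeneous_Var[of j], of "n - i"], of "int i - int k" "?c ^ i * hcomp (int i - int k) W"]
        homogeneous_Const_mult[OF homogeneous_hcomp, of "int i - int k" "s j ^ i" W] by (simp add: Const.hom_power)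
  qed
  moreover have "peval s U \<noteq> 0"
  proof -
    \<comment> \<open>At \<open>s\<close> the variable x_j equals s_j, so every weight becomes s_j^n
      and the components of \<open>W\<close> add up again.\<close>
    have "peval s U = (\<Sum>i\<le>n. s j ^ n * peval s (hcomp (int i - int k) W))"
      unfolding U_def peval.hom_sum
      by (intro sum.cong refl) (simp add: peval.hom_mult peval.hom_power mult.assoc[symmetric] power_add[symmetric])
    also have "\<dots> = s j ^ n * peval s (\<Sum>i\<le>n. hcomp (int i - int k) W)"
      by (simp add: sum_distrib_left peval.hom_sum)
    also have "(\<Sum>i\<le>n. hcomp (int i - int k) W) = (\<Sum>i\<in>(\<lambda>i. int i - int k) ` {..n}. hcomp i W)"
      by (subst sum.reindex) (auto simp: inj_on_def)
    also have "\<dots> = W"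
    proof (rule sum_hcomp_superset)
      show "(\<lambda>m. int (mdeg m)) ` keys W \<subseteq> (\<lambda>i. int i - int k) ` {..n}"
      proof safe
        fix m assume "m \<in> keys W"
        then have "mdeg m \<le> b2" by (rule b2)
        then show "int (mdeg m) \<in> (\<lambda>i. int i - int k) ` {..n}" by (intro image_eqI[of _ _ "mdeg m + k"]) (auto simp: n_def)
      qed
    qed simp
    finally show ?thesis using Ws sj by simp
  qed
  ultimately show ?thesis using that by blast
qed

lemma T_power_add:
  assumes "a \<in> local_ring j" "b \<in> local_ring j" "a ^ m \<in> T" "b ^ n \<in> T"
  shows "(a + b) ^ (m + n) \<in> T"
  unfolding binomial_ring
proof (rule T_sum)
  fix k assume "k \<in> {..m + n}"
  have c: "of_nat ((m + n) choose k) \<in> local_ring j"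
    using local_ring_Const[of "of_nat ((m + n) choose k)" j] by (simp add: Const.hom_of_nat to_fract_of_nat)
  show "of_nat ((m + n) choose k) * a ^ k * b ^ (m + n - k) \<in> T"
  proof (cases "k \<ge> m")
    case True
    then have "a ^ k = a ^ (k - m) * a ^ m" by (simp flip: power_add)
    then have eq: "of_nat ((m + n) choose k) * a ^ k * b ^ (m + n - k) = (of_nat ((m + n) choose k) * a ^ (k - m) * b ^ (m + n - k)) * a ^ m"
      by (simp add: mult_ac)
    show ?thesis unfolding eq by (intro T_mult local_ring_mult local_ring_power assms c)
  next
    case False
    then have "b ^ (m + n - k) = b ^ (m - k) * b ^ n" by (simp flip: power_add)
    then have eq: "of_nat ((m + n) choose k) * a ^ k * b ^ (m + n - k) = (of_nat ((m + n) choose k) * a ^ k * b ^ (m - k)) * b ^ n"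
      by (simp add: mult_ac)
    show ?thesis unfolding eq by (intro T_mult local_ring_mult local_ring_power assms c)
  qed
qed

end

lemma to_fract_power: "to_fract (p ^ n) = to_fract p ^ n"
  by (induction n) simp_all

lemma form_power_mem_jacobian:
  assumes f: "homogeneous (int d) f" "d > 0" and h: "homogeneous (int e) h" "e > 0"
    and van: "\<And>t. t \<in> sing_locus f \<Longrightarrow> peval (rep t) h = 0"
  obtains N where "h ^ N \<in> jacobian_ideal f"
proof (rule homogeneous_nullstellensatz[OF homog_ideal_jacobian[OF f(1)] h(1)])
  show "int e > 0" using h(2) by simp
  fix w :: "4 \<Rightarrow> complex" assume w: "w \<noteq> (\<lambda>_. 0)" "\<forall>p\<in>jacobian_ideal f. peval w p = 0"
  then have t: "proj_class w \<in> sing_locus f"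
    using proj_class_in_sing_locus[OF f w(1)] pd_mem_jacobian by blast
  have "rep (proj_class w) \<in> proj_class w" by (rule rep_in[OF sing_locus_P3[OF t]])
  then obtain c where c: "c \<noteq> 0" "rep (proj_class w) = (\<lambda>i. c * w i)" by (auto simp: proj_class_def)
  then have "c ^ e * peval w h = 0" using van[OF t] peval_scale[OF h(1), of c w] by simp
  then show "peval w h = 0" using c(1) by simp
qed (rule that)

section \<open>Representing local germs by forms of high degree\<close>

context chart begin

lemma T_unit_cancel: "peval s h \<noteq> 0 \<Longrightarrow> germ h * q \<in> T \<Longrightarrow> q \<in> T"
  using T_mult[of "inverse (germ h)" "germ h * q"] germ_unit[of h] by (simp flip: mult.assoc)

lemma T_unit_cancel_power: "peval s h \<noteq> 0 \<Longrightarrow> germ h ^ n * q \<in> T \<Longrightarrow> q \<in> T"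
  using T_unit_cancel[of "h ^ n" q] by (simp add: germ.hom_power peval.hom_power)

text \<open>A homogeneous lift of the affine coordinate centred at \<open>s\<close>: in the chart,
  \<open>lin i\<close> becomes \<open>Var i\<close> for \<open>i \<noteq> j\<close>.\<close>

definition lin :: "4 \<Rightarrow> poly4" where "lin i = Var i - Const (s i / s j) * Var j"

lemma homogeneous_lin: "homogeneous 1 (lin i)"
  unfolding lin_def by (intro homogeneous_diff homogeneous_Const_mult homogeneous_Var)

lemma loc_lin: "i \<noteq> j \<Longrightarrow> loc (lin i) = Var i"
proof -
  assume "i \<noteq> j"
  have "Const (s i / s j) * Const (s j) = Const (s i)" using sj by (simp flip: Const.hom_mult)
  then show ?thesis using \<open>i \<noteq> j\<close> by (simp add: lin_def loc.hom_minus loc.hom_mult loc_Var loc_Const)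
qed

text \<open>Let \<open>h\<close> vanish at the other singular points but not at \<open>x\<close>.
  Then \<open>h * lin i\<close> vanishes on the whole singular locus, so a power of it lies in the
  Jacobian ideal, and \<open>h\<close> is a unit at \<open>x\<close>. The affine coordinates are
  thus nilpotent modulo \<open>T\<close>.\<close>

lemma Var_power_mem_T:
  assumes fin: "finite (sing_locus f)" and x: "x \<in> sing_locus f" and s: "s = rep x"
  obtains N where "N > 0" "\<And>i. i \<noteq> j \<Longrightarrow> to_fract (Var i) ^ N \<in> T"
proof -
  have "sing_locus f \<subseteq> P3" using sing_locus_P3 by blast
  then obtain h where h: "homogeneous (int (card (sing_locus f) - 1)) h" "peval (rep x) h \<noteq> 0"
    "\<forall>t\<in>sing_locus f - {x}. peval (rep t) h = 0" using isolating_form[OF fin _ x] by blast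
  have ex: "\<exists>N. i \<noteq> j \<longrightarrow> to_fract (Var i) ^ N \<in> T" for i
  proof (cases "i = j")
    case False
    have hl: "homogeneous (int (card (sing_locus f) - 1 + 1)) (h * lin i)"
      using homogeneous_mult[OF h(1) homogeneous_lin[of i]] by (simp add: add.commute)
    have "peval (rep x) (lin i) = 0"
      unfolding s[symmetric] using sj by (simp add: lin_def peval.hom_minus peval.hom_mult)
    then have "peval (rep t) (h * lin i) = 0" if "t \<in> sing_locus f" for t
      using h(3) that by (cases "t = x") (auto simp: peval.hom_mult)
    then obtain N where "(h * lin i) ^ N \<in> jacobian_ideal f"
      by (rule form_power_mem_jacobian[OF f d hl, rotated]) auto
    then have "germ h ^ N * germ (lin i) ^ N \<in> T"
      using germ_jacobian by (simp flip: germ.hom_power germ.hom_mult power_mult_distrib)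
    then have "germ (lin i) ^ N \<in> T" using T_unit_cancel_power h(2) s by blast
    then show ?thesis using loc_lin[OF False] by (auto simp: germ_def)
  qed auto
  show ?thesis
  proof (rule finite_common_bound[of "\<lambda>i N. i \<noteq> j \<longrightarrow> to_fract (Var i) ^ N \<in> T"])
    fix i n m assume n: "i \<noteq> j \<longrightarrow> to_fract (Var i) ^ n \<in> T" "n \<le> m"
    show "i \<noteq> j \<longrightarrow> to_fract (Var i) ^ m \<in> T"
    proof
      assume i: "i \<noteq> j"
      have "to_fract (Var i) ^ m = to_fract (Var i) ^ (m - n) * to_fract (Var i) ^ n" using n(2) by (simp flip: power_add)
      then show "to_fract (Var i) ^ m \<in> T"
        using n(1) i by (simp add: T_mult local_ring_power local_ring_to_fract chart_ring_Var)
    qed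
  next
    fix N assume "N > 0" "\<And>i. i \<noteq> j \<longrightarrow> to_fract (Var i) ^ N \<in> T"
    then show ?thesis using that by blast
  qed (rule ex)
qed

lemma chart_ring_single: "lookup m j = 0 \<Longrightarrow> single m c \<in> chart_ring j"
  by (auto simp: chart_ring_def)

lemma single_split: "i \<noteq> j \<Longrightarrow> lookup m j = 0 \<Longrightarrow> n \<le> lookup m i \<Longrightarrow>
  \<exists>p\<in>chart_ring j. single m c = p * Var i ^ n"
proof -
  assume i: "i \<noteq> j" "lookup m j = 0" "n \<le> lookup m i"
  then have "m = (m - single i n) + single i n"
    by (intro poly_mapping_eqI) (auto simp: lookup_add lookup_minus lookup_single when_def)
  then have "single m c = single (m - single i n) c * Var i ^ n" by (simp add: Var_power mult_single)
  moreover have "single (m - single i n) c \<in> chart_ring j" using i by (intro chart_ring_single) (simp add: lookup_minus)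
  ultimately show ?thesis by blast
qed

lemma nilpotent_mod_T:
  assumes N: "\<And>i. i \<noteq> j \<Longrightarrow> to_fract (Var i) ^ N \<in> T"
    and p: "p \<in> chart_ring j" "lookup p 0 = 0"
  shows "\<exists>M. to_fract p ^ M \<in> T"
proof -
  have "\<exists>M. to_fract (\<Sum>m\<in>A. single m (lookup p m)) ^ M \<in> T" if "finite A" "A \<subseteq> keys p" for A
    using that
  proof (induction A rule: finite_induct)
    case empty
    then show ?case by (intro exI[of _ 1]) (simp add: T_0)
  next
    case (insert m A)
    then obtain M where M: "to_fract (\<Sum>m\<in>A. single m (lookup p m)) ^ M \<in> T" by auto
    have mk: "m \<in> keys p" using insert by auto
    then have mj: "lookup m j = 0" using p(1) by (auto simp: chart_ring_def)
    have "m \<noteq> 0" using mk p(2) by (auto simp: in_keys_iff)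
    then obtain i where i: "lookup m i \<noteq> 0" by (metis lookup_zero poly_mapping_eqI)
    then have ij: "i \<noteq> j" using mj by auto
    have "\<exists>c\<in>chart_ring j. single m (lookup p m) = c * Var i ^ 1" by (rule single_split) (use i ij mj in auto)
    then obtain c where c: "c \<in> chart_ring j" "single m (lookup p m) = c * Var i ^ 1" by blast
    have "to_fract (single m (lookup p m)) ^ N = to_fract c ^ N * to_fract (Var i) ^ N"
      unfolding c(2) by (simp add: power_mult_distrib)
    then have "to_fract (single m (lookup p m)) ^ N \<in> T"
      using N[OF ij] c(1) by (simp add: T_mult local_ring_power local_ring_to_fract)
    moreover have "(\<Sum>m\<in>A. single m (lookup p m)) \<in> chart_ring j"
      using insert p(1) by (intro chart_ring_sum chart_ring_single) (auto simp: chart_ring_def)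
    ultimately have "(to_fract (single m (lookup p m)) + to_fract (\<Sum>m\<in>A. single m (lookup p m))) ^ (N + M) \<in> T"
      by (intro T_power_add M local_ring_to_fract chart_ring_single mj)
    then show ?case using insert by (intro exI[of _ "N + M"]) (simp add: sum.insert)
  qed
  from this[of "keys p"] show ?thesis by (simp add: sum_singles)
qed

text \<open>A monomial with an exponent at least \<open>N\<close> in a chart coordinate lies in
  \<open>T\<close>. All others have degree at most 4N and can be homogenised to degree
  \<open>k\<close>.\<close>

lemma chart_surj:
  assumes N: "\<And>i. i \<noteq> j \<Longrightarrow> to_fract (Var i) ^ N \<in> T" "N > 0" and k: "k \<ge> 4 * N"
    and a: "a \<in> chart_ring j"
  shows "\<exists>p\<in>forms (int k). germ p - to_fract a \<in> T"
proof -
  have single: "\<exists>p\<in>forms (int k). germ p - to_fract (single m c) \<in> T" if mj: "lookup m j = 0" for m c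
  proof (cases "\<exists>i. i \<noteq> j \<and> N \<le> lookup m i")
    case True
    then obtain i where i: "i \<noteq> j" "N \<le> lookup m i" by blast
    obtain q where q: "q \<in> chart_ring j" "single m c = q * Var i ^ N" using single_split[OF i(1) mj i(2)] by blast
    have "to_fract (single m c) = to_fract q * to_fract (Var i) ^ N"
      unfolding q(2) by (simp add: to_fract_power)
    then have "to_fract (single m c) \<in> T" using T_mult[OF local_ring_to_fract[OF q(1)] N(1)[OF i(1)]] by simp
    then show ?thesis using T_uminus by (intro bexI[of _ 0]) auto
  next
    case False
    have "mdeg m \<le> card (UNIV :: 4 set) * N" unfolding mdeg_def
    proof (rule order_trans[OF sum_bounded_above])
      fix i show "lookup m i \<le> N" using False mj by (cases "i = j") (auto simp: not_le)
    qed simp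
    then have mk: "mdeg m \<le> k" using k by simp
    \<comment> \<open>Chart coordinates lift to \<open>lin i\<close>, and x_j / s_j, which equals 1
      in the chart, supplies the missing degree.\<close>
    define p where "p = Const c * (\<Prod>i\<in>UNIV. lin i ^ lookup m i) * (Const (1 / s j) * Var j) ^ (k - mdeg m)"
    have "homogeneous (0 + (\<Sum>i\<in>UNIV. int (lookup m i) * 1) + int (k - mdeg m) * 1) p" unfolding p_def
      by (intro homogeneous_mult homogeneous_prod homogeneous_power homogeneous_lin homogeneous_Const_mult homogeneous_Const homogeneous_Var)
    moreover have "0 + (\<Sum>i\<in>UNIV. int (lookup m i) * 1) + int (k - mdeg m) * 1 = int k"
      using mk by (simp add: mdeg_def of_nat_diff)
    ultimately have hp: "homogeneous (int k) p" by (simp only:)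
    have "loc (Const (1 / s j) * Var j) = 1" using sj by (simp add: loc.hom_mult loc_Const loc_Var flip: Const.hom_mult)
    moreover have "(\<Prod>i\<in>UNIV. loc (lin i) ^ lookup m i) = (\<Prod>i\<in>UNIV. Var i ^ lookup m i)"
    proof (rule prod.cong)
      fix i show "loc (lin i) ^ lookup m i = Var i ^ lookup m i" using mj loc_lin[of i] by (cases "i = j") auto
    qed simp
    ultimately have "loc p = single m c"
      unfolding p_def single_eq_Const_mult_Var[of m c] by (simp add: loc.hom_mult loc.hom_prod loc.hom_power loc_Const)
    then show ?thesis using hp by (intro bexI[of _ p]) (auto simp: germ_def T_0)
  qed
  have "\<exists>p\<in>forms (int k). germ p - to_fract (\<Sum>m\<in>A. single m (lookup a m)) \<in> T" if "finite A" "A \<subseteq> keys a" for A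
    using that
  proof (induction A rule: finite_induct)
    case empty
    then show ?case by (intro bexI[of _ 0]) (auto simp: T_0)
  next
    case (insert m A)
    then obtain p where p: "homogeneous (int k) p" "germ p - to_fract (\<Sum>m\<in>A. single m (lookup a m)) \<in> T" by auto
    obtain q where q: "homogeneous (int k) q" "germ q - to_fract (single m (lookup a m)) \<in> T"
      using single[of m "lookup a m"] insert a by (auto simp: chart_ring_def)
    have "(germ q - to_fract (single m (lookup a m))) + (germ p - to_fract (\<Sum>m\<in>A. single m (lookup a m))) \<in> T"
      by (rule T_add[OF q(2) p(2)])
    also have "(germ q - to_fract (single m (lookup a m))) + (germ p - to_fract (\<Sum>m\<in>A. single m (lookup a m)))
      = germ (q + p) - to_fract (\<Sum>m\<in>insert m A. single m (lookup a m))"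
      using insert(1,2) by (simp add: germ.hom_add algebra_simps)
    finally show ?case using homogeneous_add[OF q(1) p(1)] by (intro bexI[of _ "q + p"]) auto
  qed
  from this[of "keys a"] show ?thesis by (simp add: sum_singles)
qed

text \<open>Up to a nonzero constant a denominator is \<open>1 - n\<close> with \<open>n\<close>
  nilpotent modulo \<open>T\<close>; a finite geometric series inverts it there and reduces the
  claim to numerators.\<close>

lemma local_surj:
  assumes N: "\<And>i. i \<noteq> j \<Longrightarrow> to_fract (Var i) ^ N \<in> T" "N > 0" and k: "k \<ge> 4 * N"
    and q: "q \<in> local_ring j"
  shows "\<exists>p\<in>forms (int k). germ p - q \<in> T"
proof -
  from q obtain a b where q: "q = to_fract a / to_fract b" and a: "a \<in> chart_ring j"
    and b: "b \<in> chart_ring j" "peval (\<lambda>_. 0) b \<noteq> 0" unfolding local_ring_iff by (elim exE conjE) (rule that)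
  define b0 where "b0 = lookup b 0"
  have b0: "b0 \<noteq> 0" using b(2) by (simp add: b0_def peval_zero)
  define n where "n = 1 - Const (1 / b0) * b"
  have nchart: "n \<in> chart_ring j"
    using chart_ring_add[OF chart_ring_1 chart_ring_uminus[OF chart_ring_mult[OF chart_ring_Const b(1), of "1 / b0"]]] by (simp add: n_def)
  have "lookup n 0 = 0" using b0 by (simp add: n_def lookup_minus lookup_Const_mult b0_def)
  then obtain M where M: "to_fract n ^ M \<in> T" using nilpotent_mod_T[OF N(1) nchart] by blast
  define g where "g = Const (1 / b0) * (\<Sum>i<M. n ^ i)"
  have gchart: "g \<in> chart_ring j" unfolding g_def
    by (intro chart_ring_mult chart_ring_Const chart_ring_sum chart_ring_power nchart)
  have "b * g = (1 - n) * (\<Sum>i<M. n ^ i)" by (simp add: g_def n_def mult_ac)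
  also have "\<dots> = 1 - n ^ M" by (simp add: one_diff_power_eq)
  finally have bg: "b * g = 1 - n ^ M" .
  have "to_fract b \<noteq> 0" using b(2) by auto
  then have "to_fract (a * g) - q = q * (to_fract (b * g) - 1)" by (simp add: q field_simps)
  also have "\<dots> = - (q * to_fract n ^ M)" unfolding bg by (simp add: to_fract_power)
  finally have "to_fract (a * g) - q = - (q * to_fract n ^ M)" .
  then have t: "to_fract (a * g) - q \<in> T" using T_uminus[OF T_mult[OF assms(4) M]] by simp
  obtain p where p: "p \<in> forms (int k)" "germ p - to_fract (a * g) \<in> T"
    using chart_surj[OF N k chart_ring_mult[OF a gchart]] by blast
  have "germ p - q \<in> T" using T_add[OF p(2) t] by simp
  with p(1) show ?thesis by blast
qed

end

definition chart_index :: "ppoint \<Rightarrow> 4" where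
  "chart_index x = (SOME j. rep x j \<noteq> 0)"

lemma chart_at_point:
  assumes "homogeneous (int d) f" "d > 0" "x \<in> sing_locus f"
  shows "chart f d (rep x) (chart_index x)"
proof
  have "\<exists>j. rep x j \<noteq> 0" using rep_nonzero[OF sing_locus_P3[OF assms(3)]] by (auto simp: fun_eq_iff)
  then show "rep x (chart_index x) \<noteq> 0" unfolding chart_index_def by (rule someI_ex)
qed (use assms in auto)

definition germ_at :: "ppoint \<Rightarrow> poly4 \<Rightarrow> poly4 fract" where
  "germ_at x p = to_fract (local_equation p (chart_index x) (rep x))"

definition T_at :: "poly4 \<Rightarrow> ppoint \<Rightarrow> poly4 fract set" where
  "T_at f x = tjurina_ideal (chart_index x) (local_equation f (chart_index x) (rep x))"

abbreviation "qdimQ \<equiv> qdim (\<lambda>c (q :: poly4 fract). Fract (Const c) 1 * q)"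

lemma tjurina_eq: "tjurina f x = quot_dim (\<lambda>c q. Fract (Const c) 1 * q) (local_ring (chart_index x)) (T_at f x)"
  by (simp add: tjurina_def T_at_def chart_index_def rep_def Let_def)

section \<open>Comparing forms with their germs at all singular points\<close>

context
  fixes f :: poly4 and d :: nat
  assumes f: "homogeneous (int d) f" and d: "d > 0" and fin: "finite (sing_locus f)"
begin

lemma germ_at_eq: "x \<in> sing_locus f \<Longrightarrow> germ_at x = chart.germ (rep x) (chart_index x)"
  and T_at_eq: "x \<in> sing_locus f \<Longrightarrow> T_at f x = chart.T f (rep x) (chart_index x)"
proof -
  assume "x \<in> sing_locus f"
  then interpret chart f d "rep x" "chart_index x" by (rule chart_at_point[OF f d])
  show "germ_at x = germ" by (simp add: fun_eq_iff germ_at_def germ_def loc_def)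
  show "T_at f x = T" by (simp add: T_at_def T_def loc_def)
qed

text \<open>Vanishing at another point \<open>t\<close> does not yet put the germ of
  \<open>h x\<close> into the Tjurina ideal. But \<open>h x * h t\<close> vanishes at every singular
  point, so a power of it lies in the Jacobian ideal, and there \<open>h t\<close> can be cancelled
  as a unit at \<open>t\<close>.\<close>

lemma isolating_germ:
  assumes x: "x \<in> sing_locus f"
  obtains g e where "homogeneous (int e) g" "peval (rep x) g \<noteq> 0" "\<And>t. t \<in> sing_locus f - {x} \<Longrightarrow> germ_at t g \<in> T_at f t"
proof -
  let ?S = "sing_locus f" and ?n = "card (sing_locus f) - 1"
  have P: "?S \<subseteq> P3" using sing_locus_P3 by blast
  have "\<forall>t\<in>?S. \<exists>h. homogeneous (int ?n) h \<and> peval (rep t) h \<noteq> 0 \<and> (\<forall>u\<in>?S - {t}. peval (rep u) h = 0)"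
    using isolating_form[OF fin P] by blast
  then obtain h where h: "\<And>t. t \<in> ?S \<Longrightarrow> homogeneous (int ?n) (h t)" "\<And>t. t \<in> ?S \<Longrightarrow> peval (rep t) (h t) \<noteq> 0"
    "\<And>t u. t \<in> ?S \<Longrightarrow> u \<in> ?S - {t} \<Longrightarrow> peval (rep u) (h t) = 0" by metis
  have "\<exists>N. germ_at t (h x ^ N) \<in> T_at f t" if t: "t \<in> ?S - {x}" for t
  proof -
    have tS: "t \<in> ?S" using t by blast
    interpret chart f d "rep t" "chart_index t" by (rule chart_at_point[OF f d tS])
    \<comment> \<open>The Nullstellensatz requires positive degree; the isolating forms have it
      because at least two singular points exist here.\<close>
    have "card {x, t} \<le> card ?S" using x tS by (intro card_mono fin) auto
    moreover have "card {x, t} = 2" using t by (auto simp: card_insert_if)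
    ultimately have n: "?n > 0" by simp
    have hh: "homogeneous (int (?n + ?n)) (h x * h t)" using homogeneous_mult[OF h(1)[OF x] h(1)[OF tS]] by simp
    have van: "peval (rep u) (h x * h t) = 0" if "u \<in> ?S" for u
      using h(3)[OF x, of u] h(3)[OF tS, of u] t that by (auto simp: peval.hom_mult)
    obtain N where "(h x * h t) ^ N \<in> jacobian_ideal f"
      by (rule form_power_mem_jacobian[OF f d hh _ van]) (use n in auto)
    then have "germ ((h t * h x) ^ N) \<in> T" using germ_jacobian by (simp add: mult.commute)
    then have "germ (h t) ^ N * germ (h x ^ N) \<in> T" by (simp add: germ.hom_power germ.hom_mult power_mult_distrib)
    then have "germ (h x ^ N) \<in> T" using T_unit_cancel_power h(2)[OF tS] by blast
    then show ?thesis using germ_at_eq[OF tS] T_at_eq[OF tS] by auto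
  qed
  then obtain N where N: "\<And>t. t \<in> ?S - {x} \<Longrightarrow> germ_at t (h x ^ N t) \<in> T_at f t" by metis
  let ?M = "\<Sum>t\<in>?S - {x}. N t"
  have "germ_at t (h x ^ ?M) \<in> T_at f t" if t: "t \<in> ?S - {x}" for t
  proof -
    have tS: "t \<in> ?S" using t by blast
    interpret chart f d "rep t" "chart_index t" by (rule chart_at_point[OF f d tS])
    have "N t \<le> ?M" using t fin by (intro member_le_sum) auto
    then have "h x ^ ?M = h x ^ (?M - N t) * h x ^ N t" by (simp flip: power_add)
    then have "germ (h x ^ ?M) = germ (h x ^ (?M - N t)) * germ (h x ^ N t)" by (simp only: germ.hom_mult)
    then show ?thesis using N[OF t] T_mult[OF germ_local_ring] unfolding germ_at_eq[OF tS] T_at_eq[OF tS] by simp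
  qed
  moreover have "homogeneous (int (?M * ?n)) (h x ^ ?M)" using homogeneous_power[OF h(1)[OF x], of ?M] by simp
  moreover have "peval (rep x) (h x ^ ?M) \<noteq> 0" using h(2)[OF x] by (simp add: peval.hom_power)
  ultimately show ?thesis using that by blast
qed

text \<open>Multiply by the isolating form \<open>g\<close> a form representing \<open>q\<close>
  divided by the germ of \<open>g\<close>: the result has germ \<open>q\<close> at \<open>x\<close>
  and germs in the Tjurina ideals elsewhere.\<close>

lemma germs_surj:
  assumes x: "x \<in> sing_locus f"
  shows "\<exists>K. \<forall>k\<ge>K. \<forall>q\<in>local_ring (chart_index x). \<exists>p\<in>forms (int k). germ_at x p - q \<in> T_at f x \<and>
    (\<forall>t\<in>sing_locus f - {x}. germ_at t p \<in> T_at f t)"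
proof -
  interpret chart f d "rep x" "chart_index x" by (rule chart_at_point[OF f d x])
  obtain g e where g: "homogeneous (int e) g" "peval (rep x) g \<noteq> 0"
    "\<And>t. t \<in> sing_locus f - {x} \<Longrightarrow> germ_at t g \<in> T_at f t" using isolating_germ[OF x] by metis
  obtain N where N: "N > 0" "\<And>i. i \<noteq> chart_index x \<Longrightarrow> to_fract (Var i) ^ N \<in> T"
    using Var_power_mem_T[OF fin x refl] by metis
  show ?thesis
  proof (intro exI[of _ "e + 4 * N"] allI impI ballI)
    fix k q assume k: "e + 4 * N \<le> k" and q: "q \<in> local_ring (chart_index x)"
    have gi: "germ g \<noteq> 0" "inverse (germ g) \<in> local_ring (chart_index x)" using germ_unit[OF g(2)] by auto
    have k': "4 * N \<le> k - e" using k by simp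
    obtain p where p: "homogeneous (int (k - e)) p" "germ p - inverse (germ g) * q \<in> T"
      using local_surj[OF N(2,1) k' local_ring_mult[OF gi(2) q]] by auto
    have "germ (g * p) - q = germ g * (germ p - inverse (germ g) * q)"
      using gi(1) by (simp add: germ.hom_mult right_diff_distrib flip: mult.assoc)
    then have "germ (g * p) - q \<in> T" using T_mult[OF germ_local_ring p(2)] by simp
    moreover have "homogeneous (int k) (g * p)" using homogeneous_mult[OF g(1) p(1)] k by (simp add: of_nat_diff)
    moreover have "germ_at t (g * p) \<in> T_at f t" if t: "t \<in> sing_locus f - {x}" for t
    proof -
      have tS: "t \<in> sing_locus f" using t by blast
      interpret t: chart f d "rep t" "chart_index t" by (rule chart_at_point[OF f d tS])
      show ?thesis using g(3)[OF t] t.T_mult[OF t.germ_local_ring, of "t.germ g" p]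
        unfolding germ_at_eq[OF tS] T_at_eq[OF tS] t.germ.hom_mult by (simp add: mult.commute)
    qed
    ultimately show "\<exists>p\<in>forms (int k). germ_at x p - q \<in> T_at f x \<and> (\<forall>t\<in>sing_locus f - {x}. germ_at t p \<in> T_at f t)"
      unfolding germ_at_eq[OF x] T_at_eq[OF x] by (intro bexI[of _ "g * p"]) auto
  qed
qed

text \<open>The Hilbert function is eventually nonincreasing, hence eventually constant, and then
  the surjective multiplication by \<open>l\<close> is also injective.\<close>

lemma HF_eventually_injective:
  obtains l K where "homogeneous 1 l" "\<And>s. s \<in> sing_locus f \<Longrightarrow> peval (rep s) l \<noteq> 0"
    "\<And>k p. k \<ge> K \<Longrightarrow> homogeneous (int k) p \<Longrightarrow> l * p \<in> jacobian_ideal f \<Longrightarrow> p \<in> jacobian_ideal f"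
proof -
  let ?J = "jacobian_ideal f"
  obtain l K where l: "homogeneous 1 l" "\<And>s. s \<in> sing_locus f \<Longrightarrow> peval (rep s) l \<noteq> 0"
    and K: "\<And>k. k \<ge> K \<Longrightarrow> HF (ideal_plus ?J l) k = 0" "\<And>k. k \<ge> K \<Longrightarrow> HF ?J (Suc k) \<le> HF ?J k"
    using finite_sing_locus_linear_form[OF f d fin] by metis
  have "decseq (\<lambda>k. HF ?J (K + k))" by (rule decseq_SucI) (use K(2) in simp)
  have "\<exists>m. \<forall>n. HF ?J (K + m) \<le> HF ?J (K + n)"
    using ex_has_least_nat[of "\<lambda>_. True" 0 "\<lambda>k. HF ?J (K + k)"] by auto
  then obtain m where m: "\<And>n. HF ?J (K + m) \<le> HF ?J (K + n)" by blast
  have const: "HF ?J (Suc k) = HF ?J k" if k: "k \<ge> K + m" for k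
  proof -
    have "HF ?J k \<le> HF ?J (K + m)"
      using \<open>decseq _\<close>[unfolded decseq_def, rule_format, of m "k - K"] k by simp
    moreover have "HF ?J (K + m) \<le> HF ?J (Suc k)" using m[of "Suc k - K"] k by simp
    moreover have "HF ?J (Suc k) \<le> HF ?J k" using K(2) k by simp
    ultimately show ?thesis by simp
  qed
  have "p \<in> ?J" if "k \<ge> K + m" "homogeneous (int k) p" "l * p \<in> ?J" for k p
    by (rule HF_Suc_eq_imp_injective[OF homog_ideal_jacobian[OF f] l(1) _ const[OF that(1)] that(2,3)]) (use K(1) that(1) in simp)
  with l that show ?thesis by blast
qed

text \<open>The colon ideal (J : p) has no projective zero: off the singular locus it contains a
  nonvanishing partial derivative, and at a singular point \<open>germ_mem_T_imp\<close> provides an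
  element. So it contains a power of \<open>l\<close>, which is cancelled by injectivity. The bound
  \<open>K\<close> does not depend on \<open>p\<close>.\<close>

lemma germs_kernel:
  "\<exists>K. \<forall>k\<ge>K. \<forall>p\<in>forms (int k). (\<forall>x\<in>sing_locus f. germ_at x p \<in> T_at f x) \<longrightarrow> p \<in> jacobian_ideal f"
proof -
  let ?J = "jacobian_ideal f"
  have iJ: "ideal4 ?J" by (rule ideal4_jacobian)
  obtain l K where l: "homogeneous 1 l" "\<And>s. s \<in> sing_locus f \<Longrightarrow> peval (rep s) l \<noteq> 0"
    and inj: "\<And>k p. k \<ge> K \<Longrightarrow> homogeneous (int k) p \<Longrightarrow> l * p \<in> ?J \<Longrightarrow> p \<in> ?J"
    using HF_eventually_injective by metis
  show ?thesis
  proof (intro exI[of _ K] allI impI ballI)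
    fix k p assume k: "K \<le> k" and "p \<in> forms (int k)" and germs: "\<forall>x\<in>sing_locus f. germ_at x p \<in> T_at f x"
    then have p: "homogeneous (int k) p" by simp
    define I where "I = {g. g * p \<in> ?J}"
    have I: "homog_ideal I" unfolding homog_ideal_def
    proof (intro conjI ballI allI)
      show "ideal4 I" unfolding ideal4_def I_def
        using ideal4D[OF iJ] by (auto simp: distrib_right mult.assoc)
      fix g i assume "g \<in> I"
      then have "hcomp (i + int k) (p * g) \<in> ?J"
        using homog_ideal_jacobian[OF f] by (simp add: I_def homog_ideal_def mult.commute)
      then show "hcomp i g \<in> I" unfolding hcomp_mult[OF p] by (simp add: I_def mult.commute)
    qed
    have "\<exists>g\<in>I. peval w g \<noteq> 0" if w: "w \<noteq> (\<lambda>_. 0)" for w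
    proof (rule ccontr)
      assume none: "\<not> ?thesis"
      have "pd i f \<in> I" for i using ideal4D(4)[OF iJ pd_mem_jacobian] by (simp add: I_def)
      then have "peval w (pd i f) = 0" for i using none by blast
      then have x: "proj_class w \<in> sing_locus f" (is "?x \<in> _") using proj_class_in_sing_locus[OF f d w] by blast
      interpret chart f d "rep ?x" "chart_index ?x" by (rule chart_at_point[OF f d x])
      have "germ p \<in> T" using germs x germ_at_eq[OF x] T_at_eq[OF x] by auto
      then obtain U m where U: "homogeneous m U" "peval (rep ?x) U \<noteq> 0" "U * p \<in> ?J" by (rule germ_mem_T_imp[OF p])
      have "U \<noteq> 0" using U(2) by auto
      then have m: "m = int (nat m)" using homogeneous_neg[OF U(1)] by force
      have "rep ?x \<in> ?x" by (rule rep_in[OF sing_locus_P3[OF x]])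
      then obtain c where "rep ?x = (\<lambda>i. c * w i)" by (auto simp: proj_class_def)
      then have "peval w U \<noteq> 0" using U(2) peval_scale[of "nat m" U c w] U(1) m by auto
      moreover have "U \<in> I" using U(3) by (simp add: I_def)
      ultimately show False using none by blast
    qed
    from projective_nullstellensatz[OF I this] obtain M where M: "\<And>k. k \<ge> 4 * M \<Longrightarrow> forms (int k) \<subseteq> I" by metis
    have "homogeneous (int (4 * M) * 1) (l ^ (4 * M))" by (rule homogeneous_power[OF l(1)])
    then have "l ^ (4 * M) \<in> I" using M[of "4 * M"] by auto
    then have lp: "l ^ (4 * M) * p \<in> ?J" by (simp add: I_def)
    have "l ^ n * p \<in> ?J \<Longrightarrow> p \<in> ?J" for n
    proof (induction n)
      case (Suc n)
      have "homogeneous (int (n + k)) (l ^ n * p)" using homogeneous_mult[OF homogeneous_power[OF l(1), of n] p] by simp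
      then have "l ^ n * p \<in> ?J" using inj[of "n + k" "l ^ n * p"] Suc.prems k by (simp add: mult.assoc)
      then show ?case by (rule Suc.IH)
    qed simp
    then show "p \<in> ?J" using lp by blast
  qed
qed

theorem HF_eq_total_tjurina:
  obtains K where "\<And>k. k \<ge> K \<Longrightarrow> HF (jacobian_ideal f) k = total_tjurina f"
proof -
  let ?J = "jacobian_ideal f" and ?S = "sing_locus f"
  obtain K0 where K0: "\<And>k p. k \<ge> K0 \<Longrightarrow> p \<in> forms (int k) \<Longrightarrow> (\<And>x. x \<in> ?S \<Longrightarrow> germ_at x p \<in> T_at f x) \<Longrightarrow> p \<in> ?J"
    using germs_kernel by blast
  obtain K1 where K1: "\<And>x k q. x \<in> ?S \<Longrightarrow> k \<ge> K1 x \<Longrightarrow> q \<in> local_ring (chart_index x) \<Longrightarrow>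
     \<exists>p\<in>forms (int k). germ_at x p - q \<in> T_at f x \<and> (\<forall>t\<in>?S - {x}. germ_at t p \<in> T_at f t)"
    using germs_surj by metis
  have "HF ?J k = total_tjurina f" if k: "k \<ge> K0 + (\<Sum>x\<in>?S. K1 x)" for k
  proof -
    let ?F = "forms (int k)"
    let ?K = "\<lambda>x. {p. germ_at x p \<in> T_at f x}"
    have kx: "k \<ge> K1 x" if "x \<in> ?S" for x
      using member_le_sum[of x ?S K1] that fin k by simp
    have sK: "S.subspace (?K x)" and lin: "cspace_linear (\<lambda>c p. Const c * p) (\<lambda>c q. Fract (Const c) 1 * q) (germ_at x)"
      and sT: "Q.subspace (T_at f x)" and gl: "\<And>p. germ_at x p \<in> local_ring (chart_index x)" if x: "x \<in> ?S" for x
    proof -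
      interpret chart f d "rep x" "chart_index x" by (rule chart_at_point[OF f d x])
      show "S.subspace (?K x)" unfolding germ_at_eq[OF x] T_at_eq[OF x] S.subspace_def
        using T_0 T_add T_mult[OF local_ring_Const] by (auto simp: germ.hom_add germ.hom_mult germ_Const)
      show "cspace_linear (\<lambda>c p. Const c * p) (\<lambda>c q. Fract (Const c) 1 * q) (germ_at x)"
        unfolding germ_at_eq[OF x] to_fract_def[symmetric]
        by unfold_locales (simp_all add: germ.hom_add germ.hom_mult germ_Const algebra_simps Const.hom_add Const.hom_mult)
      show "Q.subspace (T_at f x)" unfolding T_at_eq[OF x] by (rule subspace_T)
      show "germ_at x p \<in> local_ring (chart_index x)" for p unfolding germ_at_eq[OF x] by (rule germ_local_ring)
    qed
    have q: "qdim4 ?F (?F \<inter> ?K x) (tjurina f x)" if x: "x \<in> ?S" for x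
    proof -
      interpret L: cspace_linear "\<lambda>c p. Const c * p" "\<lambda>c q. Fract (Const c) 1 * q" "germ_at x" by (rule lin[OF x])
      have sFK: "S.subspace (?F \<inter> ?K x)" by (intro S.subspace_inter subspace_forms sK x)
      have iso: "qdim4 ?F (?F \<inter> ?K x) n \<longleftrightarrow> qdimQ (local_ring (chart_index x)) (T_at f x) n" for n
      proof (rule L.qdim_iso[OF subspace_forms sFK subspace_local_ring sT[OF x]])
        fix q assume "q \<in> local_ring (chart_index x)"
        then obtain p where p: "p \<in> ?F" "germ_at x p - q \<in> T_at f x" using K1[OF x kx[OF x]] by blast
        have "- (germ_at x p - q) \<in> T_at f x" by (rule Q.subspace_neg[OF sT[OF x] p(2)])
        then show "\<exists>p\<in>?F. q - germ_at x p \<in> T_at f x" using p(1) by auto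
      qed (use gl[OF x] in auto)
      \<comment> \<open>Forms have finite dimension, hence so does their quotient; transporting its
        basis shows that \<open>tjurina f x\<close> is the dimension of an actual basis.\<close>
      have "{0} \<subseteq> ?F \<inter> ?K x" using S.subspace_0[OF sFK] by blast
      then obtain n where n: "qdim4 ?F (?F \<inter> ?K x) n"
        using S.qdim_split[OF sFK S.subspace_single_0 subspace_forms _ _ qdim_forms] by blast
      then have "quot_dim (\<lambda>c q. Fract (Const c) 1 * q) (local_ring (chart_index x)) (T_at f x) = n"
        using iso by (intro Q.quot_dim_eq sT x) blast
      with n show ?thesis by (simp add: tjurina_eq)
    qed
    have "qdim4 ?F (?F \<inter> (\<Inter>x\<in>?S. ?K x)) (\<Sum>x\<in>?S. tjurina f x)"
    proof (rule S.qdim_crt[OF fin subspace_forms sK q])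
      fix x v assume x: "x \<in> ?S" and v: "v \<in> ?F"
      interpret L: cspace_linear "\<lambda>c p. Const c * p" "\<lambda>c q. Fract (Const c) 1 * q" "germ_at x" by (rule lin[OF x])
      obtain p where p: "p \<in> ?F" "germ_at x p - germ_at x v \<in> T_at f x" "\<forall>t\<in>?S - {x}. germ_at t p \<in> T_at f t"
        using K1[OF x kx[OF x] gl[OF x, of v]] by blast
      have "- (germ_at x p - germ_at x v) \<in> T_at f x" by (rule Q.subspace_neg[OF sT[OF x] p(2)])
      then have "germ_at x (v - p) \<in> T_at f x" by (simp add: L.g_diff)
      with p show "\<exists>u\<in>?F. v - u \<in> ?K x \<and> (\<forall>t\<in>?S - {x}. u \<in> ?K t)" by blast
    qed
    moreover have "?F \<inter> (\<Inter>x\<in>?S. ?K x) = ?J \<inter> ?F"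
    proof (intro equalityI subsetI)
      fix p assume "p \<in> ?F \<inter> (\<Inter>x\<in>?S. ?K x)"
      then show "p \<in> ?J \<inter> ?F" using K0[of k p] k by auto
    next
      fix p assume p: "p \<in> ?J \<inter> ?F"
      have "germ_at x p \<in> T_at f x" if x: "x \<in> ?S" for x
      proof -
        interpret chart f d "rep x" "chart_index x" by (rule chart_at_point[OF f d x])
        show ?thesis using germ_jacobian p unfolding germ_at_eq[OF x] T_at_eq[OF x] by blast
      qed
      with p show "p \<in> ?F \<inter> (\<Inter>x\<in>?S. ?K x)" by blast
    qed
    ultimately have "qdim4 ?F (?J \<inter> ?F) (total_tjurina f)" by (simp add: total_tjurina_def)
    then show ?thesis by (rule S.qdim_unique[OF subspace_ideal_forms[OF ideal4_jacobian] qdim_HF[OF ideal4_jacobian]])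
  qed
  then show ?thesis by (rule that)
qed

end

section \<open>The Koszul complex of the gradient\<close>

lemma lookup_mult_0: "lookup (p * q :: poly4) 0 = lookup p 0 * lookup q 0"
  by (simp add: peval.hom_mult flip: peval_zero)

lemma monomial_ideal_split:
  assumes "finite I" "\<And>m. m \<in> keys u \<Longrightarrow> \<exists>i\<in>I. N \<le> lookup m i"
  shows "\<exists>b. u = (\<Sum>i\<in>I. Var i ^ N * b i)"
  using assms
proof (induction I arbitrary: u rule: finite_induct)
  case empty
  then have "keys u = {}" by blast
  then show ?case by simp
next
  case (insert i I)
  let ?A = "{m\<in>keys u. N \<le> lookup m i}"
  define v where "v = (\<Sum>m\<in>keys u - ?A. single m (lookup u m))"
  have kv: "keys v \<subseteq> keys u - ?A"
    unfolding v_def by (rule order_trans[OF keys_sum]) (auto split: if_splits)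
  have "\<exists>j\<in>I. N \<le> lookup m j" if "m \<in> keys v" for m
    using insert.prems[of m] kv that by auto
  then obtain b where b: "v = (\<Sum>j\<in>I. Var j ^ N * b j)" using insert.IH by blast
  have "single m c = Var i ^ N * single (m - single i N) c" if "N \<le> lookup m i" for m :: monom4 and c
  proof -
    have "m = single i N + (m - single i N)"
      using that by (intro poly_mapping_eqI) (auto simp: lookup_add lookup_minus lookup_single when_def)
    then show ?thesis by (simp add: Var_power mult_single)
  qed
  then have "(\<Sum>m\<in>?A. single m (lookup u m)) = Var i ^ N * (\<Sum>m\<in>?A. single (m - single i N) (lookup u m))"
    unfolding sum_distrib_left by (intro sum.cong) auto
  moreover have "u = (\<Sum>m\<in>?A. single m (lookup u m)) + v"
    unfolding v_def using sum.subset_diff[of ?A "keys u" "\<lambda>m. single m (lookup u m)"] sum_singles[of u] by (simp add: add.commute)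
  ultimately have "u = Var i ^ N * (\<Sum>m\<in>?A. single (m - single i N) (lookup u m)) + (\<Sum>j\<in>I. Var j ^ N * b j)"
    using b by simp
  also have "(\<Sum>j\<in>I. Var j ^ N * b j) = (\<Sum>j\<in>I. Var j ^ N * (if j = i then (\<Sum>m\<in>?A. single (m - single i N) (lookup u m)) else b j))"
    using insert by (intro sum.cong) auto
  finally have "u = (\<Sum>j\<in>insert i I. Var j ^ N * (if j = i then (\<Sum>m\<in>?A. single (m - single i N) (lookup u m)) else b j))"
    using insert by simp
  then show ?case by (rule exI[of _ "\<lambda>j. if j = i then (\<Sum>m\<in>?A. single (m - single i N) (lookup u m)) else b j"])
qed

text \<open>Membership in a monomial ideal is decided monomial by monomial, and multiplication by a
  power of x_l leaves the exponents of the other variables unchanged. The powers of the variables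
  therefore form a regular sequence.\<close>

lemma Var_powers_regular:
  assumes fin: "finite I" and l: "l \<notin> I" and eq: "Var l ^ N * u = (\<Sum>i\<in>I. Var i ^ N * a i)"
  shows "\<exists>b. u = (\<Sum>i\<in>I. Var i ^ N * b i)"
proof (rule monomial_ideal_split[OF fin])
  fix m assume m: "m \<in> keys u"
  have sh: "lookup (single n 1 * p) (n + m) = lookup p m" for n m :: monom4 and p :: poly4
  proof -
    have "single n 1 * p = single n 1 * (\<Sum>k\<in>keys p. single k (lookup p k))" by (simp only: sum_singles)
    also have "\<dots> = (\<Sum>k\<in>keys p. single (n + k) (lookup p k))" by (simp add: sum_distrib_left mult_single)
    finally have "lookup (single n 1 * p) (n + m) = (\<Sum>k\<in>keys p. if k = m then lookup p k else 0)"
      by (simp add: lookup_sum lookup_single when_def)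
    then show ?thesis by (simp add: in_keys_iff)
  qed
  have "lookup (Var l ^ N * u) (single l N + m) \<noteq> 0" using m unfolding Var_power sh by (simp add: in_keys_iff)
  then have "single l N + m \<in> keys (\<Sum>i\<in>I. Var i ^ N * a i)" unfolding eq by (simp add: in_keys_iff)
  from subsetD[OF keys_sum this] obtain i where i: "i \<in> I" "single l N + m \<in> keys (Var i ^ N * a i)" by (rule UN_E)
  from subsetD[OF keys_mult i(2)] obtain k where "single l N + m = single i N + k" unfolding Var_power by auto
  then have "lookup (single l N + m) i = lookup (single i N + k) i" by simp
  moreover have "l \<noteq> i" using i(1) l by blast
  ultimately have "N \<le> lookup m i" by (simp add: lookup_add lookup_single)
  then show "\<exists>i\<in>I. N \<le> lookup m i" using i(1) by blast
qed

text \<open>The bases of the second and third exterior powers are ordered lexicographically: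
  \<open>01, 02, 03, 12, 13, 23\<close> and \<open>012, 013, 023, 123\<close>.\<close>

definition koszul1 :: "(nat \<Rightarrow> 'a::comm_ring_1) \<Rightarrow> (nat \<Rightarrow> 'a) \<Rightarrow> 'a" where
  "koszul1 g z = g 0 * z 0 + g 1 * z 1 + g 2 * z 2 + g 3 * z 3"

definition koszul2 :: "(nat \<Rightarrow> 'a::comm_ring_1) \<Rightarrow> (nat \<Rightarrow> 'a) \<Rightarrow> nat \<Rightarrow> 'a" where
  "koszul2 g b i = (if i = 0 then - g 1 * b 0 - g 2 * b 1 - g 3 * b 2
    else if i = 1 then g 0 * b 0 - g 2 * b 3 - g 3 * b 4
    else if i = 2 then g 0 * b 1 + g 1 * b 3 - g 3 * b 5
    else if i = 3 then g 0 * b 2 + g 1 * b 4 + g 2 * b 5 else 0)"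

definition koszul3 :: "(nat \<Rightarrow> 'a::comm_ring_1) \<Rightarrow> (nat \<Rightarrow> 'a) \<Rightarrow> nat \<Rightarrow> 'a" where
  "koszul3 g c i = (if i = 0 then g 2 * c 0 + g 3 * c 1
    else if i = 1 then - g 1 * c 0 + g 3 * c 2
    else if i = 2 then - g 1 * c 1 - g 2 * c 2
    else if i = 3 then g 0 * c 0 + g 3 * c 3
    else if i = 4 then g 0 * c 1 - g 2 * c 3
    else if i = 5 then g 0 * c 2 + g 1 * c 3 else 0)"

definition koszul4 :: "(nat \<Rightarrow> 'a::comm_ring_1) \<Rightarrow> 'a \<Rightarrow> nat \<Rightarrow> 'a" where
  "koszul4 g u i = (if i = 0 then - g 3 * u else if i = 1 then g 2 * u
    else if i = 2 then - g 1 * u else if i = 3 then g 0 * u else 0)"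

text \<open>Left exterior multiplication by the vector \<open>a\<close>, in the bases fixed above;
  \<open>wedge2\<close> and \<open>wedge3\<close> continue it to the next exterior powers.\<close>

definition wedge1 :: "(nat \<Rightarrow> 'a::comm_ring_1) \<Rightarrow> (nat \<Rightarrow> 'a) \<Rightarrow> nat \<Rightarrow> 'a" where
  "wedge1 a z i = (if i = 0 then a 0 * z 1 - a 1 * z 0
    else if i = 1 then a 0 * z 2 - a 2 * z 0
    else if i = 2 then a 0 * z 3 - a 3 * z 0
    else if i = 3 then a 1 * z 2 - a 2 * z 1
    else if i = 4 then a 1 * z 3 - a 3 * z 1
    else if i = 5 then a 2 * z 3 - a 3 * z 2 else 0)"

definition wedge2 :: "(nat \<Rightarrow> 'a::comm_ring_1) \<Rightarrow> (nat \<Rightarrow> 'a) \<Rightarrow> nat \<Rightarrow> 'a" where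
  "wedge2 a b i = (if i = 0 then a 0 * b 3 - a 1 * b 1 + a 2 * b 0
    else if i = 1 then a 0 * b 4 - a 1 * b 2 + a 3 * b 0
    else if i = 2 then a 0 * b 5 - a 2 * b 2 + a 3 * b 1
    else if i = 3 then a 1 * b 5 - a 2 * b 4 + a 3 * b 3 else 0)"

definition wedge3 :: "(nat \<Rightarrow> 'a::comm_ring_1) \<Rightarrow> (nat \<Rightarrow> 'a) \<Rightarrow> 'a" where
  "wedge3 a c = a 0 * c 3 - a 1 * c 2 + a 2 * c 1 - a 3 * c 0"

lemma koszul2_wedge1: "i < 4 \<Longrightarrow> koszul2 g (wedge1 a z) i = koszul1 g a * z i - koszul1 g z * a i"
  by (auto simp: koszul2_def wedge1_def koszul1_def algebra_simps numeral_eq_Suc less_Suc_eq)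

lemma koszul3_wedge2: "i < 6 \<Longrightarrow> koszul3 g (wedge2 a b) i = koszul1 g a * b i - wedge1 a (koszul2 g b) i"
  by (auto simp: koszul3_def koszul2_def wedge2_def wedge1_def koszul1_def algebra_simps numeral_eq_Suc less_Suc_eq)

lemma koszul4_wedge3: "i < 4 \<Longrightarrow> koszul4 g (wedge3 a c) i = koszul1 g a * c i - wedge2 a (koszul3 g c) i"
  by (auto simp: koszul4_def koszul3_def wedge3_def wedge2_def koszul1_def algebra_simps numeral_eq_Suc less_Suc_eq)

lemma wedge3_koszul4: "wedge3 a (koszul4 g u) = koszul1 g a * u"
  by (simp add: koszul4_def wedge3_def koszul1_def algebra_simps)

lemma koszul3_koszul4: "koszul3 g (koszul4 g u) = (\<lambda>_. 0)"
  by (auto simp: koszul4_def koszul3_def fun_eq_iff algebra_simps)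

lemma koszul2_koszul3: "koszul2 g (koszul3 g c) = (\<lambda>_. 0)"
  by (auto simp: koszul2_def koszul3_def fun_eq_iff algebra_simps)

lemma koszul1_koszul2: "koszul1 g (koszul2 g b) = 0"
  by (simp add: koszul1_def koszul2_def algebra_simps)

lemma koszul2_lin: "koszul2 g (\<lambda>i. p * v i + q * w i) i = p * koszul2 g v i + q * koszul2 g w i"
  and koszul3_lin: "koszul3 g (\<lambda>i. p * v i + q * w i) i = p * koszul3 g v i + q * koszul3 g w i"
  and koszul4_lin: "koszul4 g (p * s + q * t) i = p * koszul4 g s i + q * koszul4 g t i"
  and wedge1_lin: "wedge1 a (\<lambda>i. p * v i + q * w i) i = p * wedge1 a v i + q * wedge1 a w i"
  and wedge2_lin: "wedge2 a (\<lambda>i. p * v i + q * w i) i = p * wedge2 a v i + q * wedge2 a w i"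
  and wedge3_lin: "wedge3 a (\<lambda>i. p * v i + q * w i) = p * wedge3 a v + q * wedge3 a w"
  by (simp_all add: koszul2_def koszul3_def koszul4_def wedge1_def wedge2_def wedge3_def algebra_simps)

lemma koszul_cong:
  "(\<And>i. i < 6 \<Longrightarrow> b i = b' i) \<Longrightarrow> koszul2 g b = koszul2 g b'"
  "(\<And>i. i < 4 \<Longrightarrow> c i = c' i) \<Longrightarrow> koszul3 g c = koszul3 g c'"
  by (auto simp: koszul2_def koszul3_def fun_eq_iff)

lemma wedge_cong:
  "(\<And>i. i < 4 \<Longrightarrow> z i = z' i) \<Longrightarrow> wedge1 a z = wedge1 a z'"
  "(\<And>i. i < 6 \<Longrightarrow> b i = b' i) \<Longrightarrow> wedge2 a b = wedge2 a b'"
  "(\<And>i. i < 4 \<Longrightarrow> c i = c' i) \<Longrightarrow> wedge3 a c = wedge3 a c'"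
  by (auto simp: wedge1_def wedge2_def wedge3_def fun_eq_iff)

text \<open>Exactness holds because the ideal generated by \<open>g\<close> contains a regular sequence \<open>h\<^sub>0, \<dots>, h\<^sub>3\<close> of
  length four: with \<open>\<delta>\<close> the differential and \<open>h\<^sub>i = \<delta>(a\<^sub>i)\<close>, one has \<open>\<delta>(a\<^sub>i \<and> z) = h\<^sub>i z - a\<^sub>i \<and> \<delta>(z)\<close>, and a
  cycle \<open>z\<close> is traced through the iterated products \<open>a\<^sub>i \<and> a\<^sub>j \<and> \<dots> \<and> z\<close> and back.\<close>

locale koszul_exact =
  fixes g h :: "nat \<Rightarrow> 'a::idom" and a :: "nat \<Rightarrow> nat \<Rightarrow> 'a"
  assumes h: "\<And>i. i < 4 \<Longrightarrow> koszul1 g (a i) = h i" and h0: "h 0 \<noteq> 0"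
    and reg1: "\<And>u x. h 1 * u = h 0 * x \<Longrightarrow> \<exists>y. u = h 0 * y"
    and reg2: "\<And>u x x'. h 2 * u = h 0 * x + h 1 * x' \<Longrightarrow> \<exists>y y'. u = h 0 * y + h 1 * y'"
    and reg3: "\<And>u x x' x''. h 3 * u = h 0 * x + h 1 * x' + h 2 * x'' \<Longrightarrow> \<exists>y y' y''. u = h 0 * y + h 1 * y' + h 2 * y''"
begin

lemma koszul3_exact:
  assumes z: "\<And>i. i < 4 \<Longrightarrow> koszul2 g z i = 0"
  obtains c where "\<And>i. i < 6 \<Longrightarrow> z i = koszul3 g c i"
proof -
  define y where "y i = wedge2 (a i) z" for i
  define w where "w i j = wedge3 (a i) (y j)" for i j
  have w10: "wedge1 x (koszul2 g z) k = 0" for x k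
    using wedge_cong(1)[of "koszul2 g z" "\<lambda>_. 0" x] z by (simp add: wedge1_def)
  have dy: "koszul3 g (y i) k = h i * z k" if "i < 4" "k < 6" for i k
    unfolding y_def koszul3_wedge2[OF that(2)] h[OF that(1)] w10 by simp
  have wy: "wedge2 x (koszul3 g (y i)) k = h i * wedge2 x z k" if "i < 4" for x i k
  proof -
    have "wedge2 x (koszul3 g (y i)) = wedge2 x (\<lambda>k. h i * z k + 0 * z k)"
      by (rule wedge_cong) (simp add: dy[OF that])
    then show ?thesis unfolding wedge2_lin fun_eq_iff by simp
  qed
  have dw: "koszul4 g (w i j) k = h i * y j k - h j * y i k" if "i < 4" "j < 4" "k < 4" for i j k
    unfolding w_def koszul4_wedge3[OF that(3)] h[OF that(1)] wy[OF that(2)] by (simp add: y_def)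
  \<comment> \<open>\<open>w 0 1\<close> lies in the top exterior power. Wedging its boundary with
    \<open>a 2\<close> recovers \<open>h 2 * w 0 1\<close>, which lands in the ideal of
    \<open>h 0\<close> and \<open>h 1\<close>; regularity then splits \<open>w 0 1\<close>.\<close>
  have "h 2 * w 0 1 = wedge3 (a 2) (koszul4 g (w 0 1))" by (simp add: wedge3_koszul4 h)
  also have "\<dots> = wedge3 (a 2) (\<lambda>k. h 0 * y 1 k + (- h 1) * y 0 k)"
    by (rule wedge_cong) (simp add: dw)
  also have "\<dots> = h 0 * w 2 1 + h 1 * (- w 2 0)" unfolding wedge3_lin by (simp add: w_def)
  finally obtain p q where pq: "w 0 1 = h 0 * p + h 1 * q" using reg2 by blast
  \<comment> \<open>Subtracting boundaries from \<open>y 0\<close> and \<open>y 1\<close> makes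
    their relation divisible by \<open>h 0\<close>, while the Koszul differential of both is
    unchanged.\<close>
  have eq: "h 1 * (y 0 k + koszul4 g q k) = h 0 * (y 1 k - koszul4 g p k)" if "k < 4" for k
  proof -
    have "h 0 * y 1 k - h 1 * y 0 k = h 0 * koszul4 g p k + h 1 * koszul4 g q k"
      using dw[of 0 1 k] that unfolding pq koszul4_lin by simp
    then show ?thesis by (simp add: algebra_simps)
  qed
  then have "\<forall>k. \<exists>c. k < 4 \<longrightarrow> y 0 k + koszul4 g q k = h 0 * c" using reg1 by blast
  then obtain c where c: "\<And>k. k < 4 \<Longrightarrow> y 0 k + koszul4 g q k = h 0 * c k" by metis
  \<comment> \<open>The differential of \<open>h 0 * c\<close> is that of \<open>y 0\<close>, namely
    \<open>h 0 * z\<close>; cancelling \<open>h 0\<close> gives a primitive of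
    \<open>z\<close>.\<close>
  have "z i = koszul3 g c i" if i: "i < 6" for i
  proof -
    have "h 0 * koszul3 g c i = koszul3 g (\<lambda>k. h 0 * c k + 0 * c k) i" unfolding koszul3_lin by simp
    also have "koszul3 g (\<lambda>k. h 0 * c k + 0 * c k) = koszul3 g (\<lambda>k. 1 * y 0 k + 1 * koszul4 g q k)"
      by (rule koszul_cong) (simp add: c)
    also have "koszul3 g (\<lambda>k. 1 * y 0 k + 1 * koszul4 g q k) i = h 0 * z i"
      unfolding koszul3_lin koszul3_koszul4 using dy[of 0 i] i by simp
    finally show ?thesis using h0 by simp
  qed
  then show ?thesis by (rule that)
qed

lemma koszul2_exact:
  assumes z: "koszul1 g z = 0"
  obtains b where "\<And>i. i < 4 \<Longrightarrow> z i = koszul2 g b i"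
proof -
  define y where "y i = wedge1 (a i) z" for i
  define w where "w i j = wedge2 (a i) (y j)" for i j
  define u where "u i j k = wedge3 (a i) (w j k)" for i j k
  have dy: "koszul2 g (y i) k = h i * z k" if "i < 4" "k < 4" for i k
    unfolding y_def koszul2_wedge1[OF that(2)] h[OF that(1)] z by simp
  have wy: "wedge1 x (koszul2 g (y i)) k = h i * wedge1 x z k" if "i < 4" for x i k
  proof -
    have "wedge1 x (koszul2 g (y i)) = wedge1 x (\<lambda>k. h i * z k + 0 * z k)"
      by (rule wedge_cong) (simp add: dy[OF that])
    then show ?thesis unfolding wedge1_lin fun_eq_iff by simp
  qed
  have dw: "koszul3 g (w i j) k = h i * y j k - h j * y i k" if "i < 4" "j < 4" "k < 6" for i j k
    unfolding w_def koszul3_wedge2[OF that(3)] h[OF that(1)] wy[OF that(2)] by (simp add: y_def)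
  have ww: "wedge2 x (koszul3 g (w i j)) k = h i * wedge2 x (y j) k - h j * wedge2 x (y i) k" if "i < 4" "j < 4" for x i j k
  proof -
    have "wedge2 x (koszul3 g (w i j)) = wedge2 x (\<lambda>k. h i * y j k + (- h j) * y i k)"
      by (rule wedge_cong) (simp add: dw[OF that])
    then show ?thesis unfolding wedge2_lin fun_eq_iff by simp
  qed
  have du: "koszul4 g (u i j k) m = h i * w j k m - h j * w i k m + h k * w i j m" if "i < 4" "j < 4" "k < 4" "m < 4" for i j k m
    unfolding u_def koszul4_wedge3[OF that(4)] h[OF that(1)] ww[OF that(2,3)] by (simp add: w_def)
  \<comment> \<open>One degree lower the triple products reach the top exterior power, so the
    descent uses all four \<open>h i\<close>: first regularity of \<open>h 3\<close>, then of
    \<open>h 2\<close> and \<open>h 1\<close>.\<close>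
  have "h 3 * u 0 1 2 = wedge3 (a 3) (koszul4 g (u 0 1 2))" by (simp add: wedge3_koszul4 h)
  also have "\<dots> = wedge3 (a 3) (\<lambda>m. 1 * (h 0 * w 1 2 m + (- h 1) * w 0 2 m) + h 2 * w 0 1 m)"
    by (rule wedge_cong) (simp add: du)
  also have "\<dots> = h 0 * u 3 1 2 + h 1 * (- u 3 0 2) + h 2 * u 3 0 1" unfolding wedge3_lin by (simp add: u_def)
  finally obtain p q r where pqr: "u 0 1 2 = h 0 * p + h 1 * q + h 2 * r" using reg3 by blast
  have "h 2 * (w 0 1 m - koszul4 g r m) = h 0 * (koszul4 g p m - w 1 2 m) + h 1 * (koszul4 g q m + w 0 2 m)" if "m < 4" for m
  proof -
    have "koszul4 g (u 0 1 2) m = koszul4 g (1 * (h 0 * p + h 1 * q) + h 2 * r) m" by (simp only: pqr mult_1_left)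
    then have "h 0 * w 1 2 m - h 1 * w 0 2 m + h 2 * w 0 1 m = h 0 * koszul4 g p m + h 1 * koszul4 g q m + h 2 * koszul4 g r m"
      using du[of 0 1 2 m] that unfolding koszul4_lin by simp
    then show ?thesis by (simp add: algebra_simps)
  qed
  then have "\<forall>m. \<exists>s t. m < 4 \<longrightarrow> w 0 1 m - koszul4 g r m = h 0 * s + h 1 * t" using reg2 by blast
  then obtain s t where st: "\<And>m. m < 4 \<Longrightarrow> w 0 1 m - koszul4 g r m = h 0 * s m + h 1 * t m" by metis
  have "h 1 * (y 0 k + koszul3 g t k) = h 0 * (y 1 k - koszul3 g s k)" if "k < 6" for k
  proof -
    have "koszul3 g (\<lambda>m. 1 * w 0 1 m + (- 1) * koszul4 g r m) = koszul3 g (\<lambda>m. h 0 * s m + h 1 * t m)"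
      by (rule koszul_cong) (use st in simp)
    then have "koszul3 g (\<lambda>m. 1 * w 0 1 m + (- 1) * koszul4 g r m) k = koszul3 g (\<lambda>m. h 0 * s m + h 1 * t m) k"
      by simp
    then show ?thesis unfolding koszul3_lin koszul3_koszul4 using dw[of 0 1 k] that by (simp add: algebra_simps)
  qed
  then have "\<forall>k. \<exists>c. k < 6 \<longrightarrow> y 0 k + koszul3 g t k = h 0 * c" using reg1 by blast
  then obtain c where c: "\<And>k. k < 6 \<Longrightarrow> y 0 k + koszul3 g t k = h 0 * c k" by metis
  have "z i = koszul2 g c i" if i: "i < 4" for i
  proof -
    have "h 0 * koszul2 g c i = koszul2 g (\<lambda>k. h 0 * c k + 0 * c k) i" unfolding koszul2_lin by simp
    also have "koszul2 g (\<lambda>k. h 0 * c k + 0 * c k) = koszul2 g (\<lambda>k. 1 * y 0 k + 1 * koszul3 g t k)"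
      by (rule koszul_cong) (simp add: c)
    also have "koszul2 g (\<lambda>k. 1 * y 0 k + 1 * koszul3 g t k) i = h 0 * z i"
      unfolding koszul2_lin koszul2_koszul3 using dy[of 0 i] i by simp
    finally show ?thesis using h0 by simp
  qed
  then show ?thesis by (rule that)
qed

end

text \<open>Powers of the four variables serve as the regular sequence; their expressions through
  the partial derivatives supply the vectors \<open>a\<close>.\<close>

lemma koszul_exact_gradient:
  assumes N: "\<And>i. Var i ^ N \<in> jacobian_ideal f"
  obtains a where "koszul_exact (\<lambda>i. pd (of_nat i) f) (\<lambda>i. Var (of_nat i) ^ N) a"
proof -
  have "\<exists>a. Var i ^ N = koszul1 (\<lambda>i. pd (of_nat i) f) a" for i
  proof -
    obtain a where "Var i ^ N = (\<Sum>i\<in>UNIV. a i * pd i f)" using N[of i] unfolding jacobian_ideal_iff by blast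
    then have "Var i ^ N = koszul1 (\<lambda>i. pd (of_nat i) f) (\<lambda>i. a (of_nat i))"
      by (simp add: sum_UNIV_4 koszul1_def mult.commute)
    then show ?thesis by blast
  qed
  then obtain a where a: "\<And>i. Var i ^ N = koszul1 (\<lambda>i. pd (of_nat i) f) (a i)" by metis
  have ne: "(1 :: 4) \<noteq> 0" "(2 :: 4) \<noteq> 0" "(2 :: 4) \<noteq> 1" "(3 :: 4) \<noteq> 0" "(3 :: 4) \<noteq> 1" "(3 :: 4) \<noteq> 2" by simp_all
  have "koszul_exact (\<lambda>i. pd (of_nat i) f) (\<lambda>i. Var (of_nat i) ^ N) (\<lambda>i. a (of_nat i))"
  proof
    show "Var (of_nat 0) ^ N \<noteq> 0"
    proof
      assume "Var (of_nat 0) ^ N = 0"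
      then have "peval (\<lambda>_. 1) (Var (of_nat 0) ^ N) = 0" by (simp only: peval.hom_zero)
      then show False by (simp add: peval.hom_power)
    qed
    fix u x x' x'' :: poly4
    {
      assume "Var (of_nat 1) ^ N * u = Var (of_nat 0) ^ N * x"
      then have "Var 1 ^ N * u = (\<Sum>i\<in>{0}. Var i ^ N * x)" by simp
      then show "\<exists>y. u = Var (of_nat 0) ^ N * y"
        using Var_powers_regular[of "{0}" 1 N u "\<lambda>_. x"] ne by auto
    next
      assume "Var (of_nat 2) ^ N * u = Var (of_nat 0) ^ N * x + Var (of_nat 1) ^ N * x'"
      then have "Var 2 ^ N * u = (\<Sum>i\<in>{0, 1}. Var i ^ N * (if i = 0 then x else x'))" using ne by simp
      then have "\<exists>b. u = (\<Sum>i\<in>{0, 1}. Var i ^ N * b i)" by (rule Var_powers_regular[rotated 2]) (use ne in auto)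
      then show "\<exists>y y'. u = Var (of_nat 0) ^ N * y + Var (of_nat 1) ^ N * y'" using ne by auto
    next
      assume "Var (of_nat 3) ^ N * u = Var (of_nat 0) ^ N * x + Var (of_nat 1) ^ N * x' + Var (of_nat 2) ^ N * x''"
      then have "Var 3 ^ N * u = (\<Sum>i\<in>{0, 1, 2}. Var i ^ N * (if i = 0 then x else if i = 1 then x' else x''))"
        using ne by (simp add: add.assoc)
      then have "\<exists>b. u = (\<Sum>i\<in>{0, 1, 2}. Var i ^ N * b i)" by (rule Var_powers_regular[rotated 2]) (use ne in auto)
      then obtain b where "u = (\<Sum>i\<in>{0, 1, 2}. Var i ^ N * b i)" by blast
      then have "u = Var 0 ^ N * b 0 + Var 1 ^ N * b 1 + Var 2 ^ N * b 2" using ne by (simp add: add.assoc)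
      then show "\<exists>y y' y''. u = Var (of_nat 0) ^ N * y + Var (of_nat 1) ^ N * y' + Var (of_nat 2) ^ N * y''" by auto
    }
  qed (simp add: a)
  then show ?thesis by (rule that)
qed

section \<open>Minimal resolutions of smooth surfaces\<close>

definition unit_fun :: "nat \<Rightarrow> nat \<Rightarrow> poly4" where "unit_fun l i = (if i = l then 1 else 0)"

lemma unit_fun_FM: "l < length ds \<Longrightarrow> unit_fun l \<in> FM ds (ds ! l)"
  by (auto simp: unit_fun_def FM_def)

lemma mapm_lincomb: "mapm A (\<lambda>i. \<Sum>l\<in>L. b l * c l i) = (\<lambda>i. \<Sum>l\<in>L. b l * mapm A (c l) i)"
proof
  fix i
  have "(\<Sum>j<dim_col A. A $$ (i, j) * (\<Sum>l\<in>L. b l * c l j)) = (\<Sum>j<dim_col A. \<Sum>l\<in>L. b l * (A $$ (i, j) * c l j))"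
    by (simp add: sum_distrib_left mult.left_commute)
  also have "\<dots> = (\<Sum>l\<in>L. b l * (\<Sum>j<dim_col A. A $$ (i, j) * c l j))"
    by (subst sum.swap) (simp add: sum_distrib_left)
  finally show "mapm A (\<lambda>i. \<Sum>l\<in>L. b l * c l i) i = (\<Sum>l\<in>L. b l * mapm A (c l) i)" by (simp add: mapm_def)
qed

lemma funs_eq_lincomb: "v \<in> funs n \<Longrightarrow> v = (\<lambda>i. \<Sum>l<n. v l * unit_fun l i)"
proof
  fix i assume v: "v \<in> funs n"
  have "(\<Sum>l<n. v l * unit_fun l i) = (\<Sum>l<n. if l = i then v i else 0)"
    by (rule sum.cong) (auto simp: unit_fun_def)
  then show "v i = (\<Sum>l<n. v l * unit_fun l i)" using v by (auto simp: funs_def)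
qed

text \<open>If \<open>ds ! i \<noteq> kk\<close>, the \<open>i\<close>-th generator is a combination of the \<open>\<kappa> l\<close>, and rewriting these in the given
  generators expresses it with an \<open>i\<close>-th coefficient in the maximal ideal, against minimality.\<close>
lemma generators_single_degree:
  assumes gA: "graded_mat es ds A"
    and min: "\<And>v i. v \<in> funs (length ds) \<Longrightarrow> mapm A v = 0 \<Longrightarrow> lookup (v i) 0 = 0"
    and k: "\<And>l. l < m \<Longrightarrow> \<kappa> l \<in> FM es kk" "\<And>l. l < m \<Longrightarrow> \<kappa> l \<in> mapm A ` funs (length ds)"
    and gen: "\<And>w. w \<in> mapm A ` funs (length ds) \<Longrightarrow> \<exists>b. w = (\<lambda>i. \<Sum>l<m. b l * \<kappa> l i)"
    and ind: "\<And>c. (\<lambda>i. \<Sum>l<m. Const (c l) * \<kappa> l i) = (\<lambda>_. 0) \<Longrightarrow> \<forall>l<m. c l = 0"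
  shows "length ds = m" "\<And>i. i < length ds \<Longrightarrow> ds ! i = kk"
proof -
  let ?p = "length ds"
  have "\<forall>l. \<exists>c. l < m \<longrightarrow> c \<in> FM ds kk \<and> \<kappa> l = mapm A c"
  proof (intro allI)
    fix l
    show "\<exists>c. l < m \<longrightarrow> c \<in> FM ds kk \<and> \<kappa> l = mapm A c"
    proof (cases "l < m")
      case True
      then obtain c where "\<kappa> l = mapm A c" using k(2) by blast
      then have "\<kappa> l = mapm A (hcompv ds kk c)" using hcompv_id[OF k(1)[OF True]] hcompv_mapm[OF gA, of kk c] by simp
      then show ?thesis using hcompv_in_FM by blast
    qed simp
  qed
  then obtain c where c: "\<And>l. l < m \<Longrightarrow> c l \<in> FM ds kk" "\<And>l. l < m \<Longrightarrow> \<kappa> l = mapm A (c l)" by metis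
  show deg: "ds ! i = kk" if i: "i < ?p" for i
  proof (rule ccontr)
    assume ne: "ds ! i \<noteq> kk"
    have ui: "unit_fun i \<in> funs ?p" using unit_fun_FM[OF i] FM_subset_funs by blast
    then obtain b where b: "mapm A (unit_fun i) = (\<lambda>n. \<Sum>l<m. b l * \<kappa> l n)" using gen by blast
    define v where "v n = (\<Sum>l<m. b l * c l n)" for n
    have "mapm A v = (\<lambda>n. \<Sum>l<m. b l * mapm A (c l) n)" unfolding v_def by (rule mapm_lincomb)
    also have "\<dots> = mapm A (unit_fun i)" unfolding b using c(2) by (intro ext sum.cong) auto
    finally have "mapm A (unit_fun i - v) = 0" by (simp add: mapm.g_diff)
    moreover have "unit_fun i - v \<in> funs ?p"
      using ui c(1) FM_subset_funs[of ds kk] by (auto simp: funs_def v_def FM_def)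
    ultimately have "lookup ((unit_fun i - v) i) 0 = 0" using min by blast
    then have "lookup (v i) 0 = 1" by (simp add: unit_fun_def lookup_minus)
    moreover have "lookup (c l i) 0 = 0" if "l < m" for l
      using c(1)[OF that] i ne by (intro homogeneous_pos_lookup_0[of "kk - ds ! i"]) (auto simp: FM_def)
    ultimately show False by (simp add: v_def lookup_sum lookup_mult_0)
  qed
  \<comment> \<open>With all generators in degree \<open>kk\<close>, the degree \<open>kk\<close>
    piece of the free module consists of constant vectors. By minimality none of them is a nonzero
    syzygy, so \<open>length ds\<close> is the dimension of the image.\<close>
  have ds: "ds = replicate ?p kk" using deg by (intro nth_equalityI) auto
  have "(\<Sum>x\<leftarrow>replicate n kk. dimS (kk - x)) = n" for n
    by (induction n) (simp_all add: dimS_def)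
  then have "(\<Sum>x\<leftarrow>ds. dimS (kk - x)) = ?p" by (metis ds)
  moreover have "qdimV (FM ds kk) {0} (\<Sum>x\<leftarrow>ds. dimS (kk - x))"
    by (rule qdim_FM) (use deg in \<open>auto simp: in_set_conv_nth\<close>)
  ultimately have q: "qdimV (FM ds kk) {0} ?p" by simp
  have "{v \<in> FM ds kk. mapm A v = 0} = {0}"
  proof safe
    fix v assume v: "v \<in> FM ds kk" "mapm A v = 0"
    show "v = 0"
    proof
      fix i show "v i = 0 i"
      proof (cases "i < ?p")
        case True
        then have "homogeneous 0 (v i)" using v(1) deg[OF True] by (auto simp: FM_def)
        moreover have "lookup (v i) 0 = 0" using min v FM_subset_funs by blast
        ultimately show ?thesis using homogeneous_zero_Const[of "v i"] by simp
      next
        case False then show ?thesis using v(1) by (simp add: FM_def)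
      qed
    qed
  qed (auto simp: FM_def)
  then have "qdimV {v \<in> FM ds kk. mapm A v = 0} {0} 0" using V.qdim_refl[OF subspace_V0] by simp
  then obtain n where n: "qdimV (mapm A ` FM ds kk) {0} n" "n + 0 = ?p"
    by (rule mapm.rank_nullity[OF subspace_FM q])
  have "qdimV (mapm A ` FM ds kk) {0} (card {..<m})"
  proof (rule V.qdim_familyI[where b = \<kappa>, OF subspace_V0])
    fix l assume "l \<in> {..<m}" then show "\<kappa> l \<in> mapm A ` FM ds kk" using c by auto
  next
    fix a assume "(\<Sum>l<m. (\<lambda>i. Const (a l) * \<kappa> l i)) \<in> {0}"
    moreover have "(\<Sum>l<m. (\<lambda>i. Const (a l) * \<kappa> l i)) = (\<lambda>i. \<Sum>l<m. Const (a l) * \<kappa> l i)"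
      by (induction m) (auto simp: fun_eq_iff)
    ultimately show "\<forall>l\<in>{..<m}. a l = 0" using ind[of a] by (auto simp: zero_fun_def)
  next
    fix w assume "w \<in> mapm A ` FM ds kk"
    then obtain v where v: "v \<in> FM ds kk" "w = mapm A v" by blast
    then have w: "w \<in> FM es kk" using mapm_FM[OF gA] by blast
    obtain b where b: "w = (\<lambda>i. \<Sum>l<m. b l * \<kappa> l i)" using gen v FM_subset_funs by blast
    \<comment> \<open>\<open>w\<close> and all \<open>\<kappa> l\<close> have the same degree, so
      only the constant terms of the coefficients \<open>b l\<close> contribute.\<close>
    have "w i = (\<Sum>l<m. Const (lookup (b l) 0) * \<kappa> l i)" for i
    proof (cases "i < length es")
      case True
      have hk: "homogeneous (kk - es ! i) (\<kappa> l i)" if "l < m" for l using k(1)[OF that] True by (simp add: FM_def)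
      have "homogeneous (kk - es ! i) (w i)" using w True by (simp add: FM_def)
      then have "w i = hcomp (kk - es ! i) (w i)" using hcomp_homogeneous[of "kk - es ! i" "w i"] by simp
      also have "\<dots> = (\<Sum>l<m. hcomp (kk - es ! i) (\<kappa> l i * b l))" by (simp add: b hcomp_sum mult.commute)
      also have "\<dots> = (\<Sum>l<m. Const (lookup (b l) 0) * \<kappa> l i)"
      proof (rule sum.cong)
        fix l assume "l \<in> {..<m}"
        then have "hcomp (kk - es ! i) (\<kappa> l i * b l) = \<kappa> l i * hcomp 0 (b l)" using hcomp_mult[OF hk] by simp
        moreover have "hcomp 0 (b l) = Const (lookup (b l) 0)"
          using homogeneous_zero_Const[OF homogeneous_hcomp, of "b l"] by (simp add: lookup_hcomp)
        ultimately show "hcomp (kk - es ! i) (\<kappa> l i * b l) = Const (lookup (b l) 0) * \<kappa> l i" by (simp add: mult.commute)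
      qed simp
      finally show ?thesis .
    next
      case False
      then show ?thesis using w k(1) by (simp add: FM_def)
    qed
    moreover have "(\<Sum>l<m. (\<lambda>i. Const (lookup (b l) 0) * \<kappa> l i)) = (\<lambda>i. \<Sum>l<m. Const (lookup (b l) 0) * \<kappa> l i)"
      by (induction m) (auto simp: fun_eq_iff)
    ultimately have "w - (\<Sum>l<m. (\<lambda>i. Const (lookup (b l) 0) * \<kappa> l i)) = 0" by (simp add: fun_eq_iff)
    then show "\<exists>c. w - (\<Sum>l<m. (\<lambda>i. Const (c l) * \<kappa> l i)) \<in> {0}" by (intro exI[of _ "\<lambda>l. lookup (b l) 0"]) simp
  qed simp
  then have "n = card {..<m}" by (rule V.qdim_unique[OF subspace_V0 n(1)])
  then show "?p = m" using n(2) by simp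
qed

lemma koszul2_lincomb: "koszul2 g (\<lambda>i. \<Sum>l\<in>L. b l * c l i) = (\<lambda>i. \<Sum>l\<in>L. b l * koszul2 g (c l) i)"
proof (induction L rule: infinite_finite_induct)
  case (insert x L)
  have "koszul2 g (\<lambda>i. b x * c x i + 1 * (\<Sum>l\<in>L. b l * c l i)) = (\<lambda>i. b x * koszul2 g (c x) i + 1 * koszul2 g (\<lambda>i. \<Sum>l\<in>L. b l * c l i) i)"
    by (rule ext) (rule koszul2_lin)
  then show ?case using insert by simp
qed (auto simp: koszul2_def fun_eq_iff)

lemma koszul3_lincomb: "koszul3 g (\<lambda>i. \<Sum>l\<in>L. b l * c l i) = (\<lambda>i. \<Sum>l\<in>L. b l * koszul3 g (c l) i)"
proof (induction L rule: infinite_finite_induct)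
  case (insert x L)
  have "koszul3 g (\<lambda>i. b x * c x i + 1 * (\<Sum>l\<in>L. b l * c l i)) = (\<lambda>i. b x * koszul3 g (c x) i + 1 * koszul3 g (\<lambda>i. \<Sum>l\<in>L. b l * c l i) i)"
    by (rule ext) (rule koszul3_lin)
  then show ?case using insert by simp
qed (auto simp: koszul3_def fun_eq_iff)

lemma koszul_funs: "koszul2 g b \<in> funs 4" "koszul3 g c \<in> funs 6"
  by (auto simp: koszul2_def koszul3_def funs_def)

lemma grad_map_koszul1: "grad_map f v = koszul1 (\<lambda>i. pd (of_nat i) f) v"
  by (simp add: grad_map_def koszul1_def numeral_eq_Suc lessThan_Suc add_ac mult.commute)

context resolution begin

text \<open>The kernel of \<open>A\<close> is the image of \<open>B\<close>, whose entries have no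
  constant term; minimality of \<open>B\<close> thus says that the columns of \<open>A\<close> are
  minimal generators.\<close>

lemma minA: "v \<in> funs (length ds) \<Longrightarrow> mapm A v = 0 \<Longrightarrow> lookup (v i) 0 = 0"
proof -
  assume "v \<in> funs (length ds)" "mapm A v = 0"
  then obtain w where "v = mapm B w" using imB by blast
  then show ?thesis using mB by (auto simp: mapm_def minimal_mat_def lookup_sum lookup_mult_0)
qed

lemma minB: "v \<in> funs (length cs) \<Longrightarrow> mapm B v = 0 \<Longrightarrow> lookup (v i) 0 = 0"
proof -
  assume "v \<in> funs (length cs)" "mapm B v = 0"
  then obtain w where "v = mapm C w" using imC by blast
  then show ?thesis using mC by (auto simp: mapm_def minimal_mat_def lookup_sum lookup_mult_0)
qed

text \<open>The Koszul syzygies minimally generate the same module as the columns of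
  \<open>A\<close>, which determines \<open>ds\<close>. Since \<open>cs\<close> refers to relations
  between those columns, the Koszul relations must be rewritten in them before the argument is
  repeated for \<open>B\<close>.\<close>

lemma smooth_betti:
  assumes f: "homogeneous (int d) f" and d: "d \<ge> 2" and smooth: "sing_locus f = {}"
  shows "length ds = 6" "length cs = 4" "\<And>i. i < 6 \<Longrightarrow> ds ! i = int d - 1" "\<And>i. i < 4 \<Longrightarrow> cs ! i = 2 * (int d - 1)"
proof -
  define e where "e = int d - 1"
  have e: "e > 0" using d by (simp add: e_def)
  have nz: "\<exists>p\<in>jacobian_ideal f. peval w p \<noteq> 0" if w: "w \<noteq> (\<lambda>_. 0)" for w
    using proj_class_in_sing_locus[OF f _ w] d smooth pd_mem_jacobian by fastforce
  obtain N where N: "\<And>i. Var i ^ N \<in> jacobian_ideal f"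
    using projective_nullstellensatz[OF homog_ideal_jacobian[OF f] nz] by metis
  define g where "g i = pd (of_nat i) f" for i
  obtain a where "koszul_exact (\<lambda>i. pd (of_nat i) f) (\<lambda>i. Var (of_nat i) ^ N) a"
    using koszul_exact_gradient[OF N] by blast
  then interpret K: koszul_exact g "\<lambda>i. Var (of_nat i) ^ N" a by (simp add: g_def[abs_def])
  have hg: "homogeneous e (g i)" for i unfolding g_def e_def by (rule homogeneous_pd[OF f])
  have g0: "lookup (g i) 0 = 0" for i using homogeneous_pos_lookup_0[OF hg] e by simp
  have hgc: "homogeneous e (g i * p)" if "homogeneous 0 p" for i p using homogeneous_mult[OF hg that] by simp
  have k20: "lookup (koszul2 g b i) 0 = 0" for b i
    by (simp add: koszul2_def lookup_add lookup_minus lookup_mult_0 g0)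
  have k30: "lookup (koszul3 g b i) 0 = 0" for b i
    by (simp add: koszul3_def lookup_add lookup_minus lookup_mult_0 g0)
  \<comment> \<open>A constant cycle is a boundary by exactness, hence has coefficients in the
    maximal ideal, hence is zero. This is the independence of the Koszul generators over the
    constants.\<close>
  have const2: "b i = 0" if b: "\<And>i. homogeneous 0 (b i)" "koszul2 g b = (\<lambda>_. 0)" and i: "i < 6" for b i
  proof -
    obtain c where "\<And>i. i < 6 \<Longrightarrow> b i = koszul3 g c i" by (rule K.koszul3_exact[of b]) (simp add: b(2), rule that)
    then have "lookup (b i) 0 = 0" using i k30 by simp
    then show ?thesis using homogeneous_zero_Const[OF b(1), of i] by simp
  qed
  have const1: "z i = 0" if z: "\<And>i. homogeneous 0 (z i)" "koszul1 g z = 0" and i: "i < 4" for z i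
  proof -
    obtain b where "\<And>i. i < 4 \<Longrightarrow> z i = koszul2 g b i" by (rule K.koszul2_exact[OF z(2)]) (rule that)
    then have "lookup (z i) 0 = 0" using i k20 by simp
    then show ?thesis using homogeneous_zero_Const[OF z(1), of i] by simp
  qed
  have const3: "c i = 0" if c: "\<And>i. homogeneous 0 (c i)" "koszul3 g c = (\<lambda>_. 0)" and i: "i < 4" for c i
  proof -
    \<comment> \<open>Components 0 and 5 read g_2 c_0 + g_3 c_1 = 0 and g_0 c_2 + g_1 c_3 = 0; both
      are constant relations between partial derivatives, covered by \<open>const1\<close>.\<close>
    have k: "koszul3 g c n = 0" for n by (simp add: c(2))
    have "koszul1 g (\<lambda>i. if i = 2 then c 0 else if i = 3 then c 1 else 0) = 0"
      using k[of 0] by (simp add: koszul1_def koszul3_def)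
    note z = const1[OF _ this]
    have "c 0 = 0" "c 1 = 0" using z[of 2] z[of 3] c(1) by simp_all
    moreover have "koszul1 g (\<lambda>i. if i = 0 then c 2 else if i = 1 then c 3 else 0) = 0"
      using k[of 5] by (simp add: koszul1_def koszul3_def)
    note z' = const1[OF _ this]
    have "c 2 = 0" "c 3 = 0" using z'[of 0] z'[of 1] c(1) by simp_all
    ultimately show ?thesis using i by (auto simp: numeral_eq_Suc less_Suc_eq)
  qed
  have u0: "homogeneous 0 (unit_fun l i)" for l i by (simp add: unit_fun_def)
  have imA': "mapm A ` funs (length ds) = {w \<in> funs 4. koszul1 g w = 0}"
    unfolding imA grad_map_koszul1 g_def[abs_def] ..
  have k2_lincomb: "koszul2 g b = (\<lambda>i. \<Sum>l<6. b l * koszul2 g (unit_fun l) i)" if "b \<in> funs 6" for b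
    by (subst funs_eq_lincomb[OF that]) (rule koszul2_lincomb)
  have k3_lincomb: "koszul3 g c = (\<lambda>i. \<Sum>l<4. c l * koszul3 g (unit_fun l) i)" if "c \<in> funs 4" for c
    by (subst funs_eq_lincomb[OF that]) (rule koszul3_lincomb)
  have restrict: "(\<lambda>i. if i < n then b i else 0) \<in> funs n" for n and b :: "nat \<Rightarrow> poly4" by (simp add: funs_def)
  define \<kappa> where "\<kappa> l = koszul2 g (unit_fun l)" for l
  have \<kappa>FM: "\<kappa> l \<in> FM [0, 0, 0, 0] e" for l
    using hgc[OF u0] by (auto simp: \<kappa>_def FM_def koszul2_def nth_Cons' intro!: homogeneous_add homogeneous_diff)
  have \<kappa>A: "\<kappa> l \<in> mapm A ` funs (length ds)" for l
    unfolding imA' \<kappa>_def using koszul1_koszul2 koszul_funs by blast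
  have genA: "\<exists>b\<in>funs 6. w = koszul2 g b" if "w \<in> mapm A ` funs (length ds)" for w
  proof -
    have w: "w \<in> funs 4" "koszul1 g w = 0" using that imA' by auto
    obtain b where b: "\<And>i. i < 4 \<Longrightarrow> w i = koszul2 g b i" by (rule K.koszul2_exact[OF w(2)]) (rule that)
    have "w = koszul2 g b"
    proof
      fix i show "w i = koszul2 g b i"
        using b[of i] w(1) koszul_funs(1)[of g b] by (cases "i < 4") (auto simp: funs_def)
    qed
    also have "\<dots> = koszul2 g (\<lambda>i. if i < 6 then b i else 0)" by (rule koszul_cong) simp
    finally show ?thesis using restrict by blast
  qed
  have A6: "length ds = 6" and Ae: "\<And>i. i < length ds \<Longrightarrow> ds ! i = e"
  proof -
    have gen: "\<exists>b. w = (\<lambda>i. \<Sum>l<6. b l * \<kappa> l i)" if "w \<in> mapm A ` funs (length ds)" for w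
      using genA[OF that] k2_lincomb unfolding \<kappa>_def by blast
    have ind: "\<forall>l<6. c l = 0" if "(\<lambda>i. \<Sum>l<6. Const (c l) * \<kappa> l i) = (\<lambda>_. 0)" for c
    proof -
      let ?c = "\<lambda>i. if i < 6 then Const (c i) else 0"
      have "koszul2 g ?c = (\<lambda>i. \<Sum>l<6. ?c l * \<kappa> l i)" unfolding \<kappa>_def by (rule k2_lincomb[OF restrict])
      also have "\<dots> = (\<lambda>_. 0)" unfolding that[symmetric] by (intro ext sum.cong) auto
      finally have k: "koszul2 g ?c = (\<lambda>_. 0)" .
      have "?c l = 0" if "l < 6" for l by (rule const2[OF _ k that]) auto
      then show ?thesis by (metis Const_eq_0_iff)
    qed
    note G = generators_single_degree[where m = 6 and \<kappa> = \<kappa> and kk = e, OF gA]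
    show "length ds = 6" by (rule G(1)) (rule minA \<kappa>FM \<kappa>A gen ind; assumption)+
    show "ds ! i = e" if "i < length ds" for i
      by (rule G(2)[OF _ _ _ _ _ that]) (rule minA \<kappa>FM \<kappa>A gen ind; assumption)+
  qed
  have "\<exists>c. c \<in> FM ds e \<and> \<kappa> l = mapm A c" for l
  proof -
    obtain c where "\<kappa> l = mapm A c" using \<kappa>A by blast
    then have "\<kappa> l = mapm A (hcompv ds e c)" using hcompv_id[OF \<kappa>FM[of l]] hcompv_mapm[OF gA, of e c] by metis
    then show ?thesis using hcompv_in_FM by blast
  qed
  then obtain c where c: "\<And>l. c l \<in> FM ds e" "\<And>l. mapm A (c l) = \<kappa> l" by metis
  have c0: "homogeneous 0 (c l i)" for l i
    using c(1)[of l] Ae[of i] by (cases "i < length ds") (auto simp: FM_def)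
  have "\<exists>q. q \<in> funs 6 \<and> (\<forall>i. homogeneous 0 (q i)) \<and> mapm A (unit_fun l) = koszul2 g q" if l: "l < 6" for l
  proof -
    have ul: "unit_fun l \<in> FM ds e" using unit_fun_FM[of l ds] Ae[of l] A6 l by simp
    then have w: "mapm A (unit_fun l) \<in> FM [0,0,0,0] e" by (rule mapm_FM[OF gA])
    obtain b where b: "b \<in> funs 6" "mapm A (unit_fun l) = koszul2 g b" using genA ul FM_subset_funs by blast
    \<comment> \<open>In degree \<open>e\<close> only the constant parts of the coefficients
      survive, so the base change \<open>q\<close> can be taken with constant entries.\<close>
    have hk: "hcomp e (koszul2 g b i) = koszul2 g (\<lambda>i. hcomp 0 (b i)) i" for i
    proof -
      have "hcomp e (g i * p) = g i * hcomp 0 p" for i p using hcomp_mult[OF hg, of e] by simp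
      moreover have "hcomp e (- p) = - hcomp e p" for p using hcomp_diff[of e 0 p] by simp
      ultimately show ?thesis by (simp add: koszul2_def hcomp_add hcomp_diff)
    qed
    have "koszul2 g b i = koszul2 g (\<lambda>i. hcomp 0 (b i)) i" for i
    proof (cases "i < 4")
      case True
      then have "i < length [0,0,0,0::int]" by simp
      then have "homogeneous (e - [0,0,0,0] ! i) (koszul2 g b i)" using w unfolding b(2) FM_def by blast
      moreover have "[0,0,0,0::int] ! i = 0" using True by (auto simp: numeral_eq_Suc less_Suc_eq)
      ultimately show ?thesis using hk[of i] hcomp_homogeneous[of e "koszul2 g b i" e] by simp
    qed (use koszul_funs(1) in \<open>auto simp: funs_def\<close>)
    then have "mapm A (unit_fun l) = koszul2 g (\<lambda>i. hcomp 0 (b i))" unfolding b(2) by (rule ext)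
    moreover have "(\<lambda>i. hcomp 0 (b i)) \<in> funs 6" using b(1) by (simp add: funs_def)
    ultimately show ?thesis using homogeneous_hcomp by blast
  qed
  then obtain q where q: "\<And>l. l < 6 \<Longrightarrow> q l \<in> funs 6" "\<And>l i. l < 6 \<Longrightarrow> homogeneous 0 (q l i)"
    "\<And>l. l < 6 \<Longrightarrow> mapm A (unit_fun l) = koszul2 g (q l)" by metis
  \<comment> \<open>\<open>P\<close> rewrites Koszul coordinates in the given generators and
    \<open>Q\<close> goes back. Both have constant entries, so their composites differ from the
    identity by constant relations, which vanish by \<open>minA\<close> and \<open>const2\<close>;
    hence they are mutually inverse.\<close>
  define P where "P b = (\<lambda>i. \<Sum>l<6. b l * c l i)" for b :: "nat \<Rightarrow> poly4"
  define Q where "Q v = (\<lambda>i. \<Sum>l<6. v l * q l i)" for v :: "nat \<Rightarrow> poly4"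
  have Pf: "P b \<in> funs 6" for b using c(1) A6 by (auto simp: P_def funs_def FM_def)
  have Qf: "Q b \<in> funs 6" for b using q(1) by (auto simp: Q_def funs_def)
  have P0: "homogeneous 0 (P b i)" if "\<And>l. homogeneous 0 (b l)" for b i
    unfolding P_def by (intro homogeneous_sum) (use homogeneous_mult[OF that c0] in simp)
  have Q0: "homogeneous 0 (Q b i)" if "\<And>l. homogeneous 0 (b l)" for b i
    unfolding Q_def by (intro homogeneous_sum) (use homogeneous_mult[OF that q(2)] in simp)
  have AP: "mapm A (P b) = koszul2 g b" if "b \<in> funs 6" for b
    unfolding P_def mapm_lincomb c(2) \<kappa>_def by (rule k2_lincomb[OF that, symmetric])
  have KQ: "koszul2 g (Q v) = mapm A v" if "v \<in> funs 6" for v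
  proof -
    have "mapm A v = (\<lambda>i. \<Sum>l<6. v l * mapm A (unit_fun l) i)" by (subst funs_eq_lincomb[OF that]) (rule mapm_lincomb)
    also have "\<dots> = koszul2 g (Q v)" unfolding Q_def koszul2_lincomb using q(3) by (intro ext sum.cong) auto
    finally show ?thesis by simp
  qed
  have P_lincomb: "P (\<lambda>i. \<Sum>l\<in>L. b l * x l i) = (\<lambda>i. \<Sum>l\<in>L. b l * P (x l) i)" for L :: "nat set" and b x
    unfolding P_def sum_distrib_left sum_distrib_right by (subst sum.swap) (simp add: mult.assoc)
  have Q_lincomb: "Q (\<lambda>i. \<Sum>l\<in>L. b l * x l i) = (\<lambda>i. \<Sum>l\<in>L. b l * Q (x l) i)" for L :: "nat set" and b x
    unfolding Q_def sum_distrib_left sum_distrib_right by (subst sum.swap) (simp add: mult.assoc)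
  have uf: "unit_fun l \<in> funs 6" if "l < 6" for l using that by (simp add: unit_fun_def funs_def)
  have PQ1: "P (Q (unit_fun l)) = unit_fun l" if l: "l < 6" for l
  proof -
    have v: "P (Q (unit_fun l)) - unit_fun l \<in> funs (length ds)"
      using Pf[of "Q (unit_fun l)"] uf[OF l] A6 by (auto simp: funs_def)
    have "mapm A (P (Q (unit_fun l)) - unit_fun l) = 0"
      by (simp add: mapm.g_diff AP[OF Qf] KQ[OF uf[OF l]])
    then have "lookup ((P (Q (unit_fun l)) - unit_fun l) i) 0 = 0" for i using minA[OF v] by blast
    moreover have "homogeneous 0 ((P (Q (unit_fun l)) - unit_fun l) i)" for i
      using homogeneous_diff[OF P0[OF Q0[OF u0]] u0] by simp
    ultimately have "(P (Q (unit_fun l)) - unit_fun l) i = 0" for i by (metis homogeneous_zero_Const Const_0)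
    then show ?thesis by (simp add: fun_eq_iff)
  qed
  have PQ: "P (Q v) = v" if "v \<in> funs 6" for v
  proof -
    have "P (Q v) = P (\<lambda>i. \<Sum>l<6. v l * Q (unit_fun l) i)"
      by (subst funs_eq_lincomb[OF that], subst Q_lincomb) (rule refl)
    also have "\<dots> = (\<lambda>i. \<Sum>l<6. v l * P (Q (unit_fun l)) i)" by (rule P_lincomb)
    also have "\<dots> = (\<lambda>i. \<Sum>l<6. v l * unit_fun l i)" using PQ1 by (intro ext sum.cong) auto
    finally show ?thesis using funs_eq_lincomb[OF that] by simp
  qed
  have QP1: "Q (P (unit_fun l)) = unit_fun l" if l: "l < 6" for l
  proof -
    let ?v = "\<lambda>i. 1 * Q (P (unit_fun l)) i + (- 1) * unit_fun l i"
    have "koszul2 g ?v = (\<lambda>_. 0)"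
      unfolding fun_eq_iff koszul2_lin by (simp add: KQ[OF Pf] AP[OF uf[OF l]])
    moreover have "homogeneous 0 (?v i)" for i using homogeneous_diff[OF Q0[OF P0[OF u0]] u0] by simp
    ultimately have "?v i = 0" if "i < 6" for i using const2[of ?v i] that by blast
    moreover have "?v i = 0" if "\<not> i < 6" for i using that Qf uf[OF l] by (simp add: funs_def)
    ultimately have "?v i = 0" for i by (cases "i < 6") blast+
    then show ?thesis by (intro ext) simp
  qed
  have QP: "Q (P v) = v" if "v \<in> funs 6" for v
  proof -
    have "Q (P v) = Q (\<lambda>i. \<Sum>l<6. v l * P (unit_fun l) i)"
      by (subst funs_eq_lincomb[OF that], subst P_lincomb) (rule refl)
    also have "\<dots> = (\<lambda>i. \<Sum>l<6. v l * Q (P (unit_fun l)) i)" by (rule Q_lincomb)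
    also have "\<dots> = (\<lambda>i. \<Sum>l<6. v l * unit_fun l i)" using QP1 by (intro ext sum.cong) auto
    finally show ?thesis using funs_eq_lincomb[OF that] by simp
  qed
  \<comment> \<open>The Koszul relations between the Koszul syzygies, carried by \<open>P\<close> to
    relations between the columns of \<open>A\<close>.\<close>
  define \<mu> where "\<mu> l = P (koszul3 g (unit_fun l))" for l
  have \<mu>FM: "\<mu> l \<in> FM ds (2 * e)" for l
  proof -
    have k3e: "homogeneous e (koszul3 g (unit_fun l) i)" for i
      using hgc[OF u0] by (auto simp: koszul3_def intro!: homogeneous_add homogeneous_diff)
    have "homogeneous e (\<mu> l i)" for i
      unfolding \<mu>_def P_def by (intro homogeneous_sum) (use homogeneous_mult[OF k3e c0] in simp)
    then show ?thesis using Pf Ae A6 by (auto simp: FM_def \<mu>_def funs_def)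
  qed
  have \<mu>B: "\<mu> l \<in> mapm B ` funs (length cs)" for l
    unfolding imB \<mu>_def using Pf A6 AP[OF koszul_funs(2)] by (simp add: koszul2_koszul3 zero_fun_def)
  have genB: "\<exists>b. w = (\<lambda>i. \<Sum>l<4. b l * \<mu> l i)" if "w \<in> mapm B ` funs (length cs)" for w
  proof -
    have w: "w \<in> funs 6" "mapm A w = 0" using that imB A6 by auto
    have "koszul2 g (Q w) i = 0" for i unfolding KQ[OF w(1)] w(2) by simp
    then obtain z where z: "\<And>i. i < 6 \<Longrightarrow> Q w i = koszul3 g z i" using K.koszul3_exact[of "Q w"] by blast
    let ?z = "\<lambda>i. if i < 4 then z i else 0"
    have "koszul3 g ?z = koszul3 g z" by (rule koszul_cong) simp
    then have "Q w = koszul3 g ?z"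
      using z Qf[of w] koszul_funs(2)[of g ?z] by (auto simp: fun_eq_iff funs_def not_less[symmetric]) (metis not_less)
    also have "\<dots> = (\<lambda>i. \<Sum>l<4. ?z l * koszul3 g (unit_fun l) i)" by (rule k3_lincomb[OF restrict])
    finally have "w = P (\<lambda>i. \<Sum>l<4. ?z l * koszul3 g (unit_fun l) i)" using PQ[OF w(1)] by simp
    then have "w = (\<lambda>i. \<Sum>l<4. ?z l * \<mu> l i)" unfolding P_lincomb \<mu>_def .
    then show ?thesis by (rule exI[of _ ?z])
  qed
  have indB: "\<forall>l<4. b l = 0" if eq: "(\<lambda>i. \<Sum>l<4. Const (b l) * \<mu> l i) = (\<lambda>_. 0)" for b
  proof -
    let ?c = "\<lambda>i. if i < 4 then Const (b i) else 0"
    have "P (koszul3 g ?c) = (\<lambda>i. \<Sum>l<4. ?c l * \<mu> l i)"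
      unfolding \<mu>_def by (subst k3_lincomb[OF restrict]) (rule P_lincomb)
    also have "\<dots> = (\<lambda>_. 0)" unfolding eq[symmetric] by (intro ext sum.cong) auto
    finally have "koszul3 g ?c = Q (\<lambda>_. 0)" using QP[OF koszul_funs(2)[of g ?c]] by simp
    then have k: "koszul3 g ?c = (\<lambda>_. 0)" by (simp add: Q_def)
    have "?c l = 0" if "l < 4" for l by (rule const3[OF _ k that]) auto
    then show ?thesis by (metis Const_eq_0_iff)
  qed
  note G = generators_single_degree[where m = 4 and \<kappa> = \<mu> and kk = "2 * e", OF gB]
  have B: "length cs = 4" by (rule G(1)) (rule minB \<mu>FM \<mu>B genB indB; assumption)+
  have B': "cs ! i = 2 * e" if "i < length cs" for i
    by (rule G(2)[OF _ _ _ _ _ that]) (rule minB \<mu>FM \<mu>B genB indB; assumption)+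
  show "length ds = 6" "length cs = 4" "\<And>i. i < 6 \<Longrightarrow> ds ! i = int d - 1" "\<And>i. i < 4 \<Longrightarrow> cs ! i = 2 * (int d - 1)"
    using A6 Ae B B' by (auto simp: e_def)
qed

end

context resolution begin

lemma smooth_iff:
  assumes f: "homogeneous (int d) f" and d: "d \<ge> 2" and sf: "squarefree f"
  shows "sing_locus f = {} \<longleftrightarrow> length ds = 6 \<and> length cs = 4 \<and> length bs = 1 \<and>
    (\<forall>i<6. ds ! i = int d - 1) \<and> (\<forall>j<4. cs ! j = 2 * (int d - 1)) \<and> bs ! 0 = 3 * (int d - 1)"
    (is "_ \<longleftrightarrow> ?betti")
proof -
  let ?e = "int d - 1" and ?J = "jacobian_ideal f"
  have d0: "d > 0" using d by simp
  have lists: "ds = replicate 6 ?e \<and> cs = replicate 4 (2 * ?e)"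
    if "length ds = 6" "length cs = 4" "\<forall>i<6. ds ! i = ?e" "\<forall>j<4. cs ! j = 2 * ?e"
    using that by (auto intro: nth_equalityI)
  show ?thesis
  proof
    assume smooth: "sing_locus f = {}"
    note S = smooth_betti[OF f d smooth]
    have l: "ds = replicate 6 ?e" "cs = replicate 4 (2 * ?e)" using lists S by simp_all
    \<comment> \<open>The count 6 - 4 + r = 3 gives r = 1, and the degree sum 6e - 8e + b = e gives
      b = 3e.\<close>
    have "int (length bs) = 1" using betti_identities(1)[OF f d0 sf] S(1,2) by (simp add: alt_sum_0)
    then obtain b where b: "bs = [b]" by (auto simp: length_Suc_conv)
    have "b = 3 * ?e" using betti_identities(2)[OF f d0 sf] unfolding alt_sum_def l b by (simp add: numeral_eq_Suc)
    then show ?betti using S b by simp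
  next
    assume betti: ?betti
    have l: "ds = replicate 6 ?e" "cs = replicate 4 (2 * ?e)" using lists betti by simp_all
    obtain b where b: "bs = [b]" using betti by (auto simp: length_Suc_conv)
    then have b3: "b = 3 * ?e" using betti by simp
    have rep: "(\<Sum>x\<leftarrow>replicate m y. x ^ n) = int m * y ^ n" for m n and y :: int
      by (induction m) (simp_all add: algebra_simps)
    have Q2: "?e ^ 2 + alt_sum 2 ds cs bs = 0"
      unfolding alt_sum_def l b rep b3 by (simp add: power2_eq_square algebra_simps)
    have Q3: "?e ^ 3 - alt_sum 3 ds cs bs = 0"
      unfolding alt_sum_def l b rep b3 by (simp add: power3_eq_cube algebra_simps)
    \<comment> \<open>For the Koszul degrees the Hilbert function vanishes from some degree on. In
      one such degree the Jacobian ideal contains a power of every variable, so it has no projective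
      zero.\<close>
    have "6 * int (HF ?J (kmin + (d - 1))) = 0"
      using six_HF'[OF f d0 sf order_refl] unfolding Q2 using Q3 by simp
    then have sub: "forms (int (kmin + (d - 1))) \<subseteq> ?J" using HF_eq_0_iff[OF ideal4_jacobian] by simp
    show "sing_locus f = {}"
    proof (rule equals0I)
      fix x assume x: "x \<in> sing_locus f"
      obtain i where i: "rep x i \<noteq> 0" using rep_nonzero[OF sing_locus_P3[OF x]] by (auto simp: fun_eq_iff)
      have "Var i ^ (kmin + (d - 1)) \<in> forms (int (kmin + (d - 1)))"
        using homogeneous_power[OF homogeneous_Var[of i], of "kmin + (d - 1)"] by simp
      then have "Var i ^ (kmin + (d - 1)) \<in> ?J" using sub by blast
      moreover have "\<forall>p\<in>?J. peval (rep x) p = 0" using zero_locus_jacobian sing_locus_rep[OF x] by blast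
      ultimately have "peval (rep x) (Var i ^ (kmin + (d - 1))) = 0" by blast
      then show False using i by (simp add: peval.hom_power)
    qed
  qed
qed

lemma six_total_tjurina:
  assumes f: "homogeneous (int d) f" and d: "d > 0" and sf: "squarefree f" and fin: "finite (sing_locus f)"
  shows "6 * int (total_tjurina f) = (int d - 1)^3 - alt_sum 3 ds cs bs"
proof -
  obtain K where K: "\<And>k. k \<ge> K \<Longrightarrow> HF (jacobian_ideal f) k = total_tjurina f"
    using HF_eq_total_tjurina[OF f d fin] by blast
  have A: "(int d - 1)^2 + alt_sum 2 ds cs bs = 0" using isolated_iff[OF f d sf] fin by simp
  have "HF (jacobian_ideal f) (kmin + K + (d - 1)) = total_tjurina f" by (rule K) simp
  then show ?thesis using six_HF'[OF f d sf, of "kmin + K"] unfolding A by simp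
qed

end

theorem theorem1p1:
  fixes f :: poly4 and d :: nat and ds cs bs :: "int list"
  assumes "d \<ge> 3"
    and "homogeneous (int d) f"
    and "squarefree f"
    and "graded_betti f ds cs bs"
    and "length ds \<ge> 3"
  shows
    "(length ds + length bs = length cs + 3 \<and>
      (\<Sum>x\<leftarrow>ds. x) - (\<Sum>x\<leftarrow>cs. x) + (\<Sum>x\<leftarrow>bs. x) = int d - 1)
   \<and> ((isolated_singularities f \<longleftrightarrow>
        (int d - 1)^2 + (\<Sum>x\<leftarrow>ds. x^2) - (\<Sum>x\<leftarrow>cs. x^2) + (\<Sum>x\<leftarrow>bs. x^2) = 0) \<and>
      (isolated_singularities f \<longrightarrow>
        6 * int (total_tjurina f) =
          (int d - 1)^3 - (\<Sum>x\<leftarrow>ds. x^3) + (\<Sum>x\<leftarrow>cs. x^3) - (\<Sum>x\<leftarrow>bs. x^3)))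
   \<and> (smooth_surface f \<longleftrightarrow>
        length ds = 6 \<and> length cs = 4 \<and> length bs = 1 \<and>
        (\<forall>i<6. ds ! i = int d - 1) \<and> (\<forall>j<4. cs ! j = 2 * (int d - 1)) \<and>
        bs ! 0 = 3 * (int d - 1))
   \<and> (has_dimension (sing_locus f) 1 \<longrightarrow>
        (let Q2 = of_int ((\<Sum>x\<leftarrow>ds. x^2) - (\<Sum>x\<leftarrow>cs. x^2) + (\<Sum>x\<leftarrow>bs. x^2)) :: rat;
             Q3 = of_int ((\<Sum>x\<leftarrow>ds. x^3) - (\<Sum>x\<leftarrow>cs. x^3) + (\<Sum>x\<leftarrow>bs. x^3)) :: rat;
             D = of_nat d :: rat;
             A = (D - 1)^2 + Q2;
             B = (D * (D - 3)^2 - 4) / 3 + (D - 3) / 2 * Q2 + Q3 / 6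
         in \<forall>u. poly (hilbert_poly f) u = A / 2 * u - B))"
proof -
  obtain A B C where "resolution f ds cs bs A B C" using graded_betti_resolution[OF assms(4)] by blast
  then interpret resolution f ds cs bs A B C .
  note f = assms(2) and sf = assms(3)
  have d: "d > 0" "d \<ge> 2" using assms(1) by simp_all
  have "length ds + length bs = length cs + 3"
    using betti_identities(1)[OF f d(1) sf] unfolding alt_sum_0 by linarith
  moreover have "(\<Sum>x\<leftarrow>ds. x) - (\<Sum>x\<leftarrow>cs. x) + (\<Sum>x\<leftarrow>bs. x) = int d - 1"
    using betti_identities(2)[OF f d(1) sf] unfolding alt_sum_def by simp
  moreover have "isolated_singularities f \<longleftrightarrow>
      (int d - 1)^2 + (\<Sum>x\<leftarrow>ds. x^2) - (\<Sum>x\<leftarrow>cs. x^2) + (\<Sum>x\<leftarrow>bs. x^2) = 0"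
    unfolding isolated_singularities_def isolated_iff[OF f d(1) sf] alt_sum_def by linarith
  moreover have "isolated_singularities f \<longrightarrow> 6 * int (total_tjurina f) =
      (int d - 1)^3 - (\<Sum>x\<leftarrow>ds. x^3) + (\<Sum>x\<leftarrow>cs. x^3) - (\<Sum>x\<leftarrow>bs. x^3)"
    using six_total_tjurina[OF f d(1) sf] unfolding isolated_singularities_def alt_sum_def by linarith
  moreover note smooth_iff[OF f d(2) sf, folded smooth_surface_def]
  \<comment> \<open>The constant terms agree since \<open>6 - 3 * (d - 1) = - 3 * (d - 3)\<close>
    and (d - 1)^2 (d - 4) = d (d - 3)^2 - 4.\<close>
  moreover have "let Q2 = of_int ((\<Sum>x\<leftarrow>ds. x^2) - (\<Sum>x\<leftarrow>cs. x^2) + (\<Sum>x\<leftarrow>bs. x^2)) :: rat;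
             Q3 = of_int ((\<Sum>x\<leftarrow>ds. x^3) - (\<Sum>x\<leftarrow>cs. x^3) + (\<Sum>x\<leftarrow>bs. x^3)) :: rat;
             D = of_nat d :: rat;
             A = (D - 1)^2 + Q2;
             B = (D * (D - 3)^2 - 4) / 3 + (D - 3) / 2 * Q2 + Q3 / 6
         in \<forall>u. poly (hilbert_poly f) u = A / 2 * u - B"
    unfolding Let_def alt_sum_def[symmetric] hilbert_poly_eq[OF f d(1) sf]
    by (simp add: field_simps power2_eq_square power3_eq_cube)
  ultimately show ?thesis by blast
qed

end
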